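(* Let $F : [0,\rho)^m \to \mathbb{R}$, where $m \geq 1$ is an integer and $0 < \rho \leq \infty$, and fix $\mathbf{y} = (y_1,\ldots,y_m)^T \in \mathcal{Y}_m$. The following are equivalent. (1) $F[-]$ maps $\mathcal{M}^\rho(\{1,y_1\}) \times \cdots \times \mathcal{M}^\rho(\{1,y_m\}) \cup \mathcal{M}^\rho(\{0,1\})^m$ into $\mathcal{M}(\mathbb{R})$, and \[ F((a_1,\dots,a_m))\, F((b_1,\dots,b_m)) \geq F\left( (\sqrt{a_1 b_1}, \dots, \sqrt{a_m b_m}) \right)^2 \] for all $a_1,\ldots,a_m, b_1,\ldots,b_m \in [0,\rho)$. (2) $F[-]$ maps $\mathcal{M}^\rho([0,1])^m$ into $\mathcal{M}([0,1])$. (3) $F$ is facewise absolutely monotonic, and the associated functions $\{ g_J : J \subset [m] \}$ satisfy the monotonicity condition \[ K \subset J \subset [m] \quad \Longrightarrow \quad 0 \leq \widetilde{g}_K \leq \widetilde{g}_J \quad \text{on } [0,\rho)^K. \]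
   Context: $\mathcal{Y}_m$ is the set of all $\mathbf{y} = (y_1,\dots,y_m)^T \in (0,1)^m$ such that the scalars $\mathbf{y}^\alpha := \prod_{l=1}^m y_l^{\alpha_l}$ are distinct for all $\alpha \in \mathbb{Z}_+^m$, where $\mathbb{Z}_+ = \{0,1,2,\dots\}$. An admissible measure is a non-negative measure $\mu$ on $\mathbb{R}$ possessing moments of all orders; its moments are $s_k(\mu) := \int_{\mathbb{R}} x^k \, d\mu$ ($k \geq 0$), where $s_0(\mu)$ is the total mass, and $\mathbf{s}(\mu) := (s_k(\mu))_{k \geq 0}$. For $K \subset \mathbb{R}$, $\mathcal{M}(K)$ is the set of moment sequences of admissible measures supported on $K$, and $\mathcal{M}^\rho(K)$ is the subset of those sequences all of whose terms lie in $(-\rho,\rho)$. $F$ acts on $m$-tuples of moment sequences by $F[\mathbf{s}(\mu_1),\dots,\mathbf{s}(\mu_m)]_k := F(s_k(\mu_1),\dots,s_k(\mu_m))$ for $k \geq 0$. A function $G$ on a set $I' \subset \mathbb{R}^n$ is absolutely monotonic if it is continuous on $I'$ and, at every interior point of $I'$ and for every $\alpha \in \mathbb{Z}_+^n$, the mixed partial derivative $D^\alpha G$ exists and is non-negative. Let $[m] := \{1,\dots,m\}$. For $J \subset [m]$, $[0,\rho)^J$ denotes the face $\{(x_1,\dots,x_m) \in [0,\rho)^m : x_l = 0 \text{ for all } l \notin J\}$, whose relative interior is $(0,\rho)^J \times \{0\}^{[m] \setminus J}$, identified with $(0,\rho)^J$. The function $F : [0,\rho)^m \to \mathbb{R}$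 is facewise absolutely monotonic if for each $J \subset [m]$ it agrees on $(0,\rho)^J \times \{0\}^{[m]\setminus J}$ with an absolutely monotonic function $g_J$ on $(0,\rho)^J$ (for $J = \emptyset$, $g_\emptyset$ is the constant $F(0,\dots,0)$, required to be non-negative). Each such $g_J$ extends to an absolutely monotonic function on $[0,\rho)^J$, denoted $\widetilde{g}_J$. When $K \subset J$, $[0,\rho)^K$ is regarded as a subset of $[0,\rho)^J$. *)

theory Defs
  imports "HOL-Analysis.Analysis"
begin

(* The index set [m] is a finite type 'm (nonempty, as every type is), so that m = CARD('m). *)

definition multiplicatively_generic :: "(real ^ 'm) set" where
  "multiplicatively_generic =
     {y. (\<forall>l. 0 < y $ l \<and> y $ l < 1) \<and>
         inj (\<lambda>\<alpha> :: 'm \<Rightarrow> nat. \<Prod>l\<in>UNIV. (y $ l) ^ \<alpha> l)}"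


subsection \<open>Moment sequences\<close>

definition admissible :: "real measure \<Rightarrow> bool" where
  "admissible \<mu> \<longleftrightarrow> sets \<mu> = sets borel \<and> (\<forall>k::nat. integrable \<mu> (\<lambda>x. x ^ k))"

definition moments :: "real measure \<Rightarrow> nat \<Rightarrow> real" where
  "moments \<mu> k = (\<integral>x. x ^ k \<partial>\<mu>)"

(* "Supported on K" means that almost every point lies in K; for closed K this says
   that the topological support is contained in K. *)
definition moment_seqs :: "real set \<Rightarrow> (nat \<Rightarrow> real) set" where
  "moment_seqs K = {moments \<mu> |\<mu>. admissible \<mu> \<and> (AE x in \<mu>. x \<in> K)}"

definition bounded_moment_seqs :: "ereal \<Rightarrow> real set \<Rightarrow> (nat \<Rightarrow> real) set" where
  "bounded_moment_seqs \<rho> K =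
     {s \<in> moment_seqs K. \<forall>k. - \<rho> < ereal (s k) \<and> ereal (s k) < \<rho>}"

(* F is a total function standing for a function on [0,rho)^m. Measures on [0,1] with
   moments below rho have all their moments in [0,rho), so only those values matter. *)
definition entrywise :: "(real ^ 'm \<Rightarrow> real) \<Rightarrow> ('m \<Rightarrow> nat \<Rightarrow> real) \<Rightarrow> nat \<Rightarrow> real" where
  "entrywise F s k = F (\<chi> l. s l k)"


subsection \<open>Absolutely monotonic functions\<close>

(* R^J, for a set J of indices, is the subspace of vectors vanishing off J. Faces of the
   cube and the functions on them live in the same type for all J, so the inclusion of
   [0,rho)^K in [0,rho)^J for K <= J is the identity. *)
definition coord_space :: "'m set \<Rightarrow> (real ^ 'm) set" where
  "coord_space J = {x. \<forall>l. l \<notin> J \<longrightarrow> x $ l = 0}"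

definition partial_deriv :: "'m \<Rightarrow> (real ^ 'm \<Rightarrow> real) \<Rightarrow> real ^ 'm \<Rightarrow> real" where
  "partial_deriv l G x = deriv (\<lambda>t. G (x + t *\<^sub>R axis l 1)) 0"

definition partially_differentiable :: "'m \<Rightarrow> (real ^ 'm \<Rightarrow> real) \<Rightarrow> real ^ 'm \<Rightarrow> bool" where
  "partially_differentiable l G x \<longleftrightarrow> (\<lambda>t. G (x + t *\<^sub>R axis l 1)) field_differentiable at 0"

(* A list ls in which each l occurs alpha_l times encodes the mixed partial derivative
   D^alpha together with an order of differentiation (last entry first). *)
primrec mixed_partial :: "'m list \<Rightarrow> (real ^ 'm \<Rightarrow> real) \<Rightarrow> real ^ 'm \<Rightarrow> real" where
  "mixed_partial [] G = G"
| "mixed_partial (l # ls) G = partial_deriv l (mixed_partial ls G)"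

(* Absolute monotonicity on a set S, regarded as a subset of R^J: the interior is the one
   relative to R^J and only the coordinates in J are differentiated. Mixed partial
   derivatives are required to exist, and to be non-negative, in every order of
   differentiation. *)
definition absolutely_monotonic_on ::
    "'m set \<Rightarrow> (real ^ 'm) set \<Rightarrow> (real ^ 'm \<Rightarrow> real) \<Rightarrow> bool" where
  "absolutely_monotonic_on J S G \<longleftrightarrow>
     continuous_on S G \<and>
     (\<forall>x \<in> (top_of_set (coord_space J)) interior_of S. \<forall>ls \<in> lists J.
        (\<forall>l\<in>J. partially_differentiable l (mixed_partial ls G) x) \<and>
        0 \<le> mixed_partial ls G x)"


subsection \<open>Facewise absolute monotonicity\<close>

definition face :: "ereal \<Rightarrow> 'm set \<Rightarrow> (real ^ 'm) set" where
  "face \<rho> J = {x \<in> coord_space J. \<forall>l. 0 \<le> x $ l \<and> ereal (x $ l) < \<rho>}"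

abbreviation cube :: "ereal \<Rightarrow> (real ^ 'm) set" where
  "cube \<rho> \<equiv> face \<rho> UNIV"

definition open_face :: "ereal \<Rightarrow> 'm set \<Rightarrow> (real ^ 'm) set" where
  "open_face \<rho> J = {x \<in> coord_space J. \<forall>l\<in>J. 0 < x $ l \<and> ereal (x $ l) < \<rho>}"

(* For J = {} this says that g {} takes the non-negative value F 0 at the origin. *)
definition facewise_absolutely_monotonic ::
    "ereal \<Rightarrow> (real ^ 'm \<Rightarrow> real) \<Rightarrow> ('m set \<Rightarrow> real ^ 'm \<Rightarrow> real) \<Rightarrow> bool" where
  "facewise_absolutely_monotonic \<rho> F g \<longleftrightarrow>
     (\<forall>J. absolutely_monotonic_on J (open_face \<rho> J) (g J) \<and>
          (\<forall>x \<in> open_face \<rho> J. F x = g J x))"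

(* An absolutely monotonic function on the open face J always has such an extension, and,
   by continuity, its values on the face J are unique. *)
definition face_extension ::
    "ereal \<Rightarrow> 'm set \<Rightarrow> (real ^ 'm \<Rightarrow> real) \<Rightarrow> real ^ 'm \<Rightarrow> real" where
  "face_extension \<rho> J g =
     (SOME h. absolutely_monotonic_on J (face \<rho> J) h \<and> (\<forall>x \<in> open_face \<rho> J. h x = g x))"

end

theory Submission
  imports Defs "HOL-Probability.Probability" "HOL-Computational_Algebra.Polynomial"
begin

text \<open>
An absolutely monotonic function is, in essence, a power series with non-negative coefficients,
and a monomial sends moment sequences of measures on \<open>[0,1]\<close> to the moment sequence
of the image of the product measure under multiplication. So absolutely monotonic functions
preserve moment sequences, and the converse is Schoenberg's and Loewner's theme: if
\<open>F\<close> turns the sequences \<open>a\<^sub>l + \<epsilon> y\<^sub>l\<^sup>k\<close>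
into moment sequences, then \<open>0 \<le> \<integral> p\<^sup>2\<close> for the resulting
measure and every real polynomial \<open>p\<close>. Expanding in \<open>\<epsilon>\<close>, the
monomial of exponent \<open>\<alpha>\<close> of the Taylor expansion of \<open>F\<close> at
\<open>a\<close> contributes the \<open>\<alpha>\<close>-th derivative times
\<open>p(y\<^sup>\<alpha>)\<^sup>2\<close>. As the numbers \<open>y\<^sup>\<alpha>\<close> are
distinct, \<open>p\<close> can be chosen to kill all other terms up to the order of
\<open>\<alpha>\<close>, so that the \<open>\<alpha>\<close>-th derivative is non-negative.

Neither power series nor smoothness is available a priori, and the notion that mediates between
all the conditions is that iterated differences are non-negative (\<open>nonneg_diffs\<close>).
It passes to pointwise limits and does not mention derivatives.

\<^item> For continuous functions it is equivalent to absolute monotonicity on open faces. One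
  direction is the mean value theorem (\<open>absolutely_monotonic_imp_nonneg_diffs\<close>). In
  the other direction (\<open>nonneg_diffs_imp_absolutely_monotonic\<close>), non-negative
  differences of orders one, two and three make a function of one real variable differentiable,
  and the partial derivatives again have non-negative differences.

\<^item> On a closed box it implies that a continuous function is a limit of polynomials with
  non-negative coefficients, because these coefficients are differences when Bernstein
  polynomials are used in one variable at a time
  (\<open>nonneg_diffs_imp_pos_poly_limit\<close>). From such limits one reads off monotonicity,
  the inequality with geometric means (Cauchy-Schwarz), and that completely monotone sequences
  are mapped to completely monotone sequences. By Hausdorff's theorem
  (\<open>Hausdorff_moment\<close>) these are the moment sequences of measures on
  \<open>[0,1]\<close>.

\<^item> The argument with the polynomial \<open>p\<close> applies to functions with enough
  derivatives. Averaging over short segments in the coordinate directions produces these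
  derivatives and keeps the positivity; letting the lengths tend to zero gives non-negative
  differences for every continuous function with this positivity
  (\<open>square_positive_imp_nonneg_diffs\<close>).

Continuity of \<open>F\<close> on open faces and its monotonicity on the cube come from measures
on \<open>{0,1}\<close> and from the inequality \<open>F(r c)\<^sup>2 \<le> F(c) F(r\<^sup>2
c)\<close> on rays. The latter is a special case of the inequality in the first condition, and
it follows from the second one by applying \<open>F\<close> to measures with a single atom at
\<open>r\<close>. Monotonicity of \<open>F\<close> compares the extensions of its restrictions
to different faces. Conversely, a sequence of moments on \<open>[0,1]\<close> has all its terms
of positive order in one open face \<open>K\<close>, and only its term of order zero may lie in
a larger open face \<open>J\<close>. The comparison of the extensions from \<open>K\<close> and
\<open>J\<close> says that the excess at order zero is non-negative, so it is an additional mass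
at the origin.
\<close>


section \<open>Iterated differences\<close>

abbreviation ax :: "'m \<Rightarrow> real ^ 'm" where "ax l \<equiv> axis l 1"

text \<open>An entry \<open>(l, h)\<close> of the list is a difference with step \<open>h\<close> in the
\<open>l\<close>-th coordinate. If no coordinate is repeated, then the points of evaluation are
the vertices of the box with opposite corners \<open>x\<close> and \<open>x + reach ps\<close>.\<close>

primrec iter_diff :: "('m \<times> real) list \<Rightarrow> (real ^ 'm \<Rightarrow> real) \<Rightarrow> real ^ 'm \<Rightarrow> real" where
  "iter_diff [] f x = f x"
| "iter_diff (p # ps) f x = iter_diff ps f (x + snd p *\<^sub>R ax (fst p)) - iter_diff ps f x"

definition reach :: "('m \<times> real) list \<Rightarrow> real ^ 'm" where
  "reach ps = (\<Sum>p\<leftarrow>ps. snd p *\<^sub>R ax (fst p))"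

lemma reach_simps [simp]: "reach [] = 0" "reach (p # ps) = snd p *\<^sub>R ax (fst p) + reach ps"
  by (simp_all add: reach_def)

text \<open>An iterated difference whose two extreme points \<open>x\<close> and \<open>x + reach ps\<close>
lie in an order-convex set evaluates the function inside this set only.\<close>

definition order_convex :: "(real ^ 'm) set \<Rightarrow> bool" where
  "order_convex S \<longleftrightarrow> (\<forall>x\<in>S. \<forall>z\<in>S. {x..z} \<subseteq> S)"

text \<open>Absolute monotonicity without derivatives. This form is stable under pointwise limits.\<close>

definition nonneg_diffs :: "'m set \<Rightarrow> (real ^ 'm) set \<Rightarrow> (real ^ 'm \<Rightarrow> real) \<Rightarrow> bool" where
  "nonneg_diffs J S f \<longleftrightarrow>
     (\<forall>ps x. set ps \<subseteq> J \<times> {0..} \<longrightarrow> x \<in> S \<longrightarrow> x + reach ps \<in> S \<longrightarrow> 0 \<le> iter_diff ps f x)"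

lemma order_convexD: "order_convex S \<Longrightarrow> x \<in> S \<Longrightarrow> z \<in> S \<Longrightarrow> x \<le> w \<Longrightarrow> w \<le> z \<Longrightarrow> w \<in> S"
  unfolding order_convex_def by (meson atLeastAtMost_iff subsetD)

lemma order_convex_product:
  assumes "\<And>l a b c. a \<in> I l \<Longrightarrow> b \<in> I l \<Longrightarrow> a \<le> c \<Longrightarrow> c \<le> b \<Longrightarrow> c \<in> I l"
  shows "order_convex {x. \<forall>l. x $ l \<in> I l}"
  unfolding order_convex_def
proof (intro ballI subsetI)
  fix x z w assume "x \<in> {x. \<forall>l. x $ l \<in> I l}" "z \<in> {x. \<forall>l. x $ l \<in> I l}" "w \<in> {x..z}"
  then have "w $ l \<in> I l" for l
    using assms[of "x $ l" l "z $ l" "w $ l"] by (simp add: less_eq_vec_def)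
  then show "w \<in> {x. \<forall>l. x $ l \<in> I l}"
    by simp
qed

lemma ax_nonneg: "0 \<le> t \<Longrightarrow> 0 \<le> t *\<^sub>R ax l"
  by (simp add: less_eq_vec_def axis_def)

lemma ax_mono: "s \<le> t \<Longrightarrow> s *\<^sub>R ax l \<le> t *\<^sub>R ax l"
  by (simp add: less_eq_vec_def axis_def)

lemma reach_nonneg: "set ps \<subseteq> J \<times> {0..} \<Longrightarrow> 0 \<le> reach ps"
proof (induction ps)
  case (Cons p ps)
  then show ?case
    using add_nonneg_nonneg[OF ax_nonneg[of "snd p" "fst p"], of "reach ps"] by auto
qed simp

lemma order_convex_between:
  assumes "order_convex S" "x \<in> S" "x + (u + v) \<in> S" "0 \<le> u" "0 \<le> v"
  shows "x + u \<in> S" "x + v \<in> S"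
proof -
  have "x \<le> x + u" "x + u \<le> x + (u + v)" "x \<le> x + v" "x + v \<le> x + (u + v)"
    using assms(4,5) by (simp_all add: less_eq_vec_def)
  then show "x + u \<in> S" "x + v \<in> S"
    using order_convexD[OF assms(1-3)] by blast+
qed

lemma step_in_domain:
  assumes S: "order_convex S" and "set (p # ps) \<subseteq> J \<times> {0..}" "x \<in> S" "x + reach (p # ps) \<in> S"
  shows "x + snd p *\<^sub>R ax (fst p) \<in> S" "x + reach ps \<in> S"
    "x + snd p *\<^sub>R ax (fst p) + reach ps \<in> S"
proof -
  have "0 \<le> snd p *\<^sub>R ax (fst p)" "0 \<le> reach ps"
    using assms(2) ax_nonneg[of "snd p" "fst p"] reach_nonneg[of ps J] by auto
  then show "x + snd p *\<^sub>R ax (fst p) \<in> S" "x + reach ps \<in> S"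
    using order_convex_between[OF S assms(3)] assms(4) by (metis reach_simps(2))+
  show "x + snd p *\<^sub>R ax (fst p) + reach ps \<in> S"
    using assms(4) by (simp add: add.assoc)
qed

lemma iter_diff_difference:
  "iter_diff ps (\<lambda>z. f (z + v) - f z) x = iter_diff ps f (x + v) - iter_diff ps f x"
  by (induction ps arbitrary: x) (simp_all add: algebra_simps)

lemma iter_diff_Cons_swap: "iter_diff (p # ps) f x = iter_diff ps (\<lambda>z. f (z + snd p *\<^sub>R ax (fst p)) - f z) x"
  by (simp add: iter_diff_difference)

lemma iter_diff_scale: "iter_diff ps (\<lambda>z. c * f z) x = c * iter_diff ps f x"
  by (induction ps arbitrary: x) (simp_all add: algebra_simps)

lemma iter_diff_translate: "iter_diff ps (\<lambda>z. f (z + v)) x = iter_diff ps f (x + v)"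
  by (induction ps arbitrary: x) (simp_all add: algebra_simps)

lemma iter_diff_tendsto:
  assumes S: "order_convex S"
    and lim: "\<And>z. z \<in> S \<Longrightarrow> ((\<lambda>n. f n z) \<longlongrightarrow> g z) F"
    and "set ps \<subseteq> J \<times> {0..}" "x \<in> S" "x + reach ps \<in> S"
  shows "((\<lambda>n. iter_diff ps (f n) x) \<longlongrightarrow> iter_diff ps g x) F"
  using assms(3-)
proof (induction ps arbitrary: x)
  case (Cons p ps)
  note dom = step_in_domain[OF S Cons.prems]
  have ps: "set ps \<subseteq> J \<times> {0..}" using Cons.prems(1) by simp
  show ?case
    using tendsto_diff[OF Cons.IH[OF ps dom(1,3)] Cons.IH[OF ps Cons.prems(2) dom(2)]] by simp
qed (use lim in simp)

lemma iter_diff_cong: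
  assumes S: "order_convex S" and "\<And>z. z \<in> S \<Longrightarrow> f z = g z"
    and "set ps \<subseteq> J \<times> {0..}" "x \<in> S" "x + reach ps \<in> S"
  shows "iter_diff ps f x = iter_diff ps g x"
  using assms(3-)
proof (induction ps arbitrary: x)
  case (Cons p ps)
  note dom = step_in_domain[OF S Cons.prems]
  have ps: "set ps \<subseteq> J \<times> {0..}" using Cons.prems(1) by simp
  show ?case
    using Cons.IH[OF ps dom(1,3)] Cons.IH[OF ps Cons.prems(2) dom(2)] by simp
qed (use assms(2) in simp)

text \<open>For fixed \<open>ps\<close> and \<open>x\<close> only finitely many points of evaluation matter.
So each difference of the approximating functions may become non-negative in its own time, which
is what happens when a shift has to be small enough to stay in a domain.\<close>

lemma nonneg_diffs_limit:
  assumes "order_convex S" "\<And>z. z \<in> S \<Longrightarrow> ((\<lambda>n. f n z) \<longlongrightarrow> g z) F" "F \<noteq> bot"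
    and ev: "\<And>ps x. set ps \<subseteq> J \<times> {0..} \<Longrightarrow> x \<in> S \<Longrightarrow> x + reach ps \<in> S \<Longrightarrow>
                 \<forall>\<^sub>F n in F. 0 \<le> iter_diff ps (f n) x"
  shows "nonneg_diffs J S g"
  unfolding nonneg_diffs_def
  using tendsto_lowerbound[OF iter_diff_tendsto[OF assms(1,2)] ev \<open>F \<noteq> bot\<close>] by blast

lemma DERIV_along_axis_shift:
  assumes "((\<lambda>s. f (x + t *\<^sub>R ax l + s *\<^sub>R ax l)) has_real_derivative D) (at 0)"
  shows "((\<lambda>s. f (x + s *\<^sub>R ax l)) has_real_derivative D) (at t)"
proof -
  have "(\<lambda>s. f (x + t *\<^sub>R ax l + s *\<^sub>R ax l)) = (\<lambda>s. f (x + (s + t) *\<^sub>R ax l))"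
    by (simp add: algebra_simps)
  then show ?thesis
    using assms DERIV_shift[of "\<lambda>s. f (x + s *\<^sub>R ax l)" D 0 t] by simp
qed

lemma iter_diff_has_derivative:
  assumes S: "order_convex S"
    and D: "\<And>x. x \<in> S \<Longrightarrow> ((\<lambda>t. f (x + t *\<^sub>R ax l)) has_real_derivative f' x) (at 0)"
    and "set ps \<subseteq> J \<times> {0..}" "x \<in> S" "x + reach ps \<in> S"
  shows "((\<lambda>t. iter_diff ps f (x + t *\<^sub>R ax l)) has_real_derivative iter_diff ps f' x) (at 0)"
  using assms(3-)
proof (induction ps arbitrary: x)
  case (Cons p ps)
  note dom = step_in_domain[OF S Cons.prems]
  have ps: "set ps \<subseteq> J \<times> {0..}" using Cons.prems(1) by simp
  show ?case
    using DERIV_diff[OF Cons.IH[OF ps dom(1,3)] Cons.IH[OF ps Cons.prems(2) dom(2)]]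
    by (simp add: add_ac)
qed (use D in simp)

text \<open>A difference is non-decreasing along a coordinate axis when the same difference of the partial
derivative is non-negative, so one entry of the list is traded for one derivative. The number
\<open>n\<close> in \<open>P n f\<close> is a supply of derivatives. It makes the lemma
applicable to functions of finite smoothness, too.\<close>

lemma derivatives_nonneg_imp_diffs_nonneg:
  assumes S: "order_convex S"
    and nonneg: "\<And>n f x. P n f \<Longrightarrow> x \<in> S \<Longrightarrow> 0 \<le> f x"
    and deriv: "\<And>n f l. P (Suc n) f \<Longrightarrow> l \<in> J \<Longrightarrow> \<exists>f'. P n f' \<and>
        (\<forall>x\<in>S. ((\<lambda>t. f (x + t *\<^sub>R ax l)) has_real_derivative f' x) (at 0))"
    and "P (length ps) f" "set ps \<subseteq> J \<times> {0..}" "x \<in> S" "x + reach ps \<in> S"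
  shows "0 \<le> iter_diff ps f x"
  using assms(4-)
proof (induction ps arbitrary: f x)
  case (Cons p ps)
  obtain l h where p: "p = (l, h)" "l \<in> J" "0 \<le> h"
    using Cons.prems(2) by (cases p) auto
  have ps: "set ps \<subseteq> J \<times> {0..}" and r: "0 \<le> reach ps"
    using Cons.prems(2) reach_nonneg[of ps J] by auto
  obtain f' where f': "P (length ps) f'"
    "\<And>x. x \<in> S \<Longrightarrow> ((\<lambda>t. f (x + t *\<^sub>R ax l)) has_real_derivative f' x) (at 0)"
    using deriv[of "length ps" f l] Cons.prems(1) p(2) by auto
  have "iter_diff ps f (x + 0 *\<^sub>R ax l) \<le> iter_diff ps f (x + h *\<^sub>R ax l)"
  proof (rule DERIV_nonneg_imp_nondecreasing[OF p(3)])
    fix t assume t: "0 \<le> t" "t \<le> h"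
    have le: "x \<le> x + t *\<^sub>R ax l" "x + t *\<^sub>R ax l \<le> x + reach (p # ps)"
      "x \<le> x + t *\<^sub>R ax l + reach ps" "x + t *\<^sub>R ax l + reach ps \<le> x + reach (p # ps)"
      using r ax_mono[OF t(1), of l] ax_mono[OF t(2), of l] p(1)
      by (simp_all add: less_eq_vec_def add_increasing2)
    have in_S: "x + t *\<^sub>R ax l \<in> S" "x + t *\<^sub>R ax l + reach ps \<in> S"
      using order_convexD[OF S Cons.prems(3,4)] le by blast+
    show "\<exists>y. ((\<lambda>t. iter_diff ps f (x + t *\<^sub>R ax l)) has_real_derivative y) (at t) \<and> 0 \<le> y"
      using DERIV_along_axis_shift[OF iter_diff_has_derivative[OF S f'(2) ps in_S]]
        Cons.IH[OF f'(1) ps in_S] by blast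
  qed
  then show ?case
    by (simp add: p)
qed (use nonneg in simp)


section \<open>Completely monotone sequences and the Hausdorff moment problem\<close>

definition bdiff :: "(nat \<Rightarrow> real) \<Rightarrow> nat \<Rightarrow> real" where
  "bdiff s k = s k - s (Suc k)"

definition completely_monotone :: "(nat \<Rightarrow> real) \<Rightarrow> bool" where
  "completely_monotone s \<longleftrightarrow> (\<forall>n k. 0 \<le> (bdiff ^^ n) s k)"

lemma bdiff_pow_Suc: "(bdiff ^^ Suc n) s k = (bdiff ^^ n) s k - (bdiff ^^ n) s (Suc k)"
  by (simp add: bdiff_def)

lemma bdiff_pow_shift: "(bdiff ^^ n) (\<lambda>k. s (Suc k)) k = (bdiff ^^ n) s (Suc k)"
  by (induction n arbitrary: k) (simp_all add: bdiff_def)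

lemma completely_monotone_shift:
  "completely_monotone s \<Longrightarrow> completely_monotone (\<lambda>k. s (Suc k))"
  by (simp add: completely_monotone_def bdiff_pow_shift)

lemma completely_monotone_bdiff: "completely_monotone s \<Longrightarrow> completely_monotone (bdiff s)"
  unfolding completely_monotone_def by (metis comp_apply funpow_Suc_right)

lemma completely_monotone_nonneg: "completely_monotone s \<Longrightarrow> 0 \<le> s k"
  unfolding completely_monotone_def by (metis funpow_0)

lemma completely_monotone_Suc_le: "completely_monotone s \<Longrightarrow> s (Suc k) \<le> s k"
  using completely_monotone_nonneg[OF completely_monotone_bdiff, of s k] by (simp add: bdiff_def)

lemma completely_monotone_le_0: "completely_monotone s \<Longrightarrow> s k \<le> s 0"
  by (induction k) (auto intro: order_trans completely_monotone_Suc_le)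

lemma completely_monotone_add:
  assumes "completely_monotone s" "completely_monotone t"
  shows "completely_monotone (\<lambda>k. s k + t k)"
proof -
  have "(bdiff ^^ n) (\<lambda>k. s k + t k) k = (bdiff ^^ n) s k + (bdiff ^^ n) t k" for n k
    by (induction n arbitrary: k) (simp_all add: bdiff_def)
  then show ?thesis
    using assms by (simp add: completely_monotone_def)
qed

lemma completely_monotone_const:
  assumes "0 \<le> c"
  shows "completely_monotone (\<lambda>_. c)"
proof -
  have "0 \<le> (bdiff ^^ n) (\<lambda>_. c) k \<and> (bdiff ^^ n) (\<lambda>_. c) k = (bdiff ^^ n) (\<lambda>_. c) (Suc k)" for n k
    by (induction n arbitrary: k) (use assms in \<open>simp_all add: bdiff_def\<close>)
  then show ?thesis
    by (simp add: completely_monotone_def)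
qed

text \<open>By the product rule, the difference of \<open>s t\<close> is a sum of two products of completely
monotone sequences, to which differences of lower order remain to be applied.\<close>

lemma completely_monotone_mult:
  assumes "completely_monotone s" "completely_monotone t"
  shows "completely_monotone (\<lambda>k. s k * t k)"
proof -
  have "0 \<le> (bdiff ^^ n) (\<lambda>k. s k * t k) k" for n k
    using assms
  proof (induction n arbitrary: s t k)
    case (Suc n)
    have sum: "(bdiff ^^ n) (\<lambda>k. u k + v k) k = (bdiff ^^ n) u k + (bdiff ^^ n) v k" for u v k
      by (induction n arbitrary: k) (simp_all add: bdiff_def)
    have "bdiff (\<lambda>k. s k * t k) = (\<lambda>k. bdiff s k * t k + s (Suc k) * bdiff t k)"
      by (simp add: bdiff_def fun_eq_iff algebra_simps)
    then have "(bdiff ^^ Suc n) (\<lambda>k. s k * t k) k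
        = (bdiff ^^ n) (\<lambda>k. bdiff s k * t k) k + (bdiff ^^ n) (\<lambda>k. s (Suc k) * bdiff t k) k"
      by (simp add: funpow_Suc_right sum del: funpow.simps)
    then show ?case
      using Suc.IH[of "bdiff s" t] Suc.IH[of "\<lambda>k. s (Suc k)" "bdiff t"] Suc.prems
        completely_monotone_bdiff completely_monotone_shift by auto
  qed (simp add: completely_monotone_nonneg)
  then show ?thesis
    by (simp add: completely_monotone_def)
qed

lemma completely_monotone_limit:
  assumes "\<And>n. completely_monotone (s n)" "\<And>k. (\<lambda>n. s n k) \<longlonglongrightarrow> t k"
  shows "completely_monotone t"
proof -
  have "(\<lambda>n. (bdiff ^^ j) (s n) k) \<longlonglongrightarrow> (bdiff ^^ j) t k" for j k
    by (induction j arbitrary: k) (use assms(2) in \<open>auto simp: bdiff_def intro!: tendsto_diff\<close>)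
  then show ?thesis
    using assms(1) unfolding completely_monotone_def by (blast intro: LIMSEQ_le_const)
qed

text \<open>The moment sequence of a point mass at the origin.\<close>

lemma completely_monotone_single:
  assumes "0 \<le> c"
  shows "completely_monotone (\<lambda>k. if k = 0 then c else 0)"
proof -
  have "(bdiff ^^ n) (\<lambda>k. if k = 0 then c else 0) k = (if k = 0 then c else 0)" for n k
    by (induction n arbitrary: k) (simp_all add: bdiff_def)
  then show ?thesis
    using assms by (simp add: completely_monotone_def)
qed

text \<open>The \<open>n\<close>-th difference of the moments at \<open>k\<close> is the integral of
\<open>x\<^sup>k (1 - x)\<^sup>n\<close>.\<close>

lemma completely_monotone_moments:
  assumes "s \<in> moment_seqs {0..1}"
  shows "completely_monotone s"
proof -
  obtain \<mu> where \<mu>: "s = moments \<mu>" "admissible \<mu>" "AE x in \<mu>. x \<in> {0..1}"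
    using assms by (auto simp: moment_seqs_def)
  have "integrable \<mu> (\<lambda>x. x ^ k * (1 - x) ^ n) \<and>
      (bdiff ^^ n) s k = (\<integral>x. x ^ k * (1 - x) ^ n \<partial>\<mu>)" for n k
  proof (induction n arbitrary: k)
    case 0
    show ?case
      using \<mu>(2) by (simp add: \<mu>(1) moments_def admissible_def)
  next
    case (Suc n)
    have "(\<lambda>x::real. x ^ k * (1 - x) ^ Suc n) = (\<lambda>x. x ^ k * (1 - x) ^ n - x ^ Suc k * (1 - x) ^ n)"
      by (simp add: fun_eq_iff algebra_simps)
    then show ?case
      using Suc[of k] Suc[of "Suc k"] by (simp add: bdiff_pow_Suc del: funpow.simps power_Suc)
  qed
  moreover have "0 \<le> (\<integral>x. x ^ k * (1 - x) ^ n \<partial>\<mu>)" for n k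
    by (rule integral_nonneg_AE) (use \<mu>(3) in eventually_elim, simp)
  ultimately show ?thesis
    by (simp add: completely_monotone_def)
qed

lemma sum_choose_Suc:
  fixes g :: "nat \<Rightarrow> real"
  shows "(\<Sum>j\<le>Suc n. (Suc n choose j) * g j)
       = (\<Sum>j\<le>n. (n choose j) * g j) + (\<Sum>j\<le>n. (n choose j) * g (Suc j))"
proof -
  have "(\<Sum>j\<le>n. (n choose j) * g j) = (\<Sum>j\<le>Suc n. (n choose j) * g j)"
    by simp
  also have "\<dots> = g 0 + (\<Sum>j\<le>n. (n choose Suc j) * g (Suc j))"
    by (subst sum.atMost_Suc_shift) simp
  finally show ?thesis
    by (subst sum.atMost_Suc_shift) (simp add: sum.distrib algebra_simps del: sum.atMost_Suc)
qed

text \<open>The sum of the difference operator and the shift is the identity, and this is the binomial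
expansion of its \<open>m\<close>-th power.\<close>

lemma sum_choose_bdiff:
  "(\<Sum>j\<le>m. (m choose j) * (bdiff ^^ (m - j)) s (k + j)) = s k"
proof (induction m arbitrary: s k)
  case (Suc m)
  have 1: "(\<Sum>j\<le>m. (m choose j) * (bdiff ^^ (Suc m - j)) s (k + j)) = bdiff s k"
    unfolding Suc[of "bdiff s" k, symmetric]
    by (intro sum.cong refl) (simp add: Suc_diff_le funpow_Suc_right del: funpow.simps)
  have 2: "(\<Sum>j\<le>m. (m choose j) * (bdiff ^^ (Suc m - Suc j)) s (k + Suc j)) = s (Suc k)"
    using Suc[of s "Suc k"] by simp
  show ?case
    unfolding sum_choose_Suc 1 2 by (simp add: bdiff_def)
qed simp

text \<open>If \<open>s\<close> consists of the moments of a measure, then \<open>(n choose i) * (bdiff ^^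
(n - i)) s i\<close> is the integral of the \<open>i\<close>-th Bernstein polynomial of degree
\<open>n\<close>, and \<open>(i choose k) / (n choose k)\<close> is the coefficient of this
polynomial in the expansion of \<open>x\<^sup>k\<close>.\<close>

lemma factorial_moment:
  assumes "k \<le> n"
  shows "(\<Sum>i\<le>n. (n choose i) * (bdiff ^^ (n - i)) s i * ((i choose k) / (n choose k))) = s k"
proof -
  have "(\<Sum>i\<le>n. (n choose i) * (bdiff ^^ (n - i)) s i * ((i choose k) / (n choose k)))
      = (\<Sum>i\<in>{k..n}. (n choose i) * (bdiff ^^ (n - i)) s i * ((i choose k) / (n choose k)))"
    by (rule sum.mono_neutral_right) auto
  also have "\<dots> = (\<Sum>i\<in>{k..n}. ((n - k) choose (i - k)) * (bdiff ^^ (n - i)) s i)"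
  proof (rule sum.cong[OF refl])
    fix i assume "i \<in> {k..n}"
    then have "real (n choose i) * real (i choose k) = real (n choose k) * real ((n - k) choose (i - k))"
      using choose_mult[of k i n] by (simp flip: of_nat_mult)
    moreover have "real (n choose k) \<noteq> 0"
      using assms by simp
    ultimately show "(n choose i) * (bdiff ^^ (n - i)) s i * ((i choose k) / (n choose k))
        = ((n - k) choose (i - k)) * (bdiff ^^ (n - i)) s i"
      by (simp add: field_simps)
  qed
  also have "\<dots> = (\<Sum>j\<le>n - k. ((n - k) choose j) * (bdiff ^^ (n - k - j)) s (k + j))"
    by (rule sum.reindex_bij_witness[of _ "\<lambda>j. k + j" "\<lambda>i. i - k"]) (use assms in auto)
  finally show ?thesis
    using sum_choose_bdiff[of "n - k" s k] by (simp only:)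
qed

text \<open>Both numbers are products of \<open>k\<close> factors of modulus at most one, and corresponding
factors differ by at most \<open>k / (n - k)\<close>.\<close>

lemma choose_quotient_approx:
  assumes "2 * k \<le> n" "0 < n" "i \<le> n"
  shows "\<bar>(i choose k) / (n choose k) - (i / n) ^ k\<bar> \<le> k * k / (n - k)"
proof -
  have pos: "j < k \<Longrightarrow> real j < real n" for j
    using assms by simp
  have "(i choose k) / (n choose k) = (\<Prod>j\<in>{0..<k}. (real i - real j) / (real n - real j))"
    by (simp add: binomial_gbinomial gbinomial_prod_rev prod_dividef)
  moreover have "(i / n) ^ k = (\<Prod>j\<in>{0..<k}. real i / real n)"
    by simp
  moreover have "norm ((\<Prod>j\<in>{0..<k}. (real i - real j) / (real n - real j)) - (\<Prod>j\<in>{0..<k}. real i / real n))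
      \<le> (\<Sum>j\<in>{0..<k}. norm ((real i - real j) / (real n - real j) - real i / real n))"
  proof (rule norm_prod_diff)
    fix j assume j: "j \<in> {0..<k}"
    then have "\<bar>real i - real j\<bar> \<le> real n - real j"
      using assms by auto
    then show "norm ((real i - real j) / (real n - real j)) \<le> 1"
      using j assms by (auto simp: divide_le_eq)
    show "norm (real i / real n) \<le> 1"
      using assms by simp
  qed
  moreover have "(\<Sum>j\<in>{0..<k}. norm ((real i - real j) / (real n - real j) - real i / real n))
      \<le> (\<Sum>j\<in>{0..<k}. k / (n - k))"
  proof (rule sum_mono)
    fix j assume j: "j \<in> {0..<k}"
    have "(real i - real j) / (real n - real j) - real i / real n
        = - ((real j / (real n - real j)) * ((real n - real i) / real n))"
      using j assms pos[of j] by (simp add: field_simps)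
    then have "norm ((real i - real j) / (real n - real j) - real i / real n)
        = (real j / (real n - real j)) * ((real n - real i) / real n)"
      using j assms by (simp add: abs_mult)
    also have "\<dots> \<le> (real k / (real n - real k)) * 1"
      using j assms by (intro mult_mono frac_le) auto
    finally show "norm ((real i - real j) / (real n - real j) - real i / real n) \<le> k / (n - k)"
      using assms by (simp add: of_nat_diff)
  qed
  ultimately show ?thesis
    using assms by simp
qed

text \<open>The discrete measure with these weights at the points \<open>i / n\<close> has almost the right
moments: replacing the power \<open>(i / n)\<^sup>k\<close> by the quotient of binomial
coefficients makes the sum exact.\<close>

lemma bernstein_weights_moments:
  assumes s: "completely_monotone s"
  shows "(\<lambda>n. \<Sum>i\<le>n. (n choose i) * (bdiff ^^ (n - i)) s i * (i / n) ^ k) \<longlonglongrightarrow> s k"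
proof (rule LIM_zero_cancel, rule Lim_null_comparison)
  define w where "w n i = (n choose i) * (bdiff ^^ (n - i)) s i" for n i
  have w: "0 \<le> w n i" for n i
    using s by (simp add: w_def completely_monotone_def)
  have sum_w: "(\<Sum>i\<le>n. w n i) = s 0" for n
    using sum_choose_bdiff[of n s 0] by (simp add: w_def)
  show "\<forall>\<^sub>F n in sequentially.
      norm ((\<Sum>i\<le>n. (n choose i) * (bdiff ^^ (n - i)) s i * (i / n) ^ k) - s k) \<le> s 0 * (k * k / (n - k))"
    using eventually_ge_at_top[of "2 * k + 1"]
  proof eventually_elim
    case (elim n)
    have "(\<Sum>i\<le>n. w n i * (i / n) ^ k) - s k
        = (\<Sum>i\<le>n. w n i * ((i / n) ^ k - (i choose k) / (n choose k)))"
      using elim by (subst factorial_moment[of k n s, symmetric])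
        (simp_all add: w_def right_diff_distrib sum_subtractf)
    also have "norm \<dots> \<le> (\<Sum>i\<le>n. w n i * (k * k / (n - k)))"
    proof (rule order_trans[OF norm_sum], rule sum_mono)
      fix i assume "i \<in> {..n}"
      then have "\<bar>(i / n) ^ k - (i choose k) / (n choose k)\<bar> \<le> k * k / (n - k)"
        using choose_quotient_approx[of k n i] elim by (simp add: abs_minus_commute)
      then show "norm (w n i * ((i / n) ^ k - (i choose k) / (n choose k))) \<le> w n i * (k * k / (n - k))"
        using mult_left_mono[OF _ w[of n i]] w[of n i] by (simp only: real_norm_def abs_mult abs_of_nonneg)
    qed
    also have "\<dots> = s 0 * (k * k / (n - k))"
      by (simp only: sum_w flip: sum_distrib_right)
    finally show ?case
      by (simp add: w_def)
  qed
  have "(\<lambda>n. s 0 * (real (k * k) / real (n + k - k))) \<longlonglongrightarrow> 0"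
    by (simp add: tendsto_mult_right_zero lim_const_over_n del: of_nat_mult)
  then show "(\<lambda>n. s 0 * (real (k * k) / real (n - k))) \<longlonglongrightarrow> 0"
    by (rule LIMSEQ_offset)
qed

text \<open>After normalisation the discrete measures with Bernstein weights at \<open>i / n\<close> are
probability measures on \<open>[0,1]\<close>. By Helly's theorem a subsequence converges weakly,
and its limit has the prescribed moments.\<close>

theorem Hausdorff_moment:
  assumes s: "completely_monotone s"
  shows "s \<in> moment_seqs {0..1}"
proof (cases "s 0 = 0")
  case True
  then have "s k = 0" for k
    using completely_monotone_nonneg[OF s, of k] completely_monotone_le_0[OF s, of k] by simp
  then have "s = moments (null_measure borel)"
    by (simp add: moments_def fun_eq_iff)
  moreover have "admissible (null_measure borel)" "AE x in null_measure borel. x \<in> {0..1::real}"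
    by (simp_all add: admissible_def integrable_iff_bounded AE_iff_null null_sets_def)
  ultimately show ?thesis
    by (auto simp: moment_seqs_def)
next
  case False
  then have s0: "0 < s 0"
    using completely_monotone_nonneg[OF s, of 0] by simp
  define w where "w n i = (n choose i) * (bdiff ^^ (n - i)) s i / s 0" for n i
  have w: "0 \<le> w n i" for n i
    using s s0 by (simp add: w_def completely_monotone_def)
  have sum_w: "(\<Sum>i\<le>n. w n i) = 1" for n
    using sum_choose_bdiff[of n s 0] s0 by (simp add: w_def flip: sum_divide_distrib)
  define \<mu> where "\<mu> n = distr (point_measure {..n} (w n)) borel (\<lambda>i. real i / real n)" for n
  have meas: "f \<in> measurable (point_measure {..n} (w n)) borel" for n and f :: "nat \<Rightarrow> real"
    by (simp add: measurable_def space_point_measure sets_point_measure)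
  have integral: "(\<integral>x. f x \<partial>\<mu> n) = (\<Sum>i\<le>n. w n i * f (i / n))"
    if "f \<in> borel_measurable borel" for f :: "real \<Rightarrow> real" and n
    using that meas w unfolding \<mu>_def
    by (subst integral_distr) (simp_all add: lebesgue_integral_point_measure_finite)
  have prob: "prob_space (\<mu> n)" for n
    unfolding \<mu>_def
  proof (rule prob_space.prob_space_distr[OF _ meas])
    show "prob_space (point_measure {..n} (w n))"
      by (rule prob_spaceI)
        (simp add: space_point_measure emeasure_point_measure_finite w sum_w sum_ennreal)
  qed
  have real_distr: "real_distribution (\<mu> n)" for n
    using prob[of n] by (simp add: real_distribution_def real_distribution_axioms_def \<mu>_def)
  have "measure (\<mu> n) {-1<..1} = 1" for n
  proof -
    have "measure (\<mu> n) {-1<..1} = (\<integral>x. indicator {-1<..1} x \<partial>\<mu> n)"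
      by (simp add: \<mu>_def)
    also have "\<dots> = (\<Sum>i\<le>n. w n i)"
      by (subst integral) (auto intro!: sum.cong simp: indicator_def divide_le_eq
          less_le_trans[of "-1" 0])
    finally show ?thesis
      by (simp add: sum_w)
  qed
  then have "tight \<mu>"
    unfolding tight_def using real_distr
    by (intro conjI allI impI exI[of _ "-1"] exI[of _ 1]) auto
  then obtain r M where r: "strict_mono (r :: nat \<Rightarrow> nat)" and M: "real_distribution M"
    and weak: "weak_conv_m (\<mu> \<circ> id \<circ> r) M"
    using tight_imp_convergent_subsubsequence[of \<mu> id] by (auto simp: strict_mono_id)
  interpret M: real_distribution M by (fact M)
  have conv: "(\<lambda>n. \<integral>x. f x \<partial>\<mu> (r n)) \<longlonglongrightarrow> (\<integral>x. f x \<partial>M)"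
    if "\<And>x. isCont f x" "\<And>x. norm (f x) \<le> 1" for f :: "real \<Rightarrow> real"
  proof -
    show ?thesis
      using weak_conv_imp_integral_bdd_continuous_conv[of "\<mu> \<circ> id \<circ> r" M f 1] real_distr M weak that
      by (simp add: o_def)
  qed
  define clip :: "real \<Rightarrow> real" where "clip x = max 0 (min 1 x)" for x
  have clip: "0 \<le> clip x" "clip x \<le> 1" "isCont clip x" for x
  proof -
    have "clip = (\<lambda>x. max 0 (min 1 x))"
      by (simp add: clip_def fun_eq_iff)
    then show "isCont clip x"
      by (auto intro!: continuous_intros)
  qed (auto simp: clip_def)
  have clip_id: "clip x = x" if "0 \<le> x" "x \<le> 1" for x
    using that by (simp add: clip_def)
  have cont_meas: "f \<in> borel_measurable borel" if "\<And>x. isCont f x" for f :: "real \<Rightarrow> real"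
    using that by (intro borel_measurable_continuous_onI continuous_at_imp_continuous_on) auto
  \<comment> \<open>A bounded continuous function that vanishes exactly on the unit interval detects the support of the limit.\<close>
  have "(\<integral>x. min 1 \<bar>x - clip x\<bar> \<partial>M) = 0"
  proof (rule LIMSEQ_unique)
    have c: "isCont (\<lambda>x. min 1 \<bar>x - clip x\<bar>) x" for x
      using clip by (auto intro!: continuous_intros)
    then show "(\<lambda>n. \<integral>x. min 1 \<bar>x - clip x\<bar> \<partial>\<mu> (r n)) \<longlonglongrightarrow> (\<integral>x. min 1 \<bar>x - clip x\<bar> \<partial>M)"
      by (intro conv) auto
    have "(\<integral>x. min 1 \<bar>x - clip x\<bar> \<partial>\<mu> n) = 0" for n
      using cont_meas[OF c] by (simp add: integral clip_id divide_le_eq)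
    then show "(\<lambda>n. \<integral>x. min 1 \<bar>x - clip x\<bar> \<partial>\<mu> (r n)) \<longlonglongrightarrow> 0"
      by simp
  qed
  moreover have "integrable M (\<lambda>x. min 1 \<bar>x - clip x\<bar>)"
  proof (rule M.integrable_const_bound[of _ 1])
    have "isCont (\<lambda>x. min 1 \<bar>x - clip x\<bar>) x" for x
      using clip by (intro continuous_intros)
    from cont_meas[OF this] show "(\<lambda>x. min 1 \<bar>x - clip x\<bar>) \<in> borel_measurable M"
      by (simp add: measurable_cong_sets[OF M.events_eq_borel refl])
  qed simp
  ultimately have "AE x in M. min 1 \<bar>x - clip x\<bar> = 0"
    by (subst (asm) integral_nonneg_eq_0_iff_AE) auto
  then have supp: "AE x in M. x \<in> {0..1}"
  proof eventually_elim
    case (elim x)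
    then have "x = clip x"
      by (simp add: min_def split: if_splits)
    then show ?case
      using clip[of x] by simp
  qed
  have mom: "(\<integral>x. x ^ k \<partial>M) = s k / s 0" and int: "integrable M (\<lambda>x. x ^ k)" for k
  proof -
    have "(\<integral>x. x ^ k \<partial>M) = (\<integral>x. clip x ^ k \<partial>M)"
      using supp by (intro integral_cong_AE) (auto simp: clip_def)
    also have "\<dots> = s k / s 0"
    proof (rule LIMSEQ_unique)
      have c: "isCont (\<lambda>x. clip x ^ k) x" for x
        using clip by (auto intro!: continuous_intros)
      then show "(\<lambda>n. \<integral>x. clip x ^ k \<partial>\<mu> (r n)) \<longlonglongrightarrow> (\<integral>x. clip x ^ k \<partial>M)"
        using clip by (intro conv) (auto simp: power_le_one)
      have "(\<integral>x. clip x ^ k \<partial>\<mu> n) = (\<Sum>i\<le>n. (n choose i) * (bdiff ^^ (n - i)) s i * (i / n) ^ k) / s 0" for n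
        using cont_meas[OF c] by (simp add: integral clip_id divide_le_eq w_def sum_divide_distrib)
      then show "(\<lambda>n. \<integral>x. clip x ^ k \<partial>\<mu> (r n)) \<longlonglongrightarrow> s k / s 0"
        using LIMSEQ_subseq_LIMSEQ[OF tendsto_divide[OF bernstein_weights_moments[OF s, of k] tendsto_const] r] s0
        by (simp add: o_def)
    qed
    finally show "(\<integral>x. x ^ k \<partial>M) = s k / s 0" .
    show "integrable M (\<lambda>x. x ^ k)"
    proof (rule M.integrable_const_bound[of _ 1])
      show "AE x in M. norm (x ^ k) \<le> 1"
        using supp by eventually_elim (simp add: power_le_one)
    qed simp
  qed
  define \<nu> where "\<nu> = density M (\<lambda>_. ennreal (s 0))"
  have "s = moments \<nu>"
    using s0 by (simp add: fun_eq_iff moments_def \<nu>_def integral_density mom)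
  moreover have "admissible \<nu>"
    using s0 int by (simp add: admissible_def \<nu>_def integrable_density)
  moreover have "AE x in \<nu>. x \<in> {0..1}"
    unfolding \<nu>_def by (subst AE_density) (auto intro: eventually_mono[OF supp])
  ultimately show ?thesis
    by (auto simp: moment_seqs_def)
qed


section \<open>Limits of polynomials with non-negative coefficients\<close>

definition proj :: "'m set \<Rightarrow> real ^ 'm \<Rightarrow> real ^ 'm" where
  "proj J x = (\<chi> l. if l \<in> J then x $ l else 0)"

lemma proj_nth [simp]: "proj J x $ l = (if l \<in> J then x $ l else 0)"
  by (simp add: proj_def)

lemma proj_add: "proj J (x + y) = proj J x + proj J y"
  by (simp add: vec_eq_iff)

lemma proj_idem: "proj J (proj J x) = proj J x"
  by (simp add: vec_eq_iff)

lemma proj_reach: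
  assumes "set ps \<subseteq> J \<times> {0..}"
  shows "proj J (reach ps) = reach ps"
proof -
  have "reach ps $ l = 0" if "l \<notin> J" for l
    using assms by (induction ps) (use that in \<open>auto simp: axis_def\<close>)
  then show ?thesis
    by (simp add: vec_eq_iff)
qed

lemma continuous_on_proj [continuous_intros]:
  "continuous_on S f \<Longrightarrow> continuous_on S (\<lambda>x. proj J (f x))"
  unfolding proj_def
proof (intro continuous_on_vec_lambda)
  show "continuous_on S (\<lambda>x. if l \<in> J then f x $ l else 0)" if "continuous_on S f" for l
    using that by (cases "l \<in> J") (auto intro!: continuous_intros)
qed

lemma iter_diff_append: "iter_diff (ps @ qs) f x = iter_diff ps (iter_diff qs f) x"
  by (induction ps arbitrary: x) simp_all

lemma iter_diff_proj:
  assumes "set ps \<subseteq> J \<times> {0..}"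
  shows "iter_diff ps (\<lambda>x. f (proj J x)) x = iter_diff ps f (proj J x)"
  using assms
proof (induction ps arbitrary: x)
  case (Cons p ps)
  have "proj J (snd p *\<^sub>R ax (fst p)) = snd p *\<^sub>R ax (fst p)"
    using proj_reach[of "[p]" J] Cons.prems by simp
  then show ?case
    using Cons by (simp add: proj_add)
qed simp

lemma continuous_on_iter_diff:
  assumes S: "order_convex S" and f: "continuous_on S f"
    and "set ps \<subseteq> J \<times> {0..}" "\<And>x. x \<in> T \<Longrightarrow> x \<in> S \<and> x + reach ps \<in> S"
  shows "continuous_on T (iter_diff ps f)"
  using assms(3-)
proof (induction ps arbitrary: T)
  case Nil
  then show ?case
    using continuous_on_subset[OF f, of T] by auto
next
  case (Cons p ps)
  let ?v = "snd p *\<^sub>R ax (fst p)"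
  have ps: "set ps \<subseteq> J \<times> {0..}" using Cons.prems(1) by simp
  have dom: "x + ?v \<in> S" "x + reach ps \<in> S" "x + ?v + reach ps \<in> S" "x \<in> S" if "x \<in> T" for x
    using step_in_domain[OF S Cons.prems(1)] Cons.prems(2)[OF that] by blast+
  have "continuous_on ((\<lambda>x. x + ?v) ` T) (iter_diff ps f)" "continuous_on T (iter_diff ps f)"
    by (rule Cons.IH[OF ps]; use dom in blast)+
  moreover have "continuous_on T (\<lambda>x. x + ?v)"
    by (intro continuous_intros)
  ultimately show ?case
    using continuous_on_diff[OF continuous_on_compose2[of _ "iter_diff ps f" T "\<lambda>x. x + ?v"]]
    by (auto simp: fun_eq_iff)
qed

text \<open>Sums, products and limits may be nested arbitrarily, because the approximation by polynomials
proceeds one variable at a time. Every property used below is verified on the generators and is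
stable under the three operations.\<close>

inductive pos_poly_limit :: "(real ^ 'm) set \<Rightarrow> (real ^ 'm \<Rightarrow> real) \<Rightarrow> bool" for S where
  const: "0 \<le> k \<Longrightarrow> pos_poly_limit S (\<lambda>_. k)"
| coord: "pos_poly_limit S (\<lambda>x. x $ l)"
| add: "pos_poly_limit S f \<Longrightarrow> pos_poly_limit S g \<Longrightarrow> pos_poly_limit S (\<lambda>x. f x + g x)"
| mult: "pos_poly_limit S f \<Longrightarrow> pos_poly_limit S g \<Longrightarrow> pos_poly_limit S (\<lambda>x. f x * g x)"
| limit: "(\<And>n. pos_poly_limit S (f n)) \<Longrightarrow> (\<And>x. x \<in> S \<Longrightarrow> (\<lambda>n. f n x) \<longlonglongrightarrow> g x)
    \<Longrightarrow> pos_poly_limit S g"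

lemma pos_poly_limit_sum:
  "finite I \<Longrightarrow> (\<And>i. i \<in> I \<Longrightarrow> pos_poly_limit S (f i)) \<Longrightarrow> pos_poly_limit S (\<lambda>x. \<Sum>i\<in>I. f i x)"
proof (induction I rule: finite_induct)
  case empty
  show ?case
    using pos_poly_limit.const[of 0] by simp
next
  case (insert i I)
  then show ?case
    using pos_poly_limit.add[of S "f i" "\<lambda>x. \<Sum>i\<in>I. f i x"] by simp
qed

lemma pos_poly_limit_power:
  "pos_poly_limit S f \<Longrightarrow> pos_poly_limit S (\<lambda>x. f x ^ n)"
  by (induction n) (simp_all add: pos_poly_limit.mult pos_poly_limit.const)

lemma pos_poly_limit_nonneg:
  assumes "pos_poly_limit S f" and "\<And>x. x \<in> S \<Longrightarrow> 0 \<le> x" "x \<in> S"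
  shows "0 \<le> f x"
  using assms(1)
proof induction
  case (coord l)
  then show ?case
    using assms(2)[OF assms(3)] by (simp add: less_eq_vec_def)
next
  case (limit f g)
  then show ?case
    using assms(3) by (blast intro: LIMSEQ_le_const)
qed auto

lemma pos_poly_limit_mono:
  assumes "pos_poly_limit S f" and S: "\<And>x. x \<in> S \<Longrightarrow> 0 \<le> x" "x \<in> S" "z \<in> S" "x \<le> z"
  shows "f x \<le> f z"
  using assms(1)
proof induction
  case (coord l)
  then show ?case
    using S(4) by (simp add: less_eq_vec_def)
next
  case (limit f g)
  then show ?case
    using S by (blast intro: LIMSEQ_le)
next
  case (mult f g)
  then show ?case
    using S pos_poly_limit_nonneg[of S] by (intro mult_mono) auto
qed auto

lemma two_term_Cauchy_Schwarz:
  fixes p q u v s t :: real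
  assumes "p\<^sup>2 \<le> u * v" "q\<^sup>2 \<le> s * t" "0 \<le> u" "0 \<le> v" "0 \<le> s" "0 \<le> t"
  shows "(p + q)\<^sup>2 \<le> (u + s) * (v + t)"
proof -
  have "(p * q)\<^sup>2 \<le> (u * v) * (s * t)"
    unfolding power_mult_distrib using assms by (intro mult_mono) auto
  also have "\<dots> \<le> ((u * t + s * v) / 2)\<^sup>2"
  proof -
    have "0 \<le> ((u * t - s * v) / 2)\<^sup>2"
      by simp
    then show ?thesis
      by (simp add: power2_eq_square field_simps)
  qed
  finally have "p * q \<le> (u * t + s * v) / 2"
    by (rule power2_le_imp_le) (use assms(3-) in simp)
  then have pq: "2 * (p * q) \<le> u * t + s * v"
    by simp
  have e1: "(p + q)\<^sup>2 = p\<^sup>2 + q\<^sup>2 + 2 * (p * q)"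
    by (simp add: power2_eq_square algebra_simps)
  have e2: "(u + s) * (v + t) = u * v + u * t + s * v + s * t"
    by (simp add: algebra_simps)
  show ?thesis
    unfolding e1 e2 using assms(1,2) pq by linarith
qed

text \<open>Equality holds for constants and coordinates, a product of two such inequalities is one again,
and sums are the Cauchy-Schwarz inequality for two terms.\<close>

lemma pos_poly_limit_Cauchy_Schwarz:
  assumes "pos_poly_limit S f" and S: "\<And>x. x \<in> S \<Longrightarrow> 0 \<le> x"
    and ab: "a \<in> S" "b \<in> S" "(\<chi> l. sqrt (a $ l * b $ l)) \<in> S"
  shows "(f (\<chi> l. sqrt (a $ l * b $ l)))\<^sup>2 \<le> f a * f b"
  using assms(1)
proof induction
  case (const k)
  show ?case
    by (simp add: power2_eq_square)
next
  case (coord l)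
  show ?case
    using S[OF ab(1)] S[OF ab(2)] by (simp add: less_eq_vec_def real_sqrt_pow2)
next
  case (add f g)
  then show ?case
    using pos_poly_limit_nonneg[OF add.hyps(1) S] pos_poly_limit_nonneg[OF add.hyps(2) S] ab
    by (intro two_term_Cauchy_Schwarz) simp_all
next
  case (mult f g)
  have "(f (\<chi> l. sqrt (a $ l * b $ l)))\<^sup>2 * (g (\<chi> l. sqrt (a $ l * b $ l)))\<^sup>2
      \<le> (f a * f b) * (g a * g b)"
    using mult.IH pos_poly_limit_nonneg[OF mult.hyps(1) S] pos_poly_limit_nonneg[OF mult.hyps(2) S] ab
    by (intro mult_mono) simp_all
  then show ?case
    by (simp only: power_mult_distrib mult_ac)
next
  case (limit f g)
  have "(\<lambda>n. (f n (\<chi> l. sqrt (a $ l * b $ l)))\<^sup>2) \<longlonglongrightarrow> (g (\<chi> l. sqrt (a $ l * b $ l)))\<^sup>2"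
    "(\<lambda>n. f n a * f n b) \<longlonglongrightarrow> g a * g b"
    by (rule tendsto_power[OF limit.hyps(2)[OF ab(3)]],
        rule tendsto_mult[OF limit.hyps(2)[OF ab(1)] limit.hyps(2)[OF ab(2)]])
  then show ?case
    using limit.IH by (intro LIMSEQ_le) auto
qed

lemma pos_poly_limit_completely_monotone:
  assumes "pos_poly_limit S f" and s: "\<And>l. completely_monotone (s l)" "\<And>k. (\<chi> l. s l k) \<in> S"
  shows "completely_monotone (\<lambda>k. f (\<chi> l. s l k))"
  using assms(1)
proof induction
  case (limit f g)
  show ?case
    by (rule completely_monotone_limit[OF limit.IH limit.hyps(2)[OF s(2)]])
next
  case (const k)
  then show ?case
    by (rule completely_monotone_const)
next
  case (coord l)
  show ?case
    using s(1)[of l] by simp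
next
  case (add f g)
  show ?case
    by (rule completely_monotone_add[OF add.IH])
next
  case (mult f g)
  show ?case
    by (rule completely_monotone_mult[OF mult.IH])
qed

definition fdiff :: "(nat \<Rightarrow> real) \<Rightarrow> nat \<Rightarrow> real" where
  "fdiff a i = a (Suc i) - a i"

text \<open>Written in powers of \<open>z\<close>, a Bernstein polynomial has forward differences of the
data as coefficients. This is where non-negative differences become non-negative coefficients.\<close>

lemma Bernstein_eq_forward_differences:
  "(\<Sum>i\<le>n. a i * Bernstein n i z) = (\<Sum>j\<le>n. (n choose j) * (z ^ j * (fdiff ^^ j) a 0))"
proof (induction n arbitrary: a)
  case 0
  show ?case
    by (simp add: Bernstein_def)
next
  case (Suc n)
  let ?B = "\<lambda>n a. \<Sum>i\<le>n. a i * Bernstein n i z"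
  have lin: "?B n (fdiff a) = ?B n (\<lambda>i. a (Suc i)) - ?B n a"
    unfolding fdiff_def left_diff_distrib sum_subtractf ..
  have "?B (Suc n) a = (\<Sum>i\<le>Suc n. (Suc n choose i) * (a i * z ^ i * (1 - z) ^ (Suc n - i)))"
    by (intro sum.cong) (auto simp: Bernstein_def)
  also have "\<dots> = (\<Sum>i\<le>n. (1 - z) * (a i * Bernstein n i z)) + (\<Sum>i\<le>n. z * (a (Suc i) * Bernstein n i z))"
    unfolding sum_choose_Suc
    by (intro arg_cong2[of _ _ _ _ "(+)"] sum.cong) (auto simp: Bernstein_def Suc_diff_le)
  also have "\<dots> = ?B n a + z * ?B n (fdiff a)"
    unfolding lin sum_distrib_left[symmetric] by algebra
  also have "\<dots> = (\<Sum>j\<le>n. (n choose j) * (z ^ j * (fdiff ^^ j) a 0))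
      + (\<Sum>j\<le>n. (n choose j) * (z ^ Suc j * (fdiff ^^ Suc j) a 0))"
    unfolding Suc sum_distrib_left
    by (intro arg_cong2[of _ _ _ _ "(+)"] sum.cong refl)
      (simp_all add: funpow_Suc_right mult_ac del: funpow.simps)
  also have "\<dots> = (\<Sum>j\<le>Suc n. (Suc n choose j) * (z ^ j * (fdiff ^^ j) a 0))"
    unfolding sum_choose_Suc ..
  finally show ?case .
qed

lemma fdiff_pow_eq_iter_diff:
  "(fdiff ^^ j) (\<lambda>i. f (x + (real i * h) *\<^sub>R ax l)) i
   = iter_diff (replicate j (l, h)) f (x + (real i * h) *\<^sub>R ax l)"
proof (induction j arbitrary: i)
  case (Suc j)
  have "x + (real i * h) *\<^sub>R ax l + h *\<^sub>R ax l = x + (real (Suc i) * h) *\<^sub>R ax l"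
    by (simp add: scaleR_left_distrib distrib_right)
  then show ?case
    by (simp only: replicate_Suc iter_diff.simps fst_conv snd_conv funpow.simps comp_apply
        fdiff_def[of "(fdiff ^^ j) _"] Suc.IH)
qed simp

lemma reach_replicate: "reach (replicate j (l, h)) = (real j * h) *\<^sub>R ax l"
  by (induction j) (simp_all add: scaleR_left_distrib distrib_right)

abbreviation corner_box :: "real \<Rightarrow> (real ^ 'm) set" where
  "corner_box c \<equiv> {x. \<forall>l. 0 \<le> x $ l \<and> x $ l \<le> c}"

lemma order_convex_corner_box: "order_convex (corner_box c)"
  using order_convex_product[of "\<lambda>_. {0..c}"] by simp

text \<open>Induction on the set \<open>V\<close> of variables on which \<open>f\<close> depends. Bernstein
polynomials in the variable \<open>x $ l\<close> converge to \<open>f\<close>, and their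
coefficients are differences of \<open>f\<close> in direction \<open>l\<close>, taken at
\<open>x $ l = 0\<close>. As functions of the other variables these have non-negative
differences again.\<close>

lemma nonneg_diffs_imp_pos_poly_limit:
  assumes c: "0 < c" and "\<And>x. f x = f (proj V x)"
    and "nonneg_diffs V (corner_box c) f" "continuous_on (corner_box c) f"
  shows "pos_poly_limit (corner_box c) (f :: real ^ 'm \<Rightarrow> real)"
  using finite[of V] assms(2-)
proof (induction V arbitrary: f rule: finite_induct)
  case empty
  have "0 \<le> iter_diff [] f 0"
    using c by (intro empty(2)[unfolded nonneg_diffs_def, rule_format]) auto
  then have "0 \<le> f 0"
    by simp
  moreover have "f = (\<lambda>_. f 0)"
  proof
    fix x :: "real ^ 'm"
    have "proj {} x = 0"
      by (simp add: vec_eq_iff)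
    then show "f x = f 0"
      using empty(1)[of x] by (simp only:)
  qed
  ultimately obtain k where "f = (\<lambda>_. k)" "0 \<le> k"
    by blast
  then show ?case
    by (simp add: pos_poly_limit.const)
next
  case (insert l V f)
  define \<phi> where "\<phi> n j x = iter_diff (replicate j (l, c / real n)) f (proj V x)" for n j x
  have \<phi>: "pos_poly_limit (corner_box c) (\<phi> n j)" if j: "j \<le> n" "0 < n" for n j
  proof (rule insert.IH)
    let ?h = "c / real n"
    have "real j * c \<le> real n * c"
      using j c by (intro mult_right_mono) auto
    then have h: "0 \<le> real j * ?h" "real j * ?h \<le> c"
      using j c by (simp_all add: divide_le_eq mult.commute)
    have dom: "x + reach (replicate j (l, ?h)) \<in> corner_box c"
      if "x \<in> corner_box c" "x $ l = 0" for x
    proof -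
      have "(x + reach (replicate j (l, ?h))) $ i = (if i = l then real j * ?h else x $ i)" for i
        using that(2) by (simp add: reach_replicate axis_def)
      then show ?thesis
        using that(1) h by simp
    qed
    show "\<phi> n j x = \<phi> n j (proj V x)" for x
      by (simp add: \<phi>_def proj_idem)
    show "nonneg_diffs V (corner_box c) (\<phi> n j)"
      unfolding nonneg_diffs_def
    proof (intro allI impI)
      fix ps x assume ps: "set ps \<subseteq> V \<times> {0..}" and x: "x \<in> corner_box c" "x + reach ps \<in> corner_box c"
      have p: "proj V (x + reach ps) = proj V x + reach ps"
        by (simp add: proj_add proj_reach[OF ps])
      have "iter_diff ps (\<phi> n j) x = iter_diff (ps @ replicate j (l, ?h)) f (proj V x)"
        unfolding \<phi>_def iter_diff_proj[OF ps] iter_diff_append ..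
      also have "0 \<le> \<dots>"
      proof -
        have "proj V (x + reach ps) \<in> corner_box c" "proj V x \<in> corner_box c"
          using x c by (auto simp: less_imp_le)
        moreover have "proj V (x + reach ps) $ l = 0"
          using insert.hyps by simp
        ultimately have "proj V (x + reach ps) + reach (replicate j (l, ?h)) \<in> corner_box c"
          by (intro dom)
        moreover have "reach (ps @ qs) = reach ps + reach qs" for qs :: "('m \<times> real) list"
          by (simp add: reach_def)
        ultimately have "proj V x + reach (ps @ replicate j (l, ?h)) \<in> corner_box c"
          unfolding p by (simp only: add.assoc)
        moreover have "set (ps @ replicate j (l, ?h)) \<subseteq> insert l V \<times> {0..}"
          using ps c by auto
        ultimately show ?thesis
          using insert.prems(2)[unfolded nonneg_diffs_def, rule_format] \<open>proj V x \<in> corner_box c\<close>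
          by blast
      qed
      finally show "0 \<le> iter_diff ps (\<phi> n j) x" .
    qed
    have "continuous_on (proj V ` corner_box c) (iter_diff (replicate j (l, ?h)) f)"
    proof (rule continuous_on_iter_diff[OF order_convex_corner_box insert.prems(3), of _ UNIV])
      fix x assume "x \<in> proj V ` corner_box c"
      then have "x \<in> corner_box c" "x $ l = 0"
        using insert.hyps c by (auto simp: less_imp_le)
      then show "x \<in> corner_box c \<and> x + reach (replicate j (l, ?h)) \<in> corner_box c"
        using dom by blast
    qed (use c in auto)
    then show "continuous_on (corner_box c) (\<phi> n j)"
      unfolding \<phi>_def by (rule continuous_on_compose2) (auto intro!: continuous_intros)
  qed
  let ?f = "\<lambda>n x. \<Sum>j\<le>n. (n choose j) * ((x $ l / c) ^ j * \<phi> n j x)"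
  show ?case
  proof (rule pos_poly_limit.limit)
    show "pos_poly_limit (corner_box c) (?f (Suc n))" for n
    proof (intro pos_poly_limit_sum pos_poly_limit.mult pos_poly_limit_power)
      show "pos_poly_limit (corner_box c) (\<lambda>x. x $ l / c)"
        using pos_poly_limit.mult[OF pos_poly_limit.const[of "1 / c"] pos_poly_limit.coord[of _ l]] c
        by simp
    qed (auto intro: pos_poly_limit.const \<phi>)
    fix x :: "real ^ 'm" assume x: "x \<in> corner_box c"
    define \<psi> where "\<psi> t = f (proj V x + (c * t) *\<^sub>R ax l)" for t
    have "continuous_on {0..1} \<psi>"
      unfolding \<psi>_def
    proof (rule continuous_on_compose2[OF insert.prems(3)])
      show "(\<lambda>t. proj V x + (c * t) *\<^sub>R ax l) ` {0..1} \<subseteq> corner_box c"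
        using x c insert.hyps by (auto simp: axis_def mult_le_cancel_left1 less_imp_le)
    qed (intro continuous_intros)
    have z: "x $ l / c \<in> {0..1}"
      using x c by (simp add: divide_le_eq)
    have lim: "(\<lambda>n. \<Sum>k\<le>n. \<psi> (k / n) * Bernstein n k (x $ l / c)) \<longlonglongrightarrow> \<psi> (x $ l / c)"
    proof (rule LIMSEQ_I)
      fix e :: real assume "0 < e"
      with Bernstein_Weierstrass[OF \<open>continuous_on {0..1} \<psi>\<close>] z show "\<exists>N. \<forall>n\<ge>N.
          norm ((\<Sum>k\<le>n. \<psi> (k / n) * Bernstein n k (x $ l / c)) - \<psi> (x $ l / c)) < e"
        unfolding real_norm_def by (metis abs_minus_commute)
    qed
    have "?f n x = (\<Sum>k\<le>n. \<psi> (k / n) * Bernstein n k (x $ l / c))" for n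
    proof -
      have "(fdiff ^^ j) (\<lambda>k. \<psi> (k / n)) 0 = \<phi> n j x" for j
        using fdiff_pow_eq_iter_diff[of j f "proj V x" "c / n" l 0]
        by (simp add: \<psi>_def \<phi>_def mult.commute)
      then show ?thesis
        by (simp add: Bernstein_eq_forward_differences)
    qed
    moreover have "\<psi> (x $ l / c) = f x"
    proof -
      have "proj V x + (x $ l) *\<^sub>R ax l = proj (insert l V) x"
        using insert.hyps by (auto simp: vec_eq_iff axis_def)
      then show ?thesis
        using c insert.prems(1)[of x] by (simp add: \<psi>_def)
    qed
    ultimately have "(\<lambda>n. ?f n x) \<longlonglongrightarrow> f x"
      using lim by (simp only:)
    then show "(\<lambda>n. ?f (Suc n) x) \<longlonglongrightarrow> f x"
      by (rule LIMSEQ_Suc)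
  qed
qed


section \<open>Differentiability from non-negative differences in one variable\<close>

text \<open>If the graph exceeded a chord, then the excess would have a positive maximum on the chord. At
the leftmost point where it is attained, midpoint convexity fails.\<close>

lemma midpoint_convex_imp_convex_on:
  fixes \<phi> :: "real \<Rightarrow> real"
  assumes I: "convex I" and cont: "continuous_on I \<phi>"
    and mid: "\<And>x z. x \<in> I \<Longrightarrow> z \<in> I \<Longrightarrow> \<phi> ((x + z) / 2) \<le> (\<phi> x + \<phi> z) / 2"
  shows "convex_on I \<phi>"
proof (rule convex_on_linorderI[OF _ I])
  fix t x z :: real
  assume t: "0 < t" "t < 1" and xz: "x \<in> I" "z \<in> I" "x < z"
  define p where "p s = (1 - s) *\<^sub>R x + s *\<^sub>R z" for s
  define g where "g s = \<phi> (p s) - ((1 - s) * \<phi> x + s * \<phi> z)" for s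
  have p: "p s \<in> I" if "s \<in> {0..1}" for s
    unfolding p_def using that xz by (intro convexD_alt[OF I]) auto
  have contg: "continuous_on {0..1} g"
  proof -
    have "continuous_on {0..1} p"
      unfolding p_def by (intro continuous_intros)
    then have "continuous_on {0..1} (\<lambda>s. \<phi> (p s))"
      using p by (intro continuous_on_compose2[OF cont]) auto
    then show ?thesis
      unfolding g_def by (intro continuous_intros)
  qed
  have mid_g: "g ((s + s') / 2) \<le> (g s + g s') / 2" if "s \<in> {0..1}" "s' \<in> {0..1}" for s s'
  proof -
    have e: "p ((s + s') / 2) = (p s + p s') / 2"
      by (simp add: p_def field_simps)
    have "\<phi> (p ((s + s') / 2)) \<le> (\<phi> (p s) + \<phi> (p s')) / 2"
      unfolding e by (rule mid[OF p[OF that(1)] p[OF that(2)]])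
    then show ?thesis
      unfolding g_def by (simp add: algebra_simps add_divide_distrib diff_divide_distrib)
  qed
  have ends: "g 0 = 0" "g 1 = 0"
    by (simp_all add: g_def p_def)
  have "g t \<le> 0"
  proof (rule ccontr)
    assume "\<not> g t \<le> 0"
    obtain m where m: "m \<in> {0..1}" "\<And>s. s \<in> {0..1} \<Longrightarrow> g s \<le> g m"
      using continuous_attains_sup[OF _ _ contg] by auto
    then have "0 < g m"
      using \<open>\<not> g t \<le> 0\<close> t by (meson atLeastAtMost_iff less_le_trans less_imp_le not_le)
    define Z where "Z = {s \<in> {0..1}. g s = g m}"
    have "closed Z"
      unfolding Z_def using continuous_closed_preimage_constant[OF contg closed_atLeastAtMost] by simp
    then have "compact Z"
      unfolding compact_eq_bounded_closed
      by (auto simp: Z_def intro: bounded_subset[OF bounded_closed_interval[of 0 "1::real"]])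
    moreover have "Z \<noteq> {}"
      using m(1) by (auto simp: Z_def)
    ultimately obtain s where s: "s \<in> Z" "\<And>r. r \<in> Z \<Longrightarrow> s \<le> r"
      using compact_attains_inf[of Z] by auto
    then have s01: "0 < s" "s < 1" and gs: "g s = g m"
    proof -
      have "0 \<le> s" "s \<le> 1" and eq: "g s = g m"
        using s(1) by (simp_all add: Z_def)
      moreover have "s \<noteq> 0" "s \<noteq> 1"
        using ends \<open>0 < g m\<close> eq by auto
      ultimately show "0 < s" "s < 1" "g s = g m"
        by simp_all
    qed
    define \<delta> where "\<delta> = min s (1 - s)"
    have \<delta>: "0 < \<delta>" "s - \<delta> \<in> {0..1}" "s + \<delta> \<in> {0..1}"
      using s01 by (auto simp: \<delta>_def)
    have "g (s - \<delta>) \<noteq> g m"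
      using s(2)[of "s - \<delta>"] \<delta> by (auto simp: Z_def)
    then have "g (s - \<delta>) < g m" "g (s + \<delta>) \<le> g m"
      using m(2)[OF \<delta>(2)] m(2)[OF \<delta>(3)] by simp_all
    then show False
      using mid_g[OF \<delta>(2,3)] gs by simp
  qed
  then show "\<phi> ((1 - t) *\<^sub>R x + t *\<^sub>R z) \<le> (1 - t) * \<phi> x + t * \<phi> z"
    by (simp add: g_def p_def)
qed

text \<open>Differences of order one and two make \<open>\<phi>\<close> continuous and convex, so the right
derivative exists. The difference of order three with points \<open>x - h, x, x + h, x + 2
h\<close> says that the slope to the left of \<open>x\<close> is at least three times the slope
on \<open>[x, x + h]\<close> minus twice the slope on \<open>[x, x + 2 h]\<close>. Hence the
left derivative agrees with the right one.\<close>

lemma differentiable_of_nonneg_differences: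
  fixes \<phi> :: "real \<Rightarrow> real"
  assumes mono: "\<And>x z. u < x \<Longrightarrow> x \<le> z \<Longrightarrow> z < v \<Longrightarrow> \<phi> x \<le> \<phi> z"
    and mid: "\<And>x h. u < x \<Longrightarrow> 0 \<le> h \<Longrightarrow> x + 2 * h < v \<Longrightarrow>
                0 \<le> \<phi> (x + 2 * h) - 2 * \<phi> (x + h) + \<phi> x"
    and third: "\<And>x h. u < x \<Longrightarrow> 0 \<le> h \<Longrightarrow> x + 3 * h < v \<Longrightarrow>
                0 \<le> \<phi> (x + 3 * h) - 3 * \<phi> (x + 2 * h) + 3 * \<phi> (x + h) - \<phi> x"
    and x: "u < x" "x < v"
  shows "\<phi> field_differentiable at x"
proof -
  have mid_le: "2 * \<phi> z \<le> \<phi> (z - h) + \<phi> (z + h)" if "u < z - h" "z + h < v" "0 \<le> h" for z h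
  proof -
    have e: "z - h + 2 * h = z + h" "z - h + h = z"
      by simp_all
    show ?thesis
      using mid[of "z - h" h, unfolded e] that by linarith
  qed
  have cont: "isCont \<phi> z" if z: "u < z" "z < v" for z
    unfolding continuous_at_eps_delta
  proof (intro allI impI)
    fix e :: real assume "0 < e"
    define r where "r = min (z - u) (v - z) / 2"
    have "0 < r" "r \<le> (z - u) / 2" "r \<le> (v - z) / 2"
      using z by (simp_all add: r_def)
    then have r: "0 < r" "u < z - r" "z + r < v"
      using z by (simp_all add: field_simps)
    have halve: "\<phi> (z + r / 2 ^ k) - \<phi> z \<le> (\<phi> (z + r) - \<phi> z) / 2 ^ k" for k
    proof (induction k)
      case (Suc k)
      have "r / 2 ^ k \<le> r"
        using r(1) by (simp add: divide_le_eq)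
      then have "2 * \<phi> (z + r / 2 ^ Suc k) \<le> \<phi> z + \<phi> (z + r / 2 ^ k)"
        using mid[of z "r / 2 ^ Suc k"] r z by simp
      moreover have "2 * (C / 2 ^ Suc k) = C / 2 ^ k" for C :: real
        by simp
      note this[of "\<phi> (z + r) - \<phi> z"]
      ultimately show ?case
        using Suc by linarith
    qed simp
    obtain k where k: "(\<phi> (z + r) - \<phi> z) / 2 ^ k < e"
    proof -
      have "(\<lambda>k. (\<phi> (z + r) - \<phi> z) * (1 / 2) ^ k) \<longlonglongrightarrow> 0"
        by (intro tendsto_mult_right_zero LIMSEQ_power_zero) simp
      from order_tendstoD(2)[OF this \<open>0 < e\<close>] show ?thesis
        using that by (auto simp: eventually_sequentially power_divide)
    qed
    define d where "d = r / 2 ^ k"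
    have d: "0 < d" "d \<le> r"
      using r(1) by (simp_all add: d_def divide_le_eq)
    have right: "\<phi> (z + d) - \<phi> z < e"
      using halve[of k] k by (simp add: d_def)
    have left: "\<phi> z - \<phi> (z - d) < e"
      using mid_le[of z d] d r right by simp
    show "\<exists>d>0. \<forall>x'. dist x' z < d \<longrightarrow> dist (\<phi> x') (\<phi> z) < e"
    proof (intro exI[of _ d] conjI allI impI d(1))
      fix w assume "dist w z < d"
      then have w: "z - d \<le> w" "w \<le> z + d"
        by (auto simp: dist_real_def)
      have "\<phi> (z - d) \<le> \<phi> w" "\<phi> w \<le> \<phi> (z + d)"
        using w d r by (auto intro!: mono)
      then show "dist (\<phi> w) (\<phi> z) < e"
        using left right by (auto simp: dist_real_def)
    qed
  qed
  have convex: "convex_on {u<..<v} \<phi>"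
  proof (rule midpoint_convex_imp_convex_on)
    show "continuous_on {u<..<v} \<phi>"
      using cont by (intro continuous_at_imp_continuous_on) auto
    fix a b assume ab: "a \<in> {u<..<v}" "b \<in> {u<..<v}"
    have ordered: "\<phi> ((a + b) / 2) \<le> (\<phi> a + \<phi> b) / 2" if "a \<le> b" "u < a" "b < v" for a b
    proof -
      have e: "a + 2 * ((b - a) / 2) = b" "a + (b - a) / 2 = (a + b) / 2"
        by (simp_all add: field_simps)
      show ?thesis
        using mid[of a "(b - a) / 2"] that unfolding e by simp
    qed
    show "\<phi> ((a + b) / 2) \<le> (\<phi> a + \<phi> b) / 2"
    proof (cases "a \<le> b")
      case True
      then show ?thesis
        using ordered[of a b] ab by simp
    next
      case False
      then show ?thesis
        using ordered[of b a] ab by (simp add: add.commute)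
    qed
  qed simp
  define s where "s h = (\<phi> (x + h) - \<phi> x) / h" for h
  define r where "r = min (x - u) (v - x)"
  have r: "0 < r" "u \<le> x - r" "x + r \<le> v"
    using x by (auto simp: r_def)
  have s_mono: "s h \<le> s k" if "0 < h" "h \<le> k" "k < r" for h k
  proof (cases "h = k")
    case False
    then have "(\<phi> x - \<phi> (x + h)) / (x - (x + h)) \<le> (\<phi> x - \<phi> (x + k)) / (x - (x + k))"
      using that r x by (intro convex_on_slope_le(1)[OF convex]) auto
    moreover have "s t = (\<phi> x - \<phi> (x + t)) / (x - (x + t))" for t
      by (simp add: s_def minus_divide_left flip: minus_divide_right)
    ultimately show ?thesis
      by simp
  qed simp
  define D where "D = Inf (s ` ({0<..} \<inter> {0<..<r}))"
  have "(s \<longlongrightarrow> D) (at 0 within ({0<..} \<inter> {0<..<r}))"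
    unfolding D_def
  proof (rule Lim_right_bound[where K = 0])
    show "0 \<le> s h" if "h \<in> {0<..<r}" for h
      using mono[of x "x + h"] that r x by (simp add: s_def)
  qed (use s_mono in auto)
  moreover have "at (0::real) within ({0<..} \<inter> {0<..<r}) = at_right 0"
    using r(1) by (intro at_within_nhd[of _ "{..<r}"]) auto
  ultimately have right: "(s \<longlongrightarrow> D) (at_right 0)"
    by simp
  have "filterlim (\<lambda>h::real. 2 * h) (at_right 0) (at_right 0)"
    by (auto simp: filterlim_at intro!: tendsto_eq_intros eventually_mono[OF eventually_at_right_less])
  then have right2: "((\<lambda>h. s (2 * h)) \<longlongrightarrow> D) (at_right 0)"
    by (rule filterlim_compose[OF right])
  have left: "((\<lambda>h. s (- h)) \<longlongrightarrow> D) (at_right 0)"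
  proof (rule tendsto_sandwich[of "\<lambda>h. 3 * s h - 2 * s (2 * h)" _ _ s])
    have ev: "\<forall>\<^sub>F h in at_right 0. 0 < h \<and> h < r / 2"
      using r(1) by (auto simp: eventually_at_right_field intro!: exI[of _ "r / 2"])
    show "\<forall>\<^sub>F h in at_right 0. 3 * s h - 2 * s (2 * h) \<le> s (- h)"
      using ev
    proof eventually_elim
      case (elim h)
      have "0 \<le> \<phi> (x + 2 * h) - 3 * \<phi> (x + h) + 3 * \<phi> x - \<phi> (x - h)"
        using third[of "x - h" h] elim r by (simp add: algebra_simps)
      then show ?case
      proof -
        assume third: "0 \<le> \<phi> (x + 2 * h) - 3 * \<phi> (x + h) + 3 * \<phi> x - \<phi> (x - h)"
        then have "0 \<le> (\<phi> (x + 2 * h) - 3 * \<phi> (x + h) + 3 * \<phi> x - \<phi> (x - h)) / h"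
          using elim by simp
        also have "\<dots> = s (- h) - (3 * s h - 2 * s (2 * h))"
          using elim by (simp add: s_def field_simps)
        finally show ?thesis
          by simp
      qed
    qed
    show "\<forall>\<^sub>F h in at_right 0. s (- h) \<le> s h"
      using ev
    proof eventually_elim
      case (elim h)
      then have "0 \<le> (\<phi> (x - h) + \<phi> (x + h) - 2 * \<phi> x) / h"
        using mid_le[of x h] r by simp
      also have "\<dots> = s h - s (- h)"
        using elim by (simp add: s_def field_simps)
      finally show ?case
        by simp
    qed
    show "((\<lambda>h. 3 * s h - 2 * s (2 * h)) \<longlongrightarrow> D) (at_right 0)"
      using tendsto_diff[OF tendsto_mult[OF tendsto_const right, of 3] tendsto_mult[OF tendsto_const right2, of 2]]
      by simp
  qed (fact right)
  have "(s \<longlongrightarrow> D) (at_left 0)"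
    using left by (simp add: filterlim_at_left_to_right)
  with right have "(s \<longlongrightarrow> D) (at 0)"
    by (intro filterlim_split_at)
  then show ?thesis
    unfolding field_differentiable_def DERIV_def s_def by blast
qed


section \<open>Absolute monotonicity and non-negative differences\<close>

definition axis_open :: "'m set \<Rightarrow> (real ^ 'm) set \<Rightarrow> bool" where
  "axis_open J S \<longleftrightarrow> (\<forall>x\<in>S. \<forall>l\<in>J. \<exists>r>0. \<forall>t. \<bar>t\<bar> < r \<longrightarrow> x + t *\<^sub>R ax l \<in> S)"

lemma nonneg_diffs_imp_partially_differentiable:
  assumes S: "order_convex S" "axis_open J S" and f: "nonneg_diffs J S f"
    and x: "x \<in> S" and l: "l \<in> J"
  shows "partially_differentiable l f x"
proof -
  obtain r where r: "0 < r" "\<And>t. \<bar>t\<bar> < r \<Longrightarrow> x + t *\<^sub>R ax l \<in> S"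
    using S(2) x l unfolding axis_open_def by blast
  define \<phi> where "\<phi> t = f (x + t *\<^sub>R ax l)" for t
  have nonneg: "0 \<le> iter_diff (replicate n (l, h)) f (x + t *\<^sub>R ax l)"
    if "- r < t" "0 \<le> h" "t + n * h < r" for n h t
  proof -
    have "t \<le> t + n * h"
      using that(2) by simp
    then have "\<bar>t\<bar> < r" "\<bar>t + n * h\<bar> < r"
      using that by linarith+
    moreover have e: "x + t *\<^sub>R ax l + reach (replicate n (l, h)) = x + (t + n * h) *\<^sub>R ax l"
      by (induction n) (simp_all add: scaleR_left_distrib distrib_right algebra_simps)
    ultimately show ?thesis
    proof (intro f[unfolded nonneg_diffs_def, rule_format])
      show "x + t *\<^sub>R ax l + reach (replicate n (l, h)) \<in> S"
        unfolding e by (rule r(2)) fact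
    qed (use l that(2) r(2)[of t] in \<open>simp_all add: set_replicate_conv_if\<close>)
  qed
  have "\<phi> field_differentiable at 0"
  proof (rule differentiable_of_nonneg_differences[where u = "-r" and v = r])
    define D where "D n h t = iter_diff (replicate n (l, h)) f (x + t *\<^sub>R ax l)" for n h t
    have D: "D 0 h t = \<phi> t" "D (Suc n) h t = D n h (t + h) - D n h t" for n h t
      by (simp_all add: D_def \<phi>_def scaleR_left_distrib add.assoc)
    have D_nonneg: "0 \<le> D n h t" if "- r < t" "0 \<le> h" "t + n * h < r" for n h t
      using nonneg[OF that] by (simp only: D_def)
    show "\<phi> t \<le> \<phi> s" if "- r < t" "t \<le> s" "s < r" for t s
      using D_nonneg[of t "s - t" 1] that by (simp add: D)
    show "0 \<le> \<phi> (t + 2 * h) - 2 * \<phi> (t + h) + \<phi> t" if "- r < t" "0 \<le> h" "t + 2 * h < r" for t h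
    proof -
      have e: "t + h + h = t + 2 * h"
        by simp
      have "D (Suc (Suc 0)) h t = \<phi> (t + 2 * h) - 2 * \<phi> (t + h) + \<phi> t"
        unfolding D e by linarith
      then show ?thesis
        using D_nonneg[of t h "Suc (Suc 0)"] that by simp
    qed
    show "0 \<le> \<phi> (t + 3 * h) - 3 * \<phi> (t + 2 * h) + 3 * \<phi> (t + h) - \<phi> t"
      if "- r < t" "0 \<le> h" "t + 3 * h < r" for t h
    proof -
      have e: "t + h + h = t + 2 * h" "t + 2 * h + h = t + 3 * h"
        by simp_all
      have "D (Suc (Suc (Suc 0))) h t = \<phi> (t + 3 * h) - 3 * \<phi> (t + 2 * h) + 3 * \<phi> (t + h) - \<phi> t"
        unfolding D e by linarith
      then show ?thesis
        using D_nonneg[of t h "Suc (Suc (Suc 0))"] that by simp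
    qed
  qed (use r(1) in auto)
  then show ?thesis
    unfolding partially_differentiable_def \<phi>_def .
qed

text \<open>A difference quotient in direction \<open>l\<close> with positive step is, up to a positive
factor, one more difference, and the partial derivative is the limit of these quotients.\<close>

lemma nonneg_diffs_partial_deriv:
  assumes S: "order_convex S" "axis_open J S" and f: "nonneg_diffs J S f" and l: "l \<in> J"
  shows "nonneg_diffs J S (partial_deriv l f)"
proof (rule nonneg_diffs_limit[OF S(1)])
  fix z assume "z \<in> S"
  then have "((\<lambda>t. f (z + t *\<^sub>R ax l)) has_real_derivative partial_deriv l f z) (at 0)"
    using nonneg_diffs_imp_partially_differentiable[OF S f _ l, of z]
    unfolding partially_differentiable_def partial_deriv_def by (simp add: field_differentiable_derivI)
  then have "((\<lambda>h. (f (z + h *\<^sub>R ax l) - f z) / h) \<longlongrightarrow> partial_deriv l f z) (at 0)"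
    by (simp add: DERIV_def)
  then have "((\<lambda>h. (f (z + h *\<^sub>R ax l) - f z) / h) \<longlongrightarrow> partial_deriv l f z) (at_right 0)"
    using tendsto_mono[OF at_le[of "{0<..}" UNIV]] by blast
  then show "((\<lambda>h. 1 / h * (f (z + h *\<^sub>R ax l) - f z)) \<longlongrightarrow> partial_deriv l f z) (at_right 0)"
    by simp
next
  fix ps x assume ps: "set ps \<subseteq> J \<times> {0..}" and x: "x \<in> S" "x + reach ps \<in> S"
  obtain r where r: "0 < r" "\<And>t. \<bar>t\<bar> < r \<Longrightarrow> x + reach ps + t *\<^sub>R ax l \<in> S"
    using S(2) x(2) l unfolding axis_open_def by blast
  have "0 \<le> iter_diff ps (\<lambda>z. 1 / h * (f (z + h *\<^sub>R ax l) - f z)) x" if h: "0 < h" "h < r" for h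
  proof -
    have "x + reach ((l, h) # ps) \<in> S"
      using r(2)[of h] h by (simp add: add_ac)
    then have "0 \<le> iter_diff ((l, h) # ps) f x"
      using f ps x(1) l h unfolding nonneg_diffs_def
      by (metis (no_types, lifting) SigmaI atLeast_iff insert_subset less_imp_le list.simps(15))
    then show ?thesis
      using h unfolding iter_diff_scale iter_diff_Cons_swap by simp
  qed
  then show "\<forall>\<^sub>F h in at_right 0. 0 \<le> iter_diff ps (\<lambda>z. 1 / h * (f (z + h *\<^sub>R ax l) - f z)) x"
    using r(1) by (auto simp: eventually_at_right_field)
qed simp

theorem nonneg_diffs_imp_absolutely_monotonic:
  assumes S: "order_convex S" "axis_open J S" and f: "nonneg_diffs J S f" "continuous_on S f"
  shows "absolutely_monotonic_on J S f"
proof -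
  have ls: "nonneg_diffs J S (mixed_partial ls f)" if "ls \<in> lists J" for ls
    using that by (induction ls) (simp_all add: f(1) nonneg_diffs_partial_deriv[OF S])
  have "0 \<le> mixed_partial ls f x" if "ls \<in> lists J" "x \<in> S" for ls x
    using ls[OF that(1)] that(2) unfolding nonneg_diffs_def
    by (metis add.right_neutral empty_subsetI iter_diff.simps(1) list.set(1) reach_simps(1))
  then show ?thesis
    using ls nonneg_diffs_imp_partially_differentiable[OF S] f(2) interior_of_subset[of _ S]
    unfolding absolutely_monotonic_on_def by blast
qed

theorem absolutely_monotonic_imp_nonneg_diffs:
  assumes S: "order_convex S" "openin (top_of_set (coord_space J)) S"
    and f: "absolutely_monotonic_on J S f"
  shows "nonneg_diffs J S f"
  unfolding nonneg_diffs_def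
proof (intro allI impI)
  fix ps x assume ps: "set ps \<subseteq> J \<times> {0..}" "x \<in> S" "x + reach ps \<in> S"
  have int: "(top_of_set (coord_space J)) interior_of S = S"
    using S(2) by (simp add: interior_of_openin)
  let ?P = "\<lambda>(n::nat) g. \<exists>ls\<in>lists J. g = mixed_partial ls f"
  show "0 \<le> iter_diff ps f x"
  proof (rule derivatives_nonneg_imp_diffs_nonneg[OF S(1), where P = ?P and J = J])
    show "0 \<le> g x" if "?P n g" "x \<in> S" for n :: nat and g x
      using f that unfolding absolutely_monotonic_on_def int by blast
    show "\<exists>g'. ?P n g' \<and> (\<forall>x\<in>S. ((\<lambda>t. g (x + t *\<^sub>R ax l)) has_real_derivative g' x) (at 0))"
      if g: "?P (Suc n) g" "l \<in> J" for n :: nat and g l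
    proof (intro exI conjI ballI)
      obtain ls where ls: "ls \<in> lists J" "g = mixed_partial ls f"
        using g by blast
      then show "?P n (partial_deriv l g)"
        using g(2) by (intro bexI[of _ "l # ls"]) auto
      fix x assume "x \<in> S"
      then have "partially_differentiable l g x"
        using f ls g(2) unfolding absolutely_monotonic_on_def int by blast
      then show "((\<lambda>t. g (x + t *\<^sub>R ax l)) has_real_derivative partial_deriv l g x) (at 0)"
        unfolding partially_differentiable_def partial_deriv_def by (rule field_differentiable_derivI)
    qed
    show "?P (length ps) f"
      by (rule bexI[of _ "[]"]) auto
  qed (use ps in auto)
qed


section \<open>Averages along a coordinate\<close>

abbreviation open_box :: "real \<Rightarrow> (real ^ 'm) set" where
  "open_box c \<equiv> {x. \<forall>l. 0 < x $ l \<and> x $ l < c}"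

lemma order_convex_open_box: "order_convex (open_box c)"
  using order_convex_product[of "\<lambda>_. {0<..<c}"] by simp

lemma open_open_box: "open (open_box c :: (real ^ 'm) set)"
proof -
  have "open_box c = (\<Inter>l. {x :: real ^ 'm. 0 < x $ l} \<inter> {x. x $ l < c})"
    by auto
  moreover have "open (\<Inter>l. {x :: real ^ 'm. 0 < x $ l} \<inter> {x. x $ l < c})"
    by (intro open_INT ballI open_Int open_Collect_less continuous_intros) simp
  ultimately show ?thesis
    by (simp only:)
qed

lemma open_box_step:
  assumes "x \<in> open_box (c - h)" "0 \<le> t" "t \<le> h"
  shows "x + t *\<^sub>R ax l \<in> open_box c"
proof -
  have b: "0 < x $ i \<and> x $ i < c - h" for i
    using assms(1) by simp
  have e: "(x + t *\<^sub>R ax l) $ i = x $ i + (if i = l then t else 0)" for i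
    by (simp add: axis_def)
  show ?thesis
  proof -
    have "0 < (x + t *\<^sub>R ax l) $ i \<and> (x + t *\<^sub>R ax l) $ i < c" for i
      using e[of i] b[of i] assms(2,3) by (auto split: if_splits)
    then show ?thesis
      by blast
  qed
qed

lemma dist_add: "dist x (x + w) = norm (w :: 'a :: real_normed_vector)"
  by (simp add: dist_norm)

lemma open_axis_ball:
  assumes "open S" "x \<in> S"
  obtains r where "0 < r" "\<And>t. \<bar>t\<bar> < r \<Longrightarrow> x + t *\<^sub>R ax l \<in> (S :: (real ^ 'm) set)"
proof -
  obtain r where r: "0 < r" "ball x r \<subseteq> S"
    using assms open_contains_ball by blast
  have "x + t *\<^sub>R ax l \<in> S" if "\<bar>t\<bar> < r" for t
    using r(2) that by (auto simp: dist_norm norm_axis_1)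
  then show ?thesis
    using r(1) that by blast
qed

text \<open>Continuous partial derivatives give a derivative along every line. The coordinates of the
direction \<open>v\<close> are switched on one at a time, so that two variables suffice in each
step.\<close>

lemma DERIV_along_line:
  fixes f :: "real ^ 'm \<Rightarrow> real"
  assumes S: "open S" "x \<in> S"
    and g: "\<And>l. continuous_on S (g l)"
      "\<And>l z. z \<in> S \<Longrightarrow> ((\<lambda>t. f (z + t *\<^sub>R ax l)) has_real_derivative g l z) (at 0)"
  shows "((\<lambda>t. f (x + t *\<^sub>R v)) has_real_derivative (\<Sum>l\<in>UNIV. v $ l * g l x)) (at 0)"
proof -
  define vL where "vL L = (\<chi> i. if i \<in> L then v $ i else 0)" for L
  have "((\<lambda>t. f (x + t *\<^sub>R vL L)) has_real_derivative (\<Sum>l\<in>L. v $ l * g l x)) (at 0)" for L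
    using finite[of L]
  proof (induction L rule: finite_induct)
    case empty
    have "vL {} = 0"
      by (simp add: vL_def vec_eq_iff)
    then show ?case
      by simp
  next
    case (insert l L)
    define u where "u = vL L"
    have vL: "vL (insert l L) = u + (v $ l) *\<^sub>R ax l"
      using insert.hyps by (auto simp: vL_def u_def vec_eq_iff axis_def)
    define F where "F t s = f (x + t *\<^sub>R u + s *\<^sub>R ax l)" for t s
    obtain r where r: "0 < r" "ball x r \<subseteq> S"
      using S open_contains_ball by blast
    define d where "d = r / (2 * (norm u + 1))"
    define d' where "d' = r / 2"
    have "0 < norm u + 1"
      by (simp add: add_nonneg_pos)
    then have d: "0 < d" "0 < d'"
      using r(1) by (simp_all add: d_def d'_def)
    have inS: "x + t *\<^sub>R u + s *\<^sub>R ax l \<in> S" if "t \<in> ball 0 d" "s \<in> ball 0 d'" for t s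
    proof -
      have "\<bar>t\<bar> * (norm u + 1) < d * (norm u + 1)"
        using that(1) \<open>0 < norm u + 1\<close> by (intro mult_strict_right_mono) auto
      also have "\<dots> = r / 2"
        using \<open>0 < norm u + 1\<close> by (simp add: d_def field_simps)
      finally have "norm (t *\<^sub>R u) < r / 2"
        by (simp add: distrib_left)
      moreover have "norm (s *\<^sub>R ax l) < r / 2"
        using that(2) by (simp add: norm_axis_1 d'_def)
      ultimately have "norm (t *\<^sub>R u + s *\<^sub>R ax l) < r"
        using norm_triangle_ineq[of "t *\<^sub>R u" "s *\<^sub>R ax l"] by linarith
      then have "x + (t *\<^sub>R u + s *\<^sub>R ax l) \<in> ball x r"
        using dist_add[of x "t *\<^sub>R u + s *\<^sub>R ax l"] by (simp only: mem_ball)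
      then show ?thesis
        using r(2) unfolding add.assoc by blast
    qed
    have "((\<lambda>(t, s). F t s) has_derivative
        (\<lambda>(t, s). t * (\<Sum>l\<in>L. v $ l * g l x) + blinfun_mult_right (g l (x + 0 *\<^sub>R u + 0 *\<^sub>R ax l)) s))
        (at (0, 0) within ball 0 d \<times> ball 0 d')"
    proof (rule has_derivative_partialsI[where f = F
          and fy = "\<lambda>t s. blinfun_mult_right (g l (x + t *\<^sub>R u + s *\<^sub>R ax l))"])
      have "((\<lambda>t. F t 0) has_derivative (\<lambda>t. (\<Sum>l\<in>L. v $ l * g l x) * t)) (at 0)"
        using insert.IH by (simp add: F_def u_def has_field_derivative_def)
      then show "((\<lambda>t. F t 0) has_derivative (\<lambda>t. t * (\<Sum>l\<in>L. v $ l * g l x))) (at 0 within ball 0 d)"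
        by (simp add: mult.commute has_derivative_at_withinI)
      show "(F t has_derivative blinfun_apply (blinfun_mult_right (g l (x + t *\<^sub>R u + s *\<^sub>R ax l)))) (at s within ball 0 d')"
        if "t \<in> ball 0 d" "s \<in> ball 0 d'" for t s
      proof -
        have "(F t has_real_derivative g l (x + t *\<^sub>R u + s *\<^sub>R ax l)) (at s)"
          unfolding F_def by (rule DERIV_along_axis_shift[OF g(2)[OF inS[OF that]]])
        then show ?thesis
          by (simp add: has_field_derivative_def has_derivative_at_withinI)
      qed
      have "continuous_on (ball 0 d \<times> ball 0 d') (\<lambda>p. x + fst p *\<^sub>R u + snd p *\<^sub>R ax l)"
        by (intro continuous_intros)
      then have "continuous_on (ball 0 d \<times> ball 0 d') (\<lambda>p. g l (x + fst p *\<^sub>R u + snd p *\<^sub>R ax l))"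
        using inS by (intro continuous_on_compose2[OF g(1)]) auto
      then have "continuous_on (ball 0 d \<times> ball 0 d')
          (\<lambda>p. blinfun_mult_right (g l (x + fst p *\<^sub>R u + snd p *\<^sub>R ax l)))"
        by (rule bounded_linear.continuous_on[OF bounded_linear_blinfun_mult_right])
      then show "continuous (at (0, 0) within ball 0 d \<times> ball 0 d')
          (\<lambda>(t, s). blinfun_mult_right (g l (x + t *\<^sub>R u + s *\<^sub>R ax l)))"
        unfolding case_prod_beta continuous_on_eq_continuous_within by (rule bspec) (use d in simp)
    qed (use d in auto)
    then have "((\<lambda>(t, s). F t s) has_derivative
        (\<lambda>(t, s). t * (\<Sum>l\<in>L. v $ l * g l x) + g l x * s)) (at (0, 0))"
      using d by (subst (asm) at_within_open) (auto simp: open_Times zero_prod_def case_prod_beta)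
    moreover have "((\<lambda>t::real. (t, t * v $ l)) has_derivative (\<lambda>t. (t, t * v $ l))) (at 0)"
      by (intro derivative_eq_intros) auto
    ultimately have "((\<lambda>t. (\<lambda>(t, s). F t s) (t, t * v $ l)) has_derivative
        (\<lambda>t. (\<lambda>(t, s). t * (\<Sum>l\<in>L. v $ l * g l x) + g l x * s) (t, t * v $ l))) (at 0)"
      using has_derivative_compose[of "\<lambda>t. (t, t * v $ l)" "\<lambda>t. (t, t * v $ l)" 0 UNIV
          "\<lambda>(t, s). F t s" "\<lambda>(t, s). t * (\<Sum>l\<in>L. v $ l * g l x) + g l x * s"] by simp
    then have "((\<lambda>t. F t (t * v $ l)) has_derivative
        (\<lambda>t. t * (\<Sum>l\<in>L. v $ l * g l x) + g l x * (t * v $ l))) (at 0)"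
      by simp
    moreover have "(\<lambda>t. t * (\<Sum>l\<in>L. v $ l * g l x) + g l x * (t * v $ l))
        = (*) (\<Sum>l\<in>insert l L. v $ l * g l x)"
      using insert.hyps by (simp add: fun_eq_iff algebra_simps)
    moreover have "(\<lambda>t. F t (t * v $ l)) = (\<lambda>t. f (x + t *\<^sub>R vL (insert l L)))"
      by (simp add: F_def vL fun_eq_iff scaleR_right_distrib add.assoc)
    ultimately show ?case
      by (simp add: has_field_derivative_def)
  qed
  from this[of UNIV] show ?thesis
    by (simp add: vL_def)
qed

definition avg :: "'m \<Rightarrow> real \<Rightarrow> (real ^ 'm \<Rightarrow> real) \<Rightarrow> real ^ 'm \<Rightarrow> real" where
  "avg l h f x = integral {0..h} (\<lambda>t. f (x + t *\<^sub>R ax l)) / h"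

lemma continuous_on_translate_pair:
  assumes f: "continuous_on (open_box c) f"
  shows "continuous_on (open_box (c - h) \<times> {0..h}) (\<lambda>(x, t). f (x + t *\<^sub>R ax l))"
proof -
  have "continuous_on (open_box (c - h) \<times> {0..h}) (\<lambda>p. fst p + snd p *\<^sub>R ax l)"
    by (intro continuous_intros)
  then have "continuous_on (open_box (c - h) \<times> {0..h}) (\<lambda>p. f (fst p + snd p *\<^sub>R ax l))"
  proof (rule continuous_on_compose2[OF f])
    show "(\<lambda>p. fst p + snd p *\<^sub>R ax l) ` (open_box (c - h) \<times> {0..h}) \<subseteq> open_box c"
      using open_box_step[of _ c h _ l] by (intro image_subsetI) (simp only: mem_Times_iff atLeastAtMost_iff)
  qed
  then show ?thesis
    by (simp add: case_prod_beta)
qed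

lemma continuous_on_avg:
  assumes "continuous_on (open_box c) f" "0 < h"
  shows "continuous_on (open_box (c - h)) (avg l h f)"
proof -
  have "continuous_on (open_box (c - h)) (\<lambda>x. integral (cbox 0 h) (\<lambda>t. f (x + t *\<^sub>R ax l)))"
    by (rule integral_continuous_on_param, unfold cbox_interval)
      (rule continuous_on_translate_pair[OF assms(1)])
  then show ?thesis
    unfolding avg_def cbox_interval using assms(2) by (intro continuous_on_divide continuous_on_const) simp_all
qed

lemma continuous_on_axis:
  assumes f: "continuous_on (open_box c) f" and x: "\<And>t. t \<in> T \<Longrightarrow> x + t *\<^sub>R ax l \<in> open_box c"
  shows "continuous_on T (\<lambda>t. f (x + t *\<^sub>R ax l))"
proof -
  have "continuous_on T (\<lambda>t. x + t *\<^sub>R ax l)"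
    by (intro continuous_intros)
  then show ?thesis
    by (rule continuous_on_compose2[OF f]) (use x in auto)
qed

text \<open>Averaging gains one derivative in its direction, and this derivative is a difference quotient.\<close>

lemma avg_has_derivative_same_axis:
  assumes f: "continuous_on (open_box c) f" and h: "0 < h" and x: "x \<in> open_box (c - h)"
  shows "((\<lambda>t. avg l h f (x + t *\<^sub>R ax l)) has_real_derivative (f (x + h *\<^sub>R ax l) - f x) / h) (at 0)"
proof -
  obtain r where r: "0 < r" "\<And>t. \<bar>t\<bar> < r \<Longrightarrow> x + t *\<^sub>R ax l \<in> open_box (c - h)"
    using open_axis_ball[OF open_open_box x, where l = l] by blast
  define \<phi> where "\<phi> s = f (x + s *\<^sub>R ax l)" for s
  define r' where "r' = r / 2"
  have r': "0 < r'" "r' < r"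
    using r(1) by (simp_all add: r'_def)
  have box: "x + s *\<^sub>R ax l \<in> open_box c" if "- r < s" "s < h + r" for s
  proof (cases "s < r")
    case True
    then show ?thesis
      using open_box_step[OF r(2)[of s], of 0 l] that(1) h by simp
  next
    case False
    define t where "t = max 0 (s - h)"
    have "\<bar>t\<bar> < r" "0 \<le> s - t" "s - t \<le> h"
      using that False r(1) h by (auto simp: t_def)
    from open_box_step[OF r(2)[OF this(1)] this(2,3), of l] show ?thesis
      by (simp add: add.assoc flip: scaleR_left_distrib)
  qed
  have cont: "continuous_on {- r'..h + r'} \<phi>"
    unfolding \<phi>_def by (intro continuous_on_axis[OF f] box) (use r' in auto)
  define \<Phi> where "\<Phi> u = integral {- r'..u} \<phi>" for u
  have \<Phi>: "(\<Phi> has_real_derivative \<phi> u) (at u)" if "- r' < u" "u < h + r'" for u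
  proof -
    have "(\<Phi> has_real_derivative \<phi> u) (at u within {- r'..h + r'})"
      unfolding \<Phi>_def using that by (intro integral_has_real_derivative[OF cont]) auto
    then show ?thesis
      using that by (subst (asm) at_within_Icc_at) auto
  qed
  have eq: "avg l h f (x + t *\<^sub>R ax l) = (\<Phi> (t + h) - \<Phi> t) / h" if "- r' < t" "t < r'" for t
  proof -
    have "integral {0..h} (\<lambda>s. f (x + t *\<^sub>R ax l + s *\<^sub>R ax l)) = integral {0..h} (\<phi> \<circ> (+) t)"
      by (simp add: \<phi>_def o_def add.assoc flip: scaleR_left_distrib)
    also have "\<dots> = integral {t..t + h} \<phi>"
      by (subst integral_shift_Icc_real) (simp add: add.commute)
    also have "\<dots> = \<Phi> (t + h) - \<Phi> t"
    proof -
      have "\<phi> integrable_on {- r'..t + h}"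
        using that h by (intro integrable_continuous_real continuous_on_subset[OF cont]) auto
      from Henstock_Kurzweil_Integration.integral_combine[OF _ _ this, of t] show ?thesis
        using that h by (simp add: \<Phi>_def)
    qed
    finally show ?thesis
      by (simp add: avg_def)
  qed
  have "((\<lambda>t. \<Phi> (t + h)) has_real_derivative \<phi> h) (at 0)"
    using DERIV_shift[of \<Phi> "\<phi> h" 0 h] \<Phi>[of h] r' h by simp
  then have "((\<lambda>t. (\<Phi> (t + h) - \<Phi> t) / h) has_real_derivative (\<phi> h - \<phi> 0) / h) (at 0)"
    using \<Phi>[of 0] r' h by (intro DERIV_cdivide DERIV_diff) auto
  moreover have "\<forall>\<^sub>F t in nhds 0. avg l h f (x + t *\<^sub>R ax l) = (\<Phi> (t + h) - \<Phi> t) / h"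
    using r'(1) eq by (auto simp: eventually_nhds_metric dist_real_def intro!: exI[of _ r'])
  ultimately show ?thesis
    by (subst DERIV_cong_ev[OF refl _ refl]) (auto simp: \<phi>_def)
qed

lemma avg_has_derivative:
  assumes f: "continuous_on (open_box c) f" and f': "continuous_on (open_box c) f'"
    and D: "\<And>x. x \<in> open_box c \<Longrightarrow> ((\<lambda>t. f (x + t *\<^sub>R ax i)) has_real_derivative f' x) (at 0)"
    and h: "0 < h" and x: "x \<in> open_box (c - h)"
  shows "((\<lambda>t. avg l h f (x + t *\<^sub>R ax i)) has_real_derivative avg l h f' x) (at 0)"
proof -
  obtain r where r: "0 < r" "\<And>t. \<bar>t\<bar> < r \<Longrightarrow> x + t *\<^sub>R ax i \<in> open_box (c - h)"
    using open_axis_ball[OF open_open_box x, where l = i] by blast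
  have box: "x + t *\<^sub>R ax i + s *\<^sub>R ax l \<in> open_box c" if "t \<in> {-r<..<r}" "s \<in> {0..h}" for t s
    by (rule open_box_step[OF r(2)]) (use that in auto)
  have swap: "x + s *\<^sub>R ax l + t *\<^sub>R ax i = x + t *\<^sub>R ax i + s *\<^sub>R ax l" for s t
    by simp
  have "((\<lambda>t. integral (cbox 0 h) (\<lambda>s. f (x + t *\<^sub>R ax i + s *\<^sub>R ax l))) has_real_derivative
      integral (cbox 0 h) (\<lambda>s. f' (x + 0 *\<^sub>R ax i + s *\<^sub>R ax l))) (at 0 within {-r<..<r})"
  proof (rule leibniz_rule_field_derivative)
    fix t s assume ts: "t \<in> {-r<..<r}" "s \<in> cbox 0 h"
    have "((\<lambda>t. f (x + s *\<^sub>R ax l + t *\<^sub>R ax i)) has_real_derivative f' (x + s *\<^sub>R ax l + t *\<^sub>R ax i)) (at t)"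
      by (rule DERIV_along_axis_shift[OF D]) (use box[OF ts(1)] ts in \<open>simp only: swap cbox_interval\<close>)
    then show "((\<lambda>t. f (x + t *\<^sub>R ax i + s *\<^sub>R ax l)) has_real_derivative f' (x + t *\<^sub>R ax i + s *\<^sub>R ax l))
        (at t within {-r<..<r})"
      unfolding swap by (rule has_field_derivative_at_within)
  next
    fix t assume t: "t \<in> {-r<..<r}"
    have "continuous_on {0..h} (\<lambda>s. f (x + t *\<^sub>R ax i + s *\<^sub>R ax l))"
      by (intro continuous_on_axis[OF f] box[OF t])
    then show "(\<lambda>s. f (x + t *\<^sub>R ax i + s *\<^sub>R ax l)) integrable_on cbox 0 h"
      unfolding cbox_interval by (rule integrable_continuous_real)
  next
    have "continuous_on ({-r<..<r} \<times> {0..h}) (\<lambda>p. x + fst p *\<^sub>R ax i + snd p *\<^sub>R ax l)"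
      by (intro continuous_intros)
    then have "continuous_on ({-r<..<r} \<times> {0..h}) (\<lambda>p. f' (x + fst p *\<^sub>R ax i + snd p *\<^sub>R ax l))"
      by (rule continuous_on_compose2[OF f'])
        (intro image_subsetI box; simp only: mem_Times_iff)
    then show "continuous_on ({-r<..<r} \<times> cbox 0 h) (\<lambda>(t, s). f' (x + t *\<^sub>R ax i + s *\<^sub>R ax l))"
      unfolding cbox_interval case_prod_beta .
  qed (use r in auto)
  then have "((\<lambda>t. integral {0..h} (\<lambda>s. f (x + t *\<^sub>R ax i + s *\<^sub>R ax l))) has_real_derivative
      integral {0..h} (\<lambda>s. f' (x + s *\<^sub>R ax l))) (at 0)"
    using r(1) by (subst (asm) at_within_open) (simp_all add: cbox_interval)
  then show ?thesis
    unfolding avg_def by (rule DERIV_cdivide)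
qed

lemma avg_tendsto:
  assumes f: "continuous_on (open_box c) f" and x: "x \<in> open_box c"
  shows "((\<lambda>h. avg l h f x) \<longlongrightarrow> f x) (at_right 0)"
proof -
  obtain r where r: "0 < r" "\<And>t. \<bar>t\<bar> < r \<Longrightarrow> x + t *\<^sub>R ax l \<in> open_box c"
    using open_axis_ball[OF open_open_box x, where l = l] by blast
  define \<phi> where "\<phi> s = f (x + s *\<^sub>R ax l)" for s
  have "continuous_on {0..r / 2} \<phi>"
    unfolding \<phi>_def by (intro continuous_on_axis[OF f] r(2)) (use r(1) in auto)
  from integral_has_real_derivative[OF this, of 0]
  have "((\<lambda>u. integral {0..u} \<phi>) has_real_derivative \<phi> 0) (at 0 within {0..r / 2})"
    using r(1) by simp
  then have "((\<lambda>u. integral {0..u} \<phi>) has_real_derivative \<phi> 0) (at_right 0)"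
    using r(1) by (simp add: at_within_Icc_at_right)
  then show ?thesis
    by (simp add: has_field_derivative_iff avg_def \<phi>_def[abs_def])
qed


section \<open>Non-negative differences from positivity on squares\<close>

definition vec_power :: "real ^ 'm \<Rightarrow> nat \<Rightarrow> real ^ 'm" where
  "vec_power y k = (\<chi> l. (y $ l) ^ k)"

definition monomial :: "real ^ 'm \<Rightarrow> ('m \<Rightarrow> nat) \<Rightarrow> real" where
  "monomial y \<alpha> = (\<Prod>l\<in>UNIV. (y $ l) ^ \<alpha> l)"

text \<open>If the numbers \<open>f (a + \<epsilon> *\<^sub>R vec_power y k)\<close> are the moments of a
measure, then the sum is the integral of \<open>p\<^sup>2\<close>. For fixed \<open>p\<close>
and \<open>\<epsilon>\<close> the condition involves translates of \<open>f\<close> only, and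
therefore it is inherited by averages.\<close>

definition square_positive :: "real ^ 'm \<Rightarrow> real \<Rightarrow> (real ^ 'm \<Rightarrow> real) \<Rightarrow> bool" where
  "square_positive y c f \<longleftrightarrow>
     (\<forall>p a \<epsilon>. (\<forall>l. 0 < a $ l \<and> a $ l + \<epsilon> < c) \<longrightarrow> 0 \<le> \<epsilon> \<longrightarrow>
        0 \<le> (\<Sum>k\<le>degree (p * p). coeff (p * p) k * f (a + \<epsilon> *\<^sub>R vec_power y k)))"

text \<open>The function \<open>d \<alpha>\<close> is the partial derivative of order
\<open>\<alpha>\<close> of \<open>d (\<lambda>_. 0)\<close>, and \<open>w l\<close> bounds the
number of derivatives available in direction \<open>l\<close>. Indexing by exponents instead of
lists of coordinates builds in that the order of differentiation is irrelevant.\<close>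

definition jet :: "('m \<Rightarrow> nat) \<Rightarrow> real \<Rightarrow> (('m \<Rightarrow> nat) \<Rightarrow> real ^ 'm \<Rightarrow> real) \<Rightarrow> bool" where
  "jet w c d \<longleftrightarrow> (\<forall>\<alpha>\<le>w. continuous_on (open_box c) (d \<alpha>) \<and>
     (\<forall>l x. \<alpha> l < w l \<longrightarrow> x \<in> open_box c \<longrightarrow>
        ((\<lambda>t. d \<alpha> (x + t *\<^sub>R ax l)) has_real_derivative d (\<alpha>(l := Suc (\<alpha> l))) x) (at 0)))"

lemma eventually_less_at_right: "0 < b \<Longrightarrow> \<forall>\<^sub>F \<epsilon> in at_right (0 :: real). \<epsilon> < b"
  by (auto simp: eventually_at_right_field)

lemma jetD:
  assumes "jet w c d" "\<alpha> \<le> w"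
  shows "continuous_on (open_box c) (d \<alpha>)"
    and "\<alpha> l < w l \<Longrightarrow> x \<in> open_box c \<Longrightarrow>
      ((\<lambda>t. d \<alpha> (x + t *\<^sub>R ax l)) has_real_derivative d (\<alpha>(l := Suc (\<alpha> l))) x) (at 0)"
  using assms by (auto simp: jet_def)

text \<open>Averaging in direction \<open>l\<close> makes one more derivative in this direction available. A
derivative without a component in direction \<open>l\<close> is averaged; otherwise one
differentiation in direction \<open>l\<close> is used up by the average and turns it into a
difference quotient.\<close>

lemma jet_avg:
  fixes l :: "'m :: finite"
  assumes d: "jet w c d" and h: "0 < h"
  defines "d' \<equiv> \<lambda>\<alpha>. if \<alpha> l = 0 then avg l h (d \<alpha>)
      else (\<lambda>x. (d (\<alpha>(l := \<alpha> l - 1)) (x + h *\<^sub>R ax l) - d (\<alpha>(l := \<alpha> l - 1)) x) / h)"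
  shows "jet (w(l := Suc (w l))) (c - h) d'"
  unfolding jet_def
proof (intro allI impI conjI)
  fix \<alpha> assume \<alpha>: "\<alpha> \<le> w(l := Suc (w l))"
  have step: "x + h *\<^sub>R ax l \<in> open_box c" "x \<in> open_box c" if "x \<in> open_box (c - h)" for x
    using open_box_step[OF that, of h l] open_box_step[OF that, of 0 l] h by simp_all
  have cont_diff: "continuous_on (open_box (c - h)) (\<lambda>x. (g (x + h *\<^sub>R ax l) - g x) / h)"
    if g: "continuous_on (open_box c) g" for g
  proof -
    have "continuous_on (open_box (c - h)) (\<lambda>x. x + h *\<^sub>R ax l)"
      by (intro continuous_intros)
    then have "continuous_on (open_box (c - h)) (\<lambda>x. g (x + h *\<^sub>R ax l))"
      by (rule continuous_on_compose2[OF g]) (use step in blast)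
    moreover have "continuous_on (open_box (c - h)) g"
      using continuous_on_subset[OF g] step by blast
    ultimately show ?thesis
      using h by (intro continuous_on_divide continuous_on_diff continuous_on_const) simp_all
  qed
  have le: "\<alpha> i \<le> w i" if "i \<noteq> l" for i
    using le_funD[OF \<alpha>, of i] that by simp
  have le_l: "\<alpha> l \<le> Suc (w l)"
    using le_funD[OF \<alpha>, of l] by simp
  have le0: "\<alpha> \<le> w" if "\<alpha> l = 0"
  proof (rule le_funI)
    show "\<alpha> i \<le> w i" for i
      by (cases "i = l") (simp_all add: le that)
  qed
  have le1: "\<alpha>(l := \<alpha> l - 1) \<le> w" if "\<alpha> l \<noteq> 0"
  proof (rule le_funI)
    show "(\<alpha>(l := \<alpha> l - 1)) i \<le> w i" for i
      using le_l by (cases "i = l") (simp_all add: le)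
  qed
  show "continuous_on (open_box (c - h)) (d' \<alpha>)"
    using continuous_on_avg[OF jetD(1)[OF d le0] h] cont_diff[OF jetD(1)[OF d le1]]
    by (simp add: d'_def)
  fix i and x :: "real ^ 'm" assume i: "\<alpha> i < (w(l := Suc (w l))) i" and x: "x \<in> open_box (c - h)"
  show "((\<lambda>t. d' \<alpha> (x + t *\<^sub>R ax i)) has_real_derivative d' (\<alpha>(i := Suc (\<alpha> i))) x) (at 0)"
  proof (cases "\<alpha> l = 0")
    case True
    show ?thesis
    proof (cases "i = l")
      case i_l: True
      have "((\<lambda>t. avg l h (d \<alpha>) (x + t *\<^sub>R ax l)) has_real_derivative
          (d \<alpha> (x + h *\<^sub>R ax l) - d \<alpha> x) / h) (at 0)"
        by (rule avg_has_derivative_same_axis[OF jetD(1)[OF d le0[OF True]] h x])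
      moreover have "\<alpha>(l := 0) = \<alpha>"
        using True by auto
      ultimately show ?thesis
        using True by (simp add: d'_def i_l)
    next
      case False
      then have iw: "\<alpha> i < w i"
        using i by simp
      then have le2: "\<alpha>(i := Suc (\<alpha> i)) \<le> w"
        using le0[OF True] by (auto simp: le_fun_def)
      have "((\<lambda>t. avg l h (d \<alpha>) (x + t *\<^sub>R ax i)) has_real_derivative
          avg l h (d (\<alpha>(i := Suc (\<alpha> i)))) x) (at 0)"
        by (rule avg_has_derivative[OF jetD(1)[OF d le0[OF True]] jetD(1)[OF d le2]
              jetD(2)[OF d le0[OF True] iw] h x])
      then show ?thesis
        using True False by (simp add: d'_def)
    qed
  next
    case False
    define \<beta> where "\<beta> = \<alpha>(l := \<alpha> l - 1)"
    have \<beta>: "\<beta> \<le> w"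
      using le1[OF False] by (simp add: \<beta>_def)
    have "\<beta> i < w i"
      using i False by (auto simp: \<beta>_def)
    then have D: "((\<lambda>t. d \<beta> (z + t *\<^sub>R ax i)) has_real_derivative d (\<beta>(i := Suc (\<beta> i))) z) (at 0)"
      if "z \<in> open_box c" for z
      using jetD(2)[OF d \<beta>] that by blast
    have "((\<lambda>t. (d \<beta> (x + h *\<^sub>R ax l + t *\<^sub>R ax i) - d \<beta> (x + t *\<^sub>R ax i)) / h) has_real_derivative
        (d (\<beta>(i := Suc (\<beta> i))) (x + h *\<^sub>R ax l) - d (\<beta>(i := Suc (\<beta> i))) x) / h) (at 0)"
      using D step[OF x] by (intro DERIV_cdivide DERIV_diff) blast+
    moreover have "x + h *\<^sub>R ax l + t *\<^sub>R ax i = x + t *\<^sub>R ax i + h *\<^sub>R ax l" for t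
      by simp
    moreover have "(\<alpha>(i := Suc (\<alpha> i)))(l := (\<alpha>(i := Suc (\<alpha> i))) l - 1) = \<beta>(i := Suc (\<beta> i))"
      using False by (auto simp: \<beta>_def fun_eq_iff)
    moreover have "(\<alpha>(i := Suc (\<alpha> i))) l \<noteq> 0"
      using False by simp
    ultimately show ?thesis
      using False by (simp only: d'_def \<beta>_def[symmetric] if_False)
  qed
qed

lemma square_positive_avg:
  fixes y :: "real ^ 'm"
  assumes pos: "square_positive y c f" and f: "continuous_on (open_box c) f" and h: "0 < h"
    and y: "\<And>l. 0 < y $ l \<and> y $ l < 1"
  shows "square_positive y (c - h) (avg l h f)"
  unfolding square_positive_def
proof (intro allI impI)
  fix p :: "real poly" and a :: "real ^ 'm" and \<epsilon> :: real
  assume a: "\<forall>l. 0 < a $ l \<and> a $ l + \<epsilon> < c - h" and \<epsilon>: "0 \<le> \<epsilon>"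
  let ?x = "\<lambda>k. a + \<epsilon> *\<^sub>R vec_power y k"
  let ?q = "\<lambda>k. coeff (p * p) k" and ?K = "{..degree (p * p)}"
  have x: "?x k \<in> open_box (c - h)" for k
  proof -
    have "0 \<le> \<epsilon> * y $ l ^ k" "\<epsilon> * y $ l ^ k \<le> \<epsilon>" for l
      using y[of l] \<epsilon> by (simp_all add: power_le_one mult_left_le)
    then show ?thesis
      using a by (auto simp: vec_power_def add_pos_nonneg) (meson add_left_mono le_less_trans)
  qed
  have int: "(\<lambda>t. f (?x k + t *\<^sub>R ax l)) integrable_on {0..h}" for k
    by (intro integrable_continuous_real continuous_on_axis[OF f] open_box_step[OF x]) auto
  have "(\<Sum>k\<in>?K. ?q k * avg l h f (?x k))
      = integral {0..h} (\<lambda>t. \<Sum>k\<in>?K. ?q k * f (?x k + t *\<^sub>R ax l)) / h"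
    using int by (subst integral_sum)
      (auto simp: avg_def sum_divide_distrib intro!: integrable_on_mult_right)
  also have "0 \<le> \<dots>"
  proof (intro divide_nonneg_pos integral_nonneg)
    show "(\<lambda>t. \<Sum>k\<in>?K. ?q k * f (?x k + t *\<^sub>R ax l)) integrable_on {0..h}"
      using int by (intro integrable_sum) (auto intro!: integrable_on_mult_right)
    fix t assume t: "t \<in> {0..h}"
    have "\<forall>i. 0 < (a + t *\<^sub>R ax l) $ i \<and> (a + t *\<^sub>R ax l) $ i + \<epsilon> < c"
    proof
      fix i
      have "0 < a $ i \<and> a $ i + \<epsilon> < c - h"
        using a by blast
      then show "0 < (a + t *\<^sub>R ax l) $ i \<and> (a + t *\<^sub>R ax l) $ i + \<epsilon> < c"
        using t by (auto simp: axis_def)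
    qed
    then have "0 \<le> (\<Sum>k\<in>?K. ?q k * f (a + t *\<^sub>R ax l + \<epsilon> *\<^sub>R vec_power y k))"
      using pos \<epsilon> unfolding square_positive_def by blast
    then show "0 \<le> (\<Sum>k\<in>?K. ?q k * f (?x k + t *\<^sub>R ax l))"
      by (simp only: add_ac)
  qed (fact h)
  finally show "0 \<le> (\<Sum>k\<in>?K. ?q k * avg l h f (?x k))" .
qed

lemma monomial_Suc: "monomial y (\<gamma>(l := Suc (\<gamma> l))) = y $ l * monomial y \<gamma>"
proof -
  have "monomial y (\<gamma>(l := Suc (\<gamma> l))) = (\<Prod>i\<in>UNIV. (if i = l then y $ i else 1) * y $ i ^ \<gamma> i)"
    unfolding monomial_def by (rule prod.cong) auto
  then show ?thesis
    by (simp add: prod.distrib monomial_def)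
qed

lemma sum_fun_upd_Suc: "(\<Sum>i\<in>UNIV. (\<gamma>(l := Suc (\<gamma> l))) i) = Suc (\<Sum>i\<in>UNIV. \<gamma> (i :: 'm :: finite))"
proof -
  have "(\<Sum>i\<in>UNIV. (\<gamma>(l := Suc (\<gamma> l))) i) = (\<Sum>i\<in>UNIV. (if i = l then 1 else 0) + \<gamma> i)"
    by (rule sum.cong) auto
  then show ?thesis
    by (simp add: sum.distrib)
qed

text \<open>The weights \<open>q\<close> stand for the polynomial with coefficients \<open>q k\<close>. If
it vanishes at \<open>y\<^sup>\<gamma>\<close> for all \<open>\<gamma>\<close> of order at most
\<open>n\<close> except \<open>\<alpha>\<close>, then the Taylor coefficient of order
\<open>\<alpha>\<close> is the leading one. Instead of a Taylor formula, l'Hopital's rule is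
iterated: differentiation with respect to \<open>\<epsilon>\<close> gives one term for each
coordinate \<open>l\<close>, in which \<open>q k\<close> is replaced by \<open>q k * y $ l ^
k\<close> and \<open>d \<beta>\<close> by its derivative in direction \<open>l\<close>. The new
weights vanish at \<open>y\<^sup>\<gamma>\<close> when the old ones vanish at
\<open>y\<^sup>\<gamma>\<close> multiplied by \<open>y $ l\<close>. The factor
\<open>\<kappa>\<close> is the reciprocal of the factorial of \<open>\<alpha>\<close>, but only
its sign matters below.\<close>

lemma leading_term:
  fixes q :: "nat \<Rightarrow> real" and y a :: "real ^ 'm" and K :: nat
  assumes d: "jet w c d" and a: "a \<in> open_box c"
    and "(\<Sum>l\<in>UNIV. \<alpha> l) = n" "\<And>l. \<beta> l + n \<le> w l"
    and "\<And>\<gamma>. (\<Sum>l\<in>UNIV. \<gamma> l) \<le> n \<Longrightarrow> \<gamma> \<noteq> \<alpha> \<Longrightarrow> (\<Sum>k\<le>K. q k * monomial y \<gamma> ^ k) = 0"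
  shows "\<exists>\<kappa>>0. ((\<lambda>\<epsilon>. (\<Sum>k\<le>K. q k * d \<beta> (a + \<epsilon> *\<^sub>R vec_power y k)) / \<epsilon> ^ n) \<longlongrightarrow>
      \<kappa> * ((\<Sum>k\<le>K. q k * monomial y \<alpha> ^ k) * d (\<lambda>l. \<beta> l + \<alpha> l) a)) (at_right 0)"
  using assms(3-)
proof (induction n arbitrary: q \<alpha> \<beta>)
  case (0 q \<alpha> \<beta>)
  have \<alpha>: "\<alpha> = (\<lambda>_. 0)"
    using 0(1) by auto
  have "\<beta> \<le> w"
    using 0(2) by (simp add: le_fun_def)
  then have "continuous (at a) (d \<beta>)"
    using jetD(1)[OF d] a continuous_on_eq_continuous_at[OF open_open_box] by blast
  then have "((\<lambda>\<epsilon>. d \<beta> (a + \<epsilon> *\<^sub>R vec_power y k)) \<longlongrightarrow> d \<beta> a) (at_right 0)" for k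
    by (rule isCont_tendsto_compose) (auto intro!: tendsto_eq_intros)
  then have "((\<lambda>\<epsilon>. \<Sum>k\<le>K. q k * d \<beta> (a + \<epsilon> *\<^sub>R vec_power y k)) \<longlongrightarrow> (\<Sum>k\<le>K. q k * d \<beta> a)) (at_right 0)"
    by (intro tendsto_sum tendsto_mult tendsto_const)
  then show ?case
    by (intro exI[of _ 1]) (simp add: \<alpha> monomial_def sum_distrib_right)
next
  case (Suc n q \<alpha> \<beta>)
  define \<Psi> where "\<Psi> q \<beta> \<epsilon> = (\<Sum>k\<le>K. q k * d \<beta> (a + \<epsilon> *\<^sub>R vec_power y k))" for q \<beta> \<epsilon>
  define q' where "q' l k = q k * y $ l ^ k" for l k
  define \<beta>' where "\<beta>' l = \<beta>(l := Suc (\<beta> l))" for l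
  define A where "A = (\<Sum>k\<le>K. q k * monomial y \<alpha> ^ k)"
  define E where "E = d (\<lambda>l. \<beta> l + \<alpha> l) a"
  have q'_sum: "(\<Sum>k\<le>K. q' l k * monomial y \<gamma> ^ k) = (\<Sum>k\<le>K. q k * monomial y (\<gamma>(l := Suc (\<gamma> l))) ^ k)" for l \<gamma>
    by (simp add: q'_def monomial_Suc power_mult_distrib mult.assoc)
  have \<beta>'_le: "\<beta>' l i + n \<le> w i" for l i
    using Suc.prems(2)[of i] by (cases "i = l") (simp_all add: \<beta>'_def)
  have "\<exists>\<kappa>\<ge>0. (0 < \<alpha> l \<longrightarrow> 0 < \<kappa>) \<and> ((\<lambda>\<epsilon>. \<Psi> (q' l) (\<beta>' l) \<epsilon> / \<epsilon> ^ n) \<longlongrightarrow> \<kappa> * (A * E)) (at_right 0)" for l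
  proof (cases "0 < \<alpha> l")
    case True
    define \<alpha>' where "\<alpha>' = \<alpha>(l := \<alpha> l - 1)"
    have \<alpha>: "\<alpha>'(l := Suc (\<alpha>' l)) = \<alpha>"
      using True by (auto simp: \<alpha>'_def)
    have "(\<Sum>l\<in>UNIV. \<alpha>' l) = n"
      using sum_fun_upd_Suc[of \<alpha>' l] Suc.prems(1) by (simp add: \<alpha>)
    moreover have "(\<Sum>k\<le>K. q' l k * monomial y \<gamma> ^ k) = 0" if "(\<Sum>l\<in>UNIV. \<gamma> l) \<le> n" "\<gamma> \<noteq> \<alpha>'" for \<gamma>
      unfolding q'_sum
    proof (rule Suc.prems(3))
      show "(\<Sum>i\<in>UNIV. (\<gamma>(l := Suc (\<gamma> l))) i) \<le> Suc n"
        using that(1) by (simp only: sum_fun_upd_Suc)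
      show "\<gamma>(l := Suc (\<gamma> l)) \<noteq> \<alpha>"
      proof
        assume eq: "\<gamma>(l := Suc (\<gamma> l)) = \<alpha>"
        have "\<gamma> i = \<alpha>' i" for i
          using fun_cong[OF eq, of i] by (auto simp: \<alpha>'_def split: if_splits)
        then show False
          using that(2) by auto
      qed
    qed
    ultimately obtain \<kappa> where \<kappa>: "\<kappa> > 0" "((\<lambda>\<epsilon>. \<Psi> (q' l) (\<beta>' l) \<epsilon> / \<epsilon> ^ n) \<longlongrightarrow>
        \<kappa> * ((\<Sum>k\<le>K. q' l k * monomial y \<alpha>' ^ k) * d (\<lambda>i. \<beta>' l i + \<alpha>' i) a)) (at_right 0)"
      using Suc.IH[of \<alpha>' "\<beta>' l" "q' l"] \<beta>'_le unfolding \<Psi>_def by blast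
    moreover have "(\<lambda>i. \<beta>' l i + \<alpha>' i) = (\<lambda>i. \<beta> i + \<alpha> i)"
      using True by (auto simp: \<beta>'_def \<alpha>'_def)
    ultimately show ?thesis
      by (intro exI[of _ \<kappa>]) (simp add: q'_sum \<alpha> A_def E_def)
  next
    case False
    define \<alpha>' where "\<alpha>' = (\<lambda>_. 0 :: nat)(l := n)"
    have "(\<Sum>l\<in>UNIV. \<alpha>' l) = n"
      by (simp add: \<alpha>'_def)
    moreover have zero: "(\<Sum>k\<le>K. q' l k * monomial y \<gamma> ^ k) = 0" if "(\<Sum>l\<in>UNIV. \<gamma> l) \<le> n" for \<gamma>
      unfolding q'_sum
    proof (rule Suc.prems(3))
      show "(\<Sum>i\<in>UNIV. (\<gamma>(l := Suc (\<gamma> l))) i) \<le> Suc n"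
        using that(1) by (simp only: sum_fun_upd_Suc)
      show "\<gamma>(l := Suc (\<gamma> l)) \<noteq> \<alpha>"
        using False by (metis fun_upd_same zero_less_Suc)
    qed
    ultimately obtain \<kappa> where "((\<lambda>\<epsilon>. \<Psi> (q' l) (\<beta>' l) \<epsilon> / \<epsilon> ^ n) \<longlongrightarrow>
        \<kappa> * ((\<Sum>k\<le>K. q' l k * monomial y \<alpha>' ^ k) * d (\<lambda>i. \<beta>' l i + \<alpha>' i) a)) (at_right 0)"
      using Suc.IH[of \<alpha>' "\<beta>' l" "q' l"] \<beta>'_le unfolding \<Psi>_def by blast
    then show ?thesis
      using False zero[of \<alpha>'] \<open>sum \<alpha>' UNIV = n\<close> by (intro exI[of _ 0]) simp
  qed
  then obtain \<kappa> where \<kappa>: "\<And>l. 0 \<le> \<kappa> l" "\<And>l. 0 < \<alpha> l \<Longrightarrow> 0 < \<kappa> l"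
    "\<And>l. ((\<lambda>\<epsilon>. \<Psi> (q' l) (\<beta>' l) \<epsilon> / \<epsilon> ^ n) \<longlongrightarrow> \<kappa> l * (A * E)) (at_right 0)"
    by metis
  define \<kappa>' where "\<kappa>' = (\<Sum>l\<in>UNIV. \<kappa> l) / Suc n"
  have "\<exists>l. 0 < \<alpha> l"
  proof (rule ccontr)
    assume "\<nexists>l. 0 < \<alpha> l"
    then have "(\<Sum>l\<in>UNIV. \<alpha> l) = 0"
      by simp
    then show False
      using Suc.prems(1) by simp
  qed
  then obtain l where "0 < \<alpha> l" ..
  then have "0 < (\<Sum>l\<in>UNIV. \<kappa> l)"
    using \<kappa>(1,2) by (intro sum_pos2[of UNIV l]) auto
  then have "0 < \<kappa>'"
    by (simp add: \<kappa>'_def)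
  have \<beta>: "\<beta> \<le> w" "\<And>l. \<beta> l < w l"
  proof -
    have less: "\<beta> l < w l" for l
      using Suc.prems(2)[of l] by simp
    then show "\<beta> \<le> w" "\<And>l. \<beta> l < w l"
      by (simp_all add: le_fun_def less_imp_le)
  qed
  have \<beta>': "\<beta>' l \<le> w" for l
    using \<beta> by (simp add: \<beta>'_def le_fun_def Suc_leI)
  have in_box: "\<forall>\<^sub>F \<epsilon> in at_right 0. \<forall>k\<in>{..K}. a + \<epsilon> *\<^sub>R vec_power y k \<in> open_box c"
  proof (intro eventually_ball_finite ballI)
    fix k :: nat
    have "((\<lambda>\<epsilon>. a + \<epsilon> *\<^sub>R vec_power y k) \<longlongrightarrow> a) (at_right 0)"
      by (auto intro!: tendsto_eq_intros)
    then show "\<forall>\<^sub>F \<epsilon> in at_right 0. a + \<epsilon> *\<^sub>R vec_power y k \<in> open_box c"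
      using topological_tendstoD open_open_box a by blast
  qed simp
  have deriv: "(\<Psi> q \<beta> has_real_derivative (\<Sum>l\<in>UNIV. \<Psi> (q' l) (\<beta>' l) \<epsilon>)) (at \<epsilon>)"
    if "\<forall>k\<in>{..K}. a + \<epsilon> *\<^sub>R vec_power y k \<in> open_box c" for \<epsilon>
  proof -
    have "((\<lambda>\<epsilon>. q k * d \<beta> (a + \<epsilon> *\<^sub>R vec_power y k)) has_real_derivative
        q k * (\<Sum>l\<in>UNIV. vec_power y k $ l * d (\<beta>' l) (a + \<epsilon> *\<^sub>R vec_power y k))) (at \<epsilon>)"
      if k: "k \<in> {..K}" for k
    proof (rule DERIV_cmult)
      have "((\<lambda>t. d \<beta> (a + \<epsilon> *\<^sub>R vec_power y k + t *\<^sub>R vec_power y k)) has_real_derivative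
          (\<Sum>l\<in>UNIV. vec_power y k $ l * d (\<beta>' l) (a + \<epsilon> *\<^sub>R vec_power y k))) (at 0)"
      proof (rule DERIV_along_line[OF open_open_box])
        show "a + \<epsilon> *\<^sub>R vec_power y k \<in> open_box c"
          using that k \<open>\<forall>k\<in>{..K}. a + \<epsilon> *\<^sub>R vec_power y k \<in> open_box c\<close> by blast
        show "continuous_on (open_box c) (d (\<beta>' l))" for l
          by (rule jetD(1)[OF d \<beta>'])
        show "((\<lambda>t. d \<beta> (z + t *\<^sub>R ax l)) has_real_derivative d (\<beta>' l) z) (at 0)"
          if "z \<in> open_box c" for l z
          unfolding \<beta>'_def by (rule jetD(2)[OF d \<beta>(1) \<beta>(2) that])
      qed
      moreover have "(\<lambda>t. d \<beta> (a + \<epsilon> *\<^sub>R vec_power y k + t *\<^sub>R vec_power y k))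
          = (\<lambda>t. d \<beta> (a + (t + \<epsilon>) *\<^sub>R vec_power y k))"
        by (simp add: scaleR_left_distrib add_ac)
      ultimately show "((\<lambda>\<epsilon>. d \<beta> (a + \<epsilon> *\<^sub>R vec_power y k)) has_real_derivative
          (\<Sum>l\<in>UNIV. vec_power y k $ l * d (\<beta>' l) (a + \<epsilon> *\<^sub>R vec_power y k))) (at \<epsilon>)"
        using DERIV_shift[of "\<lambda>\<epsilon>. d \<beta> (a + \<epsilon> *\<^sub>R vec_power y k)" _ 0 \<epsilon>] by simp
    qed
    then have "(\<Psi> q \<beta> has_real_derivative
        (\<Sum>k\<le>K. q k * (\<Sum>l\<in>UNIV. vec_power y k $ l * d (\<beta>' l) (a + \<epsilon> *\<^sub>R vec_power y k)))) (at \<epsilon>)"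
      unfolding \<Psi>_def by (intro DERIV_sum) blast
    moreover have "(\<Sum>k\<le>K. q k * (\<Sum>l\<in>UNIV. vec_power y k $ l * d (\<beta>' l) (a + \<epsilon> *\<^sub>R vec_power y k)))
        = (\<Sum>l\<in>UNIV. \<Psi> (q' l) (\<beta>' l) \<epsilon>)"
      unfolding \<Psi>_def sum_distrib_left
      by (subst sum.swap) (simp add: q'_def vec_power_def mult.assoc)
    ultimately show ?thesis
      by simp
  qed
  have "((\<lambda>\<epsilon>. \<Psi> q \<beta> \<epsilon> / \<epsilon> ^ Suc n) \<longlongrightarrow> \<kappa>' * (A * E)) (at_right 0)"
  proof (rule lhopital_right_0)
    have "(\<Sum>k\<le>K. q k * monomial y (\<lambda>_. 0) ^ k) = 0"
      using Suc.prems(1) by (intro Suc.prems(3)) auto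
    then have "\<Psi> q \<beta> 0 = 0"
      by (simp add: \<Psi>_def monomial_def flip: sum_distrib_right)
    moreover have "isCont (\<Psi> q \<beta>) 0"
      using deriv[of 0] a by (intro DERIV_isCont) simp
    ultimately show "(\<Psi> q \<beta> \<longlongrightarrow> 0) (at_right 0)"
      using tendsto_mono[OF at_le[of "{0<..}" UNIV]] by (simp add: isCont_def) blast
    show "((\<lambda>\<epsilon>::real. \<epsilon> ^ Suc n) \<longlongrightarrow> 0) (at_right 0)"
      by (auto intro!: tendsto_eq_intros)
    show "\<forall>\<^sub>F \<epsilon> in at_right 0. (\<epsilon>::real) ^ Suc n \<noteq> 0"
      "\<forall>\<^sub>F \<epsilon> in at_right 0. real (Suc n) * (\<epsilon>::real) ^ n \<noteq> 0"
      by (rule eventually_mono[OF eventually_at_right_less[of 0]], simp)+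
    show "\<forall>\<^sub>F \<epsilon> in at_right 0. (\<Psi> q \<beta> has_real_derivative (\<Sum>l\<in>UNIV. \<Psi> (q' l) (\<beta>' l) \<epsilon>)) (at \<epsilon>)"
      using in_box by (rule eventually_mono) (rule deriv)
    show "\<forall>\<^sub>F \<epsilon> in at_right 0. ((\<lambda>\<epsilon>. \<epsilon> ^ Suc n) has_real_derivative real (Suc n) * \<epsilon> ^ n) (at \<epsilon>)"
      using DERIV_pow[of "Suc n"] by (simp del: power_Suc of_nat_Suc)
    have "((\<lambda>\<epsilon>. (\<Sum>l\<in>UNIV. \<Psi> (q' l) (\<beta>' l) \<epsilon> / \<epsilon> ^ n) / real (Suc n)) \<longlongrightarrow>
        (\<Sum>l\<in>UNIV. \<kappa> l * (A * E)) / real (Suc n)) (at_right 0)"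
      by (intro tendsto_divide tendsto_sum \<kappa>(3) tendsto_const) simp
    moreover have "(\<Sum>l\<in>UNIV. \<kappa> l * (A * E)) / real (Suc n) = \<kappa>' * (A * E)"
      by (simp add: \<kappa>'_def sum_distrib_right)
    moreover have "(\<Sum>l\<in>UNIV. \<Psi> (q' l) (\<beta>' l) \<epsilon> / \<epsilon> ^ n) / real (Suc n)
        = (\<Sum>l\<in>UNIV. \<Psi> (q' l) (\<beta>' l) \<epsilon>) / (real (Suc n) * \<epsilon> ^ n)" for \<epsilon>
      by (simp add: mult.commute flip: sum_divide_distrib)
    ultimately show "((\<lambda>\<epsilon>. (\<Sum>l\<in>UNIV. \<Psi> (q' l) (\<beta>' l) \<epsilon>) / (real (Suc n) * \<epsilon> ^ n)) \<longlongrightarrow> \<kappa>' * (A * E)) (at_right 0)"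
      by (simp only:)
  qed
  then show ?case
    using \<open>0 < \<kappa>'\<close> unfolding \<Psi>_def A_def E_def by blast
qed

text \<open>The polynomial \<open>p\<close> with simple zeros at \<open>y\<^sup>\<gamma>\<close> for all
\<open>\<gamma> \<noteq> \<alpha>\<close> up to the order of \<open>\<alpha>\<close> does not
vanish at \<open>y\<^sup>\<alpha>\<close>, because \<open>y\<close> is generic. The square of
\<open>p\<close> has the same zeros, so the derivative of order \<open>\<alpha>\<close> has the
sign of the leading term.\<close>

lemma jet_nonneg:
  assumes y: "y \<in> multiplicatively_generic" and d: "jet w c d"
    and pos: "square_positive y c (d (\<lambda>_. 0))"
    and a: "a \<in> open_box c" and \<alpha>: "\<And>l. (\<Sum>i\<in>UNIV. \<alpha> i) \<le> w l"
  shows "0 \<le> d \<alpha> a"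
proof -
  define n where "n = (\<Sum>i\<in>UNIV. \<alpha> i)"
  define G where "G = {\<gamma> :: 'a \<Rightarrow> nat. (\<Sum>l\<in>UNIV. \<gamma> l) \<le> n \<and> \<gamma> \<noteq> \<alpha>}"
  have "finite {\<gamma> :: 'a \<Rightarrow> nat. \<forall>x. (x \<in> UNIV \<longrightarrow> \<gamma> x \<in> {..n}) \<and> (x \<notin> UNIV \<longrightarrow> \<gamma> x = 0)}"
    by (rule finite_set_of_finite_funs) auto
  moreover have "G \<subseteq> {\<gamma>. \<forall>x. (x \<in> UNIV \<longrightarrow> \<gamma> x \<in> {..n}) \<and> (x \<notin> UNIV \<longrightarrow> \<gamma> x = 0)}"
  proof
    fix \<gamma> assume "\<gamma> \<in> G"
    then have "\<gamma> x \<le> n" for x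
      using member_le_sum[of x UNIV \<gamma>] by (simp add: G_def)
    then show "\<gamma> \<in> {\<gamma>. \<forall>x. (x \<in> UNIV \<longrightarrow> \<gamma> x \<in> {..n}) \<and> (x \<notin> UNIV \<longrightarrow> \<gamma> x = 0)}"
      by simp
  qed
  ultimately have G: "finite G"
    by (rule rev_finite_subset)
  define p where "p = (\<Prod>\<gamma>\<in>G. [:- monomial y \<gamma>, 1:])"
  define K where "K = degree (p * p)"
  have poly_p: "poly p z = (\<Prod>\<gamma>\<in>G. z - monomial y \<gamma>)" for z
    by (simp add: p_def poly_prod)
  have sum_q: "(\<Sum>k\<le>K. coeff (p * p) k * z ^ k) = (poly p z)\<^sup>2" for z
    by (simp add: K_def power2_eq_square flip: poly_altdef)
  have inj: "inj (monomial y)"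
    using y by (simp add: multiplicatively_generic_def monomial_def[abs_def])
  have "\<exists>\<kappa>>0. ((\<lambda>\<epsilon>. (\<Sum>k\<le>K. coeff (p * p) k * d (\<lambda>_. 0) (a + \<epsilon> *\<^sub>R vec_power y k)) / \<epsilon> ^ n) \<longlongrightarrow>
      \<kappa> * ((\<Sum>k\<le>K. coeff (p * p) k * monomial y \<alpha> ^ k) * d (\<lambda>l. 0 + \<alpha> l) a)) (at_right 0)"
  proof (rule leading_term[OF d a n_def[symmetric]])
    show "0 + n \<le> w l" for l
      using \<alpha>[of l] by (simp add: n_def)
    show "(\<Sum>k\<le>K. coeff (p * p) k * monomial y \<gamma> ^ k) = 0" if "(\<Sum>l\<in>UNIV. \<gamma> l) \<le> n" "\<gamma> \<noteq> \<alpha>" for \<gamma>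
    proof -
      have "\<gamma> \<in> G"
        using that by (simp add: G_def)
      then have "poly p (monomial y \<gamma>) = 0"
        using G by (auto simp: poly_p)
      then show ?thesis
        by (simp only: sum_q) simp
    qed
  qed
  then obtain \<kappa> where \<kappa>: "0 < \<kappa>"
    "((\<lambda>\<epsilon>. (\<Sum>k\<le>K. coeff (p * p) k * d (\<lambda>_. 0) (a + \<epsilon> *\<^sub>R vec_power y k)) / \<epsilon> ^ n) \<longlongrightarrow>
      \<kappa> * ((poly p (monomial y \<alpha>))\<^sup>2 * d \<alpha> a)) (at_right 0)"
    unfolding sum_q by auto
  have "\<forall>\<^sub>F \<epsilon> in at_right 0. 0 < \<epsilon> \<and> (\<forall>l\<in>UNIV. \<epsilon> < c - a $ l)"
    using a by (intro eventually_conj eventually_at_right_less eventually_ball_finite ballI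
        eventually_less_at_right) auto
  then have "\<forall>\<^sub>F \<epsilon> in at_right 0.
      0 \<le> (\<Sum>k\<le>K. coeff (p * p) k * d (\<lambda>_. 0) (a + \<epsilon> *\<^sub>R vec_power y k)) / \<epsilon> ^ n"
  proof eventually_elim
    case (elim \<epsilon>)
    have "\<forall>l. 0 < a $ l \<and> a $ l + \<epsilon> < c"
      using a elim by (simp add: less_diff_eq add.commute)
    then have "0 \<le> (\<Sum>k\<le>K. coeff (p * p) k * d (\<lambda>_. 0) (a + \<epsilon> *\<^sub>R vec_power y k))"
      unfolding K_def using pos elim unfolding square_positive_def by (meson less_imp_le)
    then show ?case
      using elim by simp
  qed
  then have "0 \<le> \<kappa> * ((poly p (monomial y \<alpha>))\<^sup>2 * d \<alpha> a)"
    using \<kappa>(2) by (intro tendsto_lowerbound[OF \<kappa>(2)]) auto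
  moreover have "poly p (monomial y \<alpha>) \<noteq> 0"
    using G injD[OF inj, of \<alpha>] by (auto simp: poly_p G_def)
  ultimately show ?thesis
    using \<kappa>(1) by (simp add: zero_le_mult_iff)
qed

text \<open>As many derivatives in each direction as there are differences are enough. If some are missing,
average once more in a direction where this happens, and let the length of the average tend to
zero in the end.\<close>

theorem square_positive_imp_nonneg_diffs:
  fixes f :: "real ^ 'm \<Rightarrow> real"
  assumes y: "y \<in> multiplicatively_generic" and f: "continuous_on (open_box c) f"
    and pos: "square_positive y c f"
  shows "nonneg_diffs UNIV (open_box c) f"
  unfolding nonneg_diffs_def
proof (intro allI impI)
  fix ps :: "('m \<times> real) list" and x
  assume ps: "set ps \<subseteq> UNIV \<times> {0..}" and x: "x \<in> open_box c" "x + reach ps \<in> open_box c"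
  have "0 \<le> iter_diff ps (d (\<lambda>_. 0)) x"
    if "jet w c d" "square_positive y c (d (\<lambda>_. 0))" "x \<in> open_box c" "x + reach ps \<in> open_box c" for w c d
    using that
  proof (induction "\<Sum>l\<in>UNIV. length ps - w l" arbitrary: w c d rule: less_induct)
    case less
    note d = less.prems(1) and pos = less.prems(2) and x = less.prems(3,4)
    show ?case
    proof (cases "\<forall>l. length ps \<le> w l")
      case True
      \<comment> \<open>The supply of derivatives left for \<open>d \<alpha>\<close> is what the order of \<open>\<alpha>\<close> leaves of every \<open>w l\<close>.\<close>
      let ?P = "\<lambda>n g. \<exists>\<alpha>. g = d \<alpha> \<and> (\<forall>l. (\<Sum>i\<in>UNIV. \<alpha> i) + n \<le> w l)"
      have le: "\<alpha> i + n \<le> w i" if "\<forall>l. (\<Sum>i\<in>UNIV. \<alpha> i) + n \<le> w l" for \<alpha> i n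
      proof -
        have "\<alpha> i \<le> (\<Sum>i\<in>UNIV. \<alpha> i)"
          by (rule member_le_sum) auto
        then show ?thesis
          using that[rule_format, of i] by linarith
      qed
      show ?thesis
      proof (rule derivatives_nonneg_imp_diffs_nonneg[OF order_convex_open_box, where P = ?P and J = UNIV])
        show "0 \<le> g z" if "?P n g" "z \<in> open_box c" for n g z
          using that(1) jet_nonneg[OF y d pos that(2)] by (meson add_leD1)
        show "\<exists>g'. ?P n g' \<and> (\<forall>x\<in>open_box c. ((\<lambda>t. g (x + t *\<^sub>R ax l)) has_real_derivative g' x) (at 0))"
          if g: "?P (Suc n) g" for n g l
        proof -
          obtain \<alpha> where \<alpha>: "g = d \<alpha>" "\<forall>l. (\<Sum>i\<in>UNIV. \<alpha> i) + Suc n \<le> w l"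
            using g by blast
          have "\<alpha> \<le> w" "\<alpha> l < w l"
          proof -
            have less: "\<alpha> i < w i" for i
              using le[OF \<alpha>(2), of i] by simp
            then show "\<alpha> \<le> w" "\<alpha> l < w l"
              by (simp_all add: le_fun_def less_imp_le)
          qed
          then have "\<forall>x\<in>open_box c. ((\<lambda>t. g (x + t *\<^sub>R ax l)) has_real_derivative d (\<alpha>(l := Suc (\<alpha> l))) x) (at 0)"
            unfolding \<alpha>(1) using jetD(2)[OF d] by blast
          moreover have "\<forall>i. (\<Sum>i\<in>UNIV. (\<alpha>(l := Suc (\<alpha> l))) i) + n \<le> w i"
            using \<alpha>(2) by (simp only: sum_fun_upd_Suc) simp
          ultimately show ?thesis
            by blast
        qed
        show "?P (length ps) (d (\<lambda>_. 0))"
          using True by (intro exI[of _ "\<lambda>_. 0"]) simp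
      qed (use ps x in auto)
    next
      case False
      then obtain l where l: "w l < length ps"
        by (auto simp: not_le)
      have cont: "continuous_on (open_box c) (d (\<lambda>_. 0))"
        by (rule jetD(1)[OF d]) (simp add: le_fun_def)
      have y': "0 < y $ l \<and> y $ l < 1" for l
        using y by (simp add: multiplicatively_generic_def)
      have "0 \<le> iter_diff ps (avg l h (d (\<lambda>_. 0))) x"
        if h: "0 < h" "x \<in> open_box (c - h)" "x + reach ps \<in> open_box (c - h)" for h
      proof -
        define d' where "d' = (\<lambda>\<alpha>. if \<alpha> l = 0 then avg l h (d \<alpha>)
          else (\<lambda>x. (d (\<alpha>(l := \<alpha> l - 1)) (x + h *\<^sub>R ax l) - d (\<alpha>(l := \<alpha> l - 1)) x) / h))"
        have d0: "d' (\<lambda>_. 0) = avg l h (d (\<lambda>_. 0))"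
          by (simp add: d'_def)
        have "(\<Sum>i\<in>UNIV. length ps - (w(l := Suc (w l))) i) < (\<Sum>i\<in>UNIV. length ps - w i)"
        proof (rule sum_strict_mono_ex1)
          show "\<exists>i\<in>UNIV. length ps - (w(l := Suc (w l))) i < length ps - w i"
            using l by (intro bexI[of _ l]) auto
        qed auto
        moreover have "jet (w(l := Suc (w l))) (c - h) d'"
          unfolding d'_def by (rule jet_avg[OF d h(1)])
        moreover have "square_positive y (c - h) (d' (\<lambda>_. 0))"
          unfolding d0 by (rule square_positive_avg[OF pos cont h(1) y'])
        ultimately show ?thesis
          using less.hyps[of "w(l := Suc (w l))" "c - h" d'] h(2,3) unfolding d0 by blast
      qed
      moreover have "\<forall>\<^sub>F h in at_right 0. 0 < h \<and> (\<forall>l\<in>UNIV. h < c - x $ l) \<and>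
          (\<forall>l\<in>UNIV. h < c - (x + reach ps) $ l)"
        using x by (intro eventually_conj eventually_at_right_less eventually_ball_finite ballI
            eventually_less_at_right) auto
      ultimately have "\<forall>\<^sub>F h in at_right 0. 0 \<le> iter_diff ps (avg l h (d (\<lambda>_. 0))) x"
      proof (elim eventually_mono)
        fix h assume h: "0 < h \<and> (\<forall>l\<in>UNIV. h < c - x $ l) \<and> (\<forall>l\<in>UNIV. h < c - (x + reach ps) $ l)"
        then have "x \<in> open_box (c - h)" "x + reach ps \<in> open_box (c - h)"
          using x by (simp_all add: less_diff_eq add.commute)
        then show "0 \<le> iter_diff ps (avg l h (d (\<lambda>_. 0))) x"
          using h \<open>\<And>h. 0 < h \<Longrightarrow> x \<in> open_box (c - h) \<Longrightarrow> x + reach ps \<in> open_box (c - h) \<Longrightarrow>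
            0 \<le> iter_diff ps (avg l h (d (\<lambda>_. 0))) x\<close> by blast
      qed
      moreover have "((\<lambda>h. iter_diff ps (avg l h (d (\<lambda>_. 0))) x) \<longlongrightarrow> iter_diff ps (d (\<lambda>_. 0)) x) (at_right 0)"
        by (rule iter_diff_tendsto[OF order_convex_open_box avg_tendsto[OF cont] ps x])
      ultimately show ?thesis
        by (intro tendsto_lowerbound) auto
    qed
  qed
  from this[of "\<lambda>_. 0" c "\<lambda>_. f"] show "0 \<le> iter_diff ps f x"
    using f pos x by (simp add: jet_def le_fun_def)
qed


section \<open>Extension to closed faces\<close>

definition ones :: "'m set \<Rightarrow> real ^ 'm" where
  "ones J = (\<chi> l. if l \<in> J then 1 else 0)"

lemma ones_nth [simp]: "ones J $ l = (if l \<in> J then 1 else 0)"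
  by (simp add: ones_def)

lemma order_convex_face:
  fixes J :: "'m :: finite set"
  shows "order_convex (face \<rho> J)"
proof -
  let ?I = "\<lambda>l. {t. (l \<notin> J \<longrightarrow> t = 0) \<and> 0 \<le> t \<and> ereal t < \<rho>}"
  have "order_convex {x :: real ^ 'm. \<forall>l. x $ l \<in> ?I l}"
    by (rule order_convex_product)
      (auto intro: le_less_trans[of "ereal _" "ereal _"] order_trans antisym)
  moreover have "face \<rho> J = {x. \<forall>l. x $ l \<in> ?I l}"
    by (auto simp: face_def coord_space_def)
  ultimately show ?thesis
    by simp
qed

lemma order_convex_open_face:
  fixes J :: "'m :: finite set"
  shows "order_convex (open_face \<rho> J)"
proof -
  let ?I = "\<lambda>l. {t. (l \<notin> J \<longrightarrow> t = 0) \<and> (l \<in> J \<longrightarrow> 0 < t \<and> ereal t < \<rho>)}"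
  have "order_convex {x :: real ^ 'm. \<forall>l. x $ l \<in> ?I l}"
    by (rule order_convex_product)
      (auto intro: le_less_trans[of "ereal _" "ereal _"] less_le_trans antisym)
  moreover have "open_face \<rho> J = {x. \<forall>l. x $ l \<in> ?I l}"
    by (auto simp: open_face_def coord_space_def)
  ultimately show ?thesis
    by simp
qed

lemma open_face_subset_face: "0 < \<rho> \<Longrightarrow> open_face \<rho> J \<subseteq> face \<rho> J"
proof
  fix x assume \<rho>: "0 < \<rho>" and x: "x \<in> open_face \<rho> J"
  have "0 \<le> x $ l \<and> ereal (x $ l) < \<rho>" for l
    using x \<rho> by (cases "l \<in> J") (simp_all add: open_face_def coord_space_def zero_ereal_def less_imp_le)
  then show "x \<in> face \<rho> J"
    using x by (simp add: face_def open_face_def)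
qed

lemma open_face_subset_cube: "0 < \<rho> \<Longrightarrow> open_face \<rho> J \<subseteq> cube \<rho>"
  using open_face_subset_face[of \<rho> J] by (auto simp: face_def coord_space_def)

lemma openin_open_face:
  fixes J :: "'m :: finite set"
  shows "openin (top_of_set (coord_space J)) (open_face \<rho> J)"
proof -
  have "open (\<Inter>l\<in>J. {x :: real ^ 'm. 0 < x $ l} \<inter> {x. ereal (x $ l) < \<rho>})"
    by (intro open_INT ballI open_Int open_Collect_less continuous_on_ereal continuous_intros) simp
  moreover have "open_face \<rho> J = coord_space J \<inter> (\<Inter>l\<in>J. {x. 0 < x $ l} \<inter> {x. ereal (x $ l) < \<rho>})"
    by (auto simp: open_face_def)
  ultimately show ?thesis
    by (simp only: openin_open_Int)
qed

lemma axis_open_open_face: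
  fixes J :: "'m :: finite set"
  shows "axis_open J (open_face \<rho> J)"
  unfolding axis_open_def
proof (intro ballI)
  fix x and l assume x: "x \<in> open_face \<rho> J" and l: "l \<in> J"
  obtain T where T: "open T" "open_face \<rho> J = coord_space J \<inter> T"
    using openin_open_face unfolding openin_open by blast
  then obtain r where r: "0 < r" "\<And>t. \<bar>t\<bar> < r \<Longrightarrow> x + t *\<^sub>R ax l \<in> T"
    using open_axis_ball[of T x, where l = l] x by blast
  have "x + t *\<^sub>R ax l \<in> coord_space J" for t
    using x l T(2) by (auto simp: coord_space_def axis_def)
  then show "\<exists>r>0. \<forall>t. \<bar>t\<bar> < r \<longrightarrow> x + t *\<^sub>R ax l \<in> open_face \<rho> J"
    using r T(2) by blast
qed

lemma interior_face_subset: "(top_of_set (coord_space J)) interior_of (face \<rho> J) \<subseteq> open_face \<rho> J"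
proof
  fix x assume "x \<in> (top_of_set (coord_space J)) interior_of (face \<rho> J)"
  then obtain U where U: "openin (top_of_set (coord_space J)) U" "x \<in> U" "U \<subseteq> face \<rho> J"
    unfolding interior_of_def by blast
  then obtain T where T: "open T" "U = coord_space J \<inter> T"
    unfolding openin_open by blast
  have x: "x \<in> face \<rho> J"
    using U by blast
  have "0 < x $ l" if l: "l \<in> J" for l
  proof -
    obtain r where r: "0 < r" "\<And>t. \<bar>t\<bar> < r \<Longrightarrow> x + t *\<^sub>R ax l \<in> T"
      using open_axis_ball[of T x, where l = l] T U(2) by blast
    have "x + (- r / 2) *\<^sub>R ax l \<in> coord_space J"
      using x l by (auto simp: face_def coord_space_def axis_def)
    then have "x + (- r / 2) *\<^sub>R ax l \<in> face \<rho> J"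
      using r(2)[of "- r / 2"] r(1) T(2) U(3) by auto
    then have "0 \<le> (x + (- r / 2) *\<^sub>R ax l) $ l"
      by (simp only: face_def mem_Collect_eq)
    then show ?thesis
      using r(1) by simp
  qed
  then show "x \<in> open_face \<rho> J"
    using x by (simp add: face_def open_face_def)
qed

lemma bound_below_ereal:
  fixes x :: "real ^ 'm"
  assumes "\<And>l. ereal (x $ l) < \<rho>" "0 < \<rho>"
  obtains c where "0 < c" "\<And>l. x $ l < c" "ereal c < \<rho>"
proof -
  define m where "m = Max (insert 0 (range (\<lambda>l. x $ l)))"
  have "m \<in> insert 0 (range (\<lambda>l. x $ l))"
    unfolding m_def by (rule Max_in) auto
  then have "ereal m < \<rho>"
    using assms by (auto simp: zero_ereal_def)
  then obtain c where c: "ereal m < ereal c" "ereal c < \<rho>"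
    using ereal_dense2 by blast
  have m: "0 \<le> m" "x $ l \<le> m" for l
    unfolding m_def by (intro Max_ge; simp)+
  show ?thesis
  proof (rule that[of c])
    show "0 < c"
      using m(1) c(1) by simp
    show "x $ l < c" for l
      using le_less_trans[OF m(2)[of l], of c] c(1) by simp
  qed (fact c(2))
qed

lemma face_shift_in_open_face:
  assumes x: "x \<in> face \<rho> J" and "0 < \<rho>"
  obtains \<delta> where "0 < \<delta>" "\<And>t. 0 < t \<Longrightarrow> t < \<delta> \<Longrightarrow> x + t *\<^sub>R ones J \<in> open_face \<rho> J"
proof -
  obtain c where c: "0 < c" "\<And>l. x $ l < c" "ereal c < \<rho>"
    using bound_below_ereal[of x \<rho>] x \<open>0 < \<rho>\<close> by (auto simp: face_def)
  define \<delta> where "\<delta> = Min (range (\<lambda>l. c - x $ l))"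
  have "\<delta> \<in> range (\<lambda>l. c - x $ l)"
    unfolding \<delta>_def by (rule Min_in) auto
  then have "0 < \<delta>"
    using c(2) by auto
  moreover have "x + t *\<^sub>R ones J \<in> open_face \<rho> J" if t: "0 < t" "t < \<delta>" for t
  proof -
    have "\<delta> \<le> c - x $ l" for l
      unfolding \<delta>_def by (rule Min_le) auto
    then have lt: "x $ l + t < c" for l
      using t(2) by (smt (verit) )
    have "0 < x $ l + t" for l
      using x t(1) by (simp add: face_def add_nonneg_pos)
    moreover have "ereal (x $ l + t) < \<rho>" for l
      using less_trans[OF _ c(3), of "ereal (x $ l + t)"] lt[of l] by simp
    ultimately show ?thesis
      using x by (simp add: open_face_def face_def coord_space_def)
  qed
  ultimately show ?thesis
    using that by blast
qed

lemma eventually_shift_in_open_face: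
  assumes "x \<in> face \<rho> J" "0 < \<rho>"
  shows "\<forall>\<^sub>F t in at_right 0. x + t *\<^sub>R ones J \<in> open_face \<rho> J"
proof -
  obtain \<delta> where "0 < \<delta>" "\<And>t. 0 < t \<Longrightarrow> t < \<delta> \<Longrightarrow> x + t *\<^sub>R ones J \<in> open_face \<rho> J"
    using face_shift_in_open_face[OF assms] by blast
  then show ?thesis
    by (auto simp: eventually_at_right_field)
qed

text \<open>Move from \<open>x\<close> to \<open>z\<close> parallel to the axes, one coordinate after the
other.\<close>

lemma path_estimate:
  fixes f :: "real ^ 'm \<Rightarrow> real"
  assumes S: "order_convex S"
    and step: "\<And>x l s. x \<in> S \<Longrightarrow> 0 \<le> s \<Longrightarrow> x + s *\<^sub>R ax l \<in> S \<Longrightarrow> l \<in> J \<Longrightarrow>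
        f (x + s *\<^sub>R ax l) - f x \<le> L * s"
    and x: "x \<in> S" "z \<in> S" "x \<le> z" "\<And>l. l \<notin> J \<Longrightarrow> x $ l = z $ l"
  shows "f z - f x \<le> L * (\<Sum>l\<in>UNIV. z $ l - x $ l)"
proof -
  have le: "x $ l \<le> z $ l" for l
    using x(3) by (simp add: less_eq_vec_def)
  define p where "p I = (\<chi> l. if l \<in> I then z $ l else x $ l)" for I
  have p_in: "p I \<in> S" for I
    by (rule order_convexD[OF S x(1,2)]) (use le in \<open>simp_all add: p_def less_eq_vec_def\<close>)
  have "f (p I) - f x \<le> L * (\<Sum>l\<in>I. z $ l - x $ l)" for I
    using finite[of I]
  proof (induction I rule: finite_induct)
    case empty
    have "p {} = x"
      by (simp add: p_def vec_eq_iff)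
    then show ?case
      by simp
  next
    case (insert l I)
    have eq: "p (insert l I) = p I + (z $ l - x $ l) *\<^sub>R ax l"
      using insert.hyps by (auto simp: p_def vec_eq_iff axis_def)
    have "f (p (insert l I)) - f (p I) \<le> L * (z $ l - x $ l)"
    proof (cases "l \<in> J")
      case True
      show ?thesis
        unfolding eq using p_in[of "insert l I"] le[of l] True
        by (intro step[OF p_in]) (simp_all add: eq)
    next
      case False
      then show ?thesis
        using x(4) by (simp add: eq)
    qed
    moreover have "L * (\<Sum>l\<in>insert l I. z $ l - x $ l)
        = L * (z $ l - x $ l) + L * (\<Sum>l\<in>I. z $ l - x $ l)"
      using insert.hyps by (simp add: distrib_left)
    ultimately show ?case
      using insert.IH by linarith
  qed
  moreover have "p UNIV = z"
    by (simp add: p_def vec_eq_iff)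
  ultimately show ?thesis
    by metis
qed

lemma nonneg_diffs_axis_mono:
  assumes "nonneg_diffs J S f" "x \<in> S" "x + s *\<^sub>R ax l \<in> S" "0 \<le> s" "l \<in> J"
  shows "f x \<le> f (x + s *\<^sub>R ax l)"
  using assms(1)[unfolded nonneg_diffs_def, rule_format, of "[(l, s)]" x] assms(2-) by simp

lemma nonneg_diffs_nonneg:
  assumes "nonneg_diffs J S f" "x \<in> S"
  shows "0 \<le> f x"
  using assms(1)[unfolded nonneg_diffs_def, rule_format, of "[]" x] assms(2) by simp

text \<open>The partial derivative is non-decreasing in direction \<open>l\<close>, so a slope on a segment
where the coordinates are at most \<open>c\<close> is bounded by the slope on a segment of
length \<open>\<eta>\<close> that starts in the first one. As \<open>f\<close> is non-negative,
the latter is at most \<open>M / \<eta>\<close>. The bound does not deteriorate at the lower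
boundary of the face.\<close>

lemma slope_bound:
  assumes f: "nonneg_diffs J (open_face \<rho> J) f" and c: "0 < \<eta>" "ereal (c + \<eta>) < \<rho>"
    and x: "x \<in> open_face \<rho> J" "x + s *\<^sub>R ax l \<in> open_face \<rho> J" "0 \<le> s" "l \<in> J"
      "\<And>i. (x + s *\<^sub>R ax l) $ i \<le> c"
    and M: "\<And>z. z \<in> open_face \<rho> J \<Longrightarrow> (\<And>i. z $ i \<le> c + \<eta>) \<Longrightarrow> f z \<le> M"
  shows "f (x + s *\<^sub>R ax l) - f x \<le> M / \<eta> * s"
proof (cases "s = 0")
  case False
  then have s: "0 < s"
    using x(3) by simp
  note S = order_convex_open_face[of \<rho> J] axis_open_open_face[of J \<rho>]
  have b: "(x + s *\<^sub>R ax l) $ l \<le> c"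
    using x(5) by blast
  have top: "x + (s + \<eta>) *\<^sub>R ax l \<in> open_face \<rho> J" and top_le: "(x + (s + \<eta>) *\<^sub>R ax l) $ i \<le> c + \<eta>" for i
  proof -
    have e: "(x + (s + \<eta>) *\<^sub>R ax l) $ i = (x + s *\<^sub>R ax l) $ i + (if i = l then \<eta> else 0)" for i
      by (simp add: axis_def)
    show "(x + (s + \<eta>) *\<^sub>R ax l) $ i \<le> c + \<eta>" for i
      unfolding e using add_mono[OF x(5)[of i] order_refl[of \<eta>]] add_increasing2[of \<eta> "(x + s *\<^sub>R ax l) $ i" "c"]
        x(5)[of i] c(1) by (cases "i = l") (simp_all del: vector_add_component)
    have "ereal ((x + (s + \<eta>) *\<^sub>R ax l) $ l) < \<rho>"
      using le_less_trans[OF _ c(2), of "ereal ((x + (s + \<eta>) *\<^sub>R ax l) $ l)"] b by simp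
    moreover have "0 < (x + (s + \<eta>) *\<^sub>R ax l) $ l"
      using x(1,3,4) c(1) by (simp add: open_face_def add_pos_nonneg)
    ultimately show "x + (s + \<eta>) *\<^sub>R ax l \<in> open_face \<rho> J"
      using x(2,4) by (auto simp: open_face_def coord_space_def axis_def)
  qed
  have le: "r *\<^sub>R ax l \<le> r' *\<^sub>R ax l" if "r \<le> r'" for r r' :: real
    using that by (rule ax_mono)
  have mid: "x + t *\<^sub>R ax l \<in> open_face \<rho> J" if "0 \<le> t" "t \<le> s + \<eta>" for t
  proof (rule order_convexD[OF S(1) x(1) top])
    show "x \<le> x + t *\<^sub>R ax l"
      using ax_nonneg[OF that(1), of l] by simp
    show "x + t *\<^sub>R ax l \<le> x + (s + \<eta>) *\<^sub>R ax l"
      using ax_mono[OF that(2), of l] by simp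
  qed
  define P where "P t = partial_deriv l f (x + t *\<^sub>R ax l)" for t
  have D: "((\<lambda>t. f (x + t *\<^sub>R ax l)) has_real_derivative P t) (at t)" if "0 \<le> t" "t \<le> s + \<eta>" for t
  proof (rule DERIV_along_axis_shift)
    have "partially_differentiable l f (x + t *\<^sub>R ax l)"
      by (rule nonneg_diffs_imp_partially_differentiable[OF S f mid[OF that] x(4)])
    then show "((\<lambda>r. f (x + t *\<^sub>R ax l + r *\<^sub>R ax l)) has_real_derivative P t) (at 0)"
      unfolding partially_differentiable_def P_def partial_deriv_def by (rule field_differentiable_derivI)
  qed
  obtain t where t: "0 < t" "t < s" "f (x + s *\<^sub>R ax l) - f (x + 0 *\<^sub>R ax l) = (s - 0) * P t"
    using MVT2[OF s, of "\<lambda>t. f (x + t *\<^sub>R ax l)" P] D c(1) by auto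
  obtain t' where t': "t < t'" "t' < t + \<eta>"
    "f (x + (t + \<eta>) *\<^sub>R ax l) - f (x + t *\<^sub>R ax l) = (t + \<eta> - t) * P t'"
    using MVT2[of t "t + \<eta>" "\<lambda>t. f (x + t *\<^sub>R ax l)" P] D c(1) t by auto
  have "P t \<le> P t'"
  proof -
    have "nonneg_diffs J (open_face \<rho> J) (partial_deriv l f)"
      by (rule nonneg_diffs_partial_deriv[OF S f x(4)])
    moreover have in_face: "x + t *\<^sub>R ax l \<in> open_face \<rho> J" "x + t' *\<^sub>R ax l \<in> open_face \<rho> J"
      using t t' c(1) by (auto intro!: mid)
    moreover have e: "x + t *\<^sub>R ax l + (t' - t) *\<^sub>R ax l = x + t' *\<^sub>R ax l"
      by (simp add: scaleR_left_diff_distrib)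
    ultimately show ?thesis
      using nonneg_diffs_axis_mono[of J "open_face \<rho> J" "partial_deriv l f" "x + t *\<^sub>R ax l" "t' - t" l,
          unfolded e] x(4) t'(1) unfolding P_def by (simp only: diff_ge_0_iff_ge less_imp_le)
  qed
  then have "\<eta> * P t \<le> \<eta> * P t'"
    using c(1) by (intro mult_left_mono) simp_all
  moreover have "\<eta> * P t' \<le> M"
  proof -
    have in1: "x + (t + \<eta>) *\<^sub>R ax l \<in> open_face \<rho> J" and in2: "x + t *\<^sub>R ax l \<in> open_face \<rho> J"
      using t c(1) by (auto intro!: mid)
    have "(x + (t + \<eta>) *\<^sub>R ax l) $ i \<le> c + \<eta>" for i
    proof -
      have "(x + (t + \<eta>) *\<^sub>R ax l) $ i \<le> (x + (s + \<eta>) *\<^sub>R ax l) $ i"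
        using le[of "t + \<eta>" "s + \<eta>"] t(2) by (simp add: less_eq_vec_def)
      then show ?thesis
        using top_le[of i] by linarith
    qed
    then have "f (x + (t + \<eta>) *\<^sub>R ax l) \<le> M"
      by (rule M[OF in1])
    moreover have "0 \<le> f (x + t *\<^sub>R ax l)"
      by (rule nonneg_diffs_nonneg[OF f in2])
    ultimately show ?thesis
      using t'(3) by simp
  qed
  ultimately have "\<eta> * P t \<le> M"
    by linarith
  then have "P t \<le> M / \<eta>"
    using c(1) by (simp add: pos_le_divide_eq mult.commute)
  then show ?thesis
    using t(3) mult_left_mono[OF _ less_imp_le[OF s], of "P t" "M / \<eta>"] by (simp add: mult.commute)
qed simp

lemma nonneg_diffs_mono:
  fixes f :: "real ^ 'm \<Rightarrow> real"
  assumes f: "nonneg_diffs J S f" and S: "order_convex S"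
    and x: "x \<in> S" "z \<in> S" "x \<le> z" "\<And>l. l \<notin> J \<Longrightarrow> x $ l = z $ l"
  shows "f x \<le> f z"
  using path_estimate[OF S _ x, where f = "\<lambda>x. - f x" and L = 0 and J = J]
    nonneg_diffs_axis_mono[OF f] by simp

text \<open>By monotonicity the value at \<open>x\<close> is at most the value at the coordinatewise maximum
of \<open>x\<close> and \<open>z\<close>, which is reached from \<open>z\<close> by a path
upwards.\<close>

lemma Lipschitz_on_open_face:
  fixes f :: "real ^ 'm \<Rightarrow> real"
  assumes f: "nonneg_diffs J (open_face \<rho> J) f" and c: "0 < c" "ereal c < \<rho>"
  obtains L where "\<And>x z. x \<in> open_face \<rho> J \<Longrightarrow> z \<in> open_face \<rho> J \<Longrightarrow> (\<And>l. x $ l \<le> c) \<Longrightarrow> (\<And>l. z $ l \<le> c) \<Longrightarrow>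
      \<bar>f x - f z\<bar> \<le> L * (\<Sum>l\<in>UNIV. \<bar>x $ l - z $ l\<bar>)"
proof -
  obtain c' where c': "ereal c < ereal c'" "ereal c' < \<rho>"
    using ereal_dense2[OF c(2)] by blast
  define \<eta> where "\<eta> = c' - c"
  have \<eta>: "0 < \<eta>" "c + \<eta> = c'"
    using c' by (simp_all add: \<eta>_def)
  define top where "top = c' *\<^sub>R (ones J :: real ^ 'm)"
  have top: "top \<in> open_face \<rho> J"
    using c' c(1) by (auto simp: top_def open_face_def coord_space_def)
  define M where "M = f top"
  have M: "f z \<le> M" if "z \<in> open_face \<rho> J" "\<And>i. z $ i \<le> c + \<eta>" for z
    unfolding M_def
  proof (rule nonneg_diffs_mono[OF f order_convex_open_face that(1) top])
    show "z $ l = top $ l" if "l \<notin> J" for l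
      using that \<open>z \<in> open_face \<rho> J\<close> by (simp add: top_def open_face_def coord_space_def)
    then show "z \<le> top"
      using that(2) \<eta>(2) by (auto simp: less_eq_vec_def top_def)
  qed
  define L where "L = M / \<eta>"
  have "0 \<le> L"
    using nonneg_diffs_nonneg[OF f top] \<eta>(1) by (simp add: L_def M_def)
  define S where "S = {x \<in> open_face \<rho> J. \<forall>l. x $ l \<le> c}"
  have S: "order_convex S"
    unfolding order_convex_def
  proof (intro ballI subsetI)
    fix x z w assume h: "x \<in> S" "z \<in> S" "w \<in> {x..z}"
    then have "w \<in> open_face \<rho> J"
      using order_convexD[OF order_convex_open_face, of x \<rho> J z w] by (simp add: S_def)
    moreover have "w $ l \<le> z $ l" "z $ l \<le> c" for l
      using h by (simp_all add: S_def less_eq_vec_def)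
    ultimately show "w \<in> S"
      using order_trans by (simp add: S_def) blast
  qed
  have up: "f w - f x \<le> L * (\<Sum>l\<in>UNIV. w $ l - x $ l)" if "x \<in> S" "w \<in> S" "x \<le> w" for x w
  proof (rule path_estimate[OF S _ that, where J = J])
    fix x s and l :: 'm assume h: "x \<in> S" "0 \<le> s" "x + s *\<^sub>R ax l \<in> S" "l \<in> J"
    have "f (x + s *\<^sub>R ax l) - f x \<le> M / \<eta> * s"
      using h by (intro slope_bound[OF f \<eta>(1), of c] M) (simp_all add: S_def \<eta>(2) c'(2) del: vector_add_component)
    then show "f (x + s *\<^sub>R ax l) - f x \<le> L * s"
      by (simp add: L_def)
  next
    show "x $ l = w $ l" if "l \<notin> J" for l
      using \<open>x \<in> S\<close> \<open>w \<in> S\<close> that by (simp add: S_def open_face_def coord_space_def)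
  qed
  have one_sided: "f x - f z \<le> L * (\<Sum>l\<in>UNIV. \<bar>x $ l - z $ l\<bar>)" if x: "x \<in> S" and z: "z \<in> S" for x z
  proof -
    define w where "w = (\<chi> l. max (x $ l) (z $ l))"
    have "w \<in> S"
      using x z by (auto simp: S_def open_face_def coord_space_def w_def max_def)
    have "f x \<le> f w"
    proof (rule nonneg_diffs_mono[OF f order_convex_open_face])
      show "x $ l = w $ l" if "l \<notin> J" for l
        using x z that by (simp add: S_def open_face_def coord_space_def w_def)
    qed (use x \<open>w \<in> S\<close> in \<open>auto simp: S_def w_def less_eq_vec_def\<close>)
    moreover have "f w - f z \<le> L * (\<Sum>l\<in>UNIV. w $ l - z $ l)"
      using z \<open>w \<in> S\<close> by (intro up) (auto simp: w_def less_eq_vec_def)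
    moreover have "L * (\<Sum>l\<in>UNIV. w $ l - z $ l) \<le> L * (\<Sum>l\<in>UNIV. \<bar>x $ l - z $ l\<bar>)"
      using \<open>0 \<le> L\<close> by (intro mult_left_mono sum_mono) (auto simp: w_def)
    ultimately show ?thesis
      by linarith
  qed
  have "\<bar>f x - f z\<bar> \<le> L * (\<Sum>l\<in>UNIV. \<bar>x $ l - z $ l\<bar>)" if "x \<in> S" "z \<in> S" for x z
    using one_sided[OF that] one_sided[OF that(2,1)] by (simp add: abs_minus_commute)
  then show ?thesis
    by (intro that[of L]) (simp add: S_def)
qed

text \<open>The limit in direction \<open>ones J\<close> exists at every point of the closed face, because
\<open>g\<close> is monotone and non-negative. It inherits the Lipschitz estimates, and so it is
continuous.\<close>

theorem absolutely_monotonic_extension: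
  fixes g :: "real ^ 'm \<Rightarrow> real"
  assumes \<rho>: "0 < \<rho>" and g: "absolutely_monotonic_on J (open_face \<rho> J) g"
  shows "\<exists>h. absolutely_monotonic_on J (face \<rho> J) h \<and> (\<forall>x\<in>open_face \<rho> J. h x = g x)"
proof -
  have nd: "nonneg_diffs J (open_face \<rho> J) g"
    by (rule absolutely_monotonic_imp_nonneg_diffs[OF order_convex_open_face openin_open_face g])
  have cont_g: "continuous_on (open_face \<rho> J) g"
    using g by (simp add: absolutely_monotonic_on_def)
  define h where "h x = Lim (at_right 0) (\<lambda>t. g (x + t *\<^sub>R ones J))" for x
  have h: "((\<lambda>t. g (x + t *\<^sub>R ones J)) \<longlongrightarrow> h x) (at_right 0)" if x: "x \<in> face \<rho> J" for x
  proof -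
    obtain \<delta> where \<delta>: "0 < \<delta>" "\<And>t. 0 < t \<Longrightarrow> t < \<delta> \<Longrightarrow> x + t *\<^sub>R ones J \<in> open_face \<rho> J"
      using face_shift_in_open_face[OF x \<rho>] by blast
    define \<psi> where "\<psi> t = g (x + t *\<^sub>R ones J)" for t
    have "(\<psi> \<longlongrightarrow> Inf (\<psi> ` ({0<..} \<inter> {0<..<\<delta>}))) (at 0 within ({0<..} \<inter> {0<..<\<delta>}))"
    proof (rule Lim_right_bound[where K = 0])
      show "\<psi> s \<le> \<psi> t" if "s \<in> {0<..<\<delta>}" "t \<in> {0<..<\<delta>}" "0 < s" "s \<le> t" for s t
        unfolding \<psi>_def
        by (rule nonneg_diffs_mono[OF nd order_convex_open_face \<delta>(2) \<delta>(2)])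
          (use that in \<open>auto simp: less_eq_vec_def\<close>)
      show "0 \<le> \<psi> t" if "t \<in> {0<..<\<delta>}" "0 < t" for t
        unfolding \<psi>_def using that by (intro nonneg_diffs_nonneg[OF nd] \<delta>(2)) auto
    qed
    moreover have "at (0::real) within ({0<..} \<inter> {0<..<\<delta>}) = at_right 0"
      using \<delta>(1) by (intro at_within_nhd[of _ "{..<\<delta>}"]) auto
    ultimately have "(\<psi> \<longlongrightarrow> Inf (\<psi> ` ({0<..} \<inter> {0<..<\<delta>}))) (at_right 0)"
      by simp
    then show ?thesis
      unfolding h_def \<psi>_def by (metis tendsto_Lim trivial_limit_at_right_real)
  qed
  have h_eq: "h x = g x" if x: "x \<in> open_face \<rho> J" for x
  proof (rule tendsto_unique[OF _ h])
    show xf: "x \<in> face \<rho> J"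
      using x open_face_subset_face[OF \<rho>] by blast
    have "((\<lambda>t. x + t *\<^sub>R ones J) \<longlongrightarrow> x) (at_right 0)"
      by (auto intro!: tendsto_eq_intros)
    then show "((\<lambda>t. g (x + t *\<^sub>R ones J)) \<longlongrightarrow> g x) (at_right 0)"
      by (rule continuous_on_tendsto_compose[OF cont_g _ x eventually_shift_in_open_face[OF xf \<rho>]])
  qed simp
  have cont_h: "continuous_on (face \<rho> J) h"
    unfolding continuous_on_def
  proof
    fix x assume x: "x \<in> face \<rho> J"
    obtain c where c: "0 < c" "\<And>l. x $ l < c" "ereal c < \<rho>"
      using bound_below_ereal[of x \<rho>] x \<rho> by (auto simp: face_def)
    obtain c' where c': "ereal c < ereal c'" "ereal c' < \<rho>"
      using ereal_dense2[OF c(3)] by blast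
    obtain L where L: "\<And>x z. x \<in> open_face \<rho> J \<Longrightarrow> z \<in> open_face \<rho> J \<Longrightarrow> (\<And>l. x $ l \<le> c') \<Longrightarrow> (\<And>l. z $ l \<le> c') \<Longrightarrow>
      \<bar>g x - g z\<bar> \<le> L * (\<Sum>l\<in>UNIV. \<bar>x $ l - z $ l\<bar>)"
      using Lipschitz_on_open_face[OF nd, of c'] c(1) c' by auto
    have lip: "\<bar>h z - h x\<bar> \<le> L * (\<Sum>l\<in>UNIV. \<bar>z $ l - x $ l\<bar>)" if z: "z \<in> face \<rho> J" "\<And>l. z $ l \<le> c" for z
    proof (rule tendsto_upperbound)
      show "((\<lambda>t. \<bar>g (z + t *\<^sub>R ones J) - g (x + t *\<^sub>R ones J)\<bar>) \<longlongrightarrow> \<bar>h z - h x\<bar>) (at_right 0)"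
        by (intro tendsto_rabs tendsto_diff h z x)
      have "\<forall>\<^sub>F t in at_right 0. t < c' - c"
        using c'(1) by (intro eventually_less_at_right) simp
      then show "\<forall>\<^sub>F t in at_right 0. \<bar>g (z + t *\<^sub>R ones J) - g (x + t *\<^sub>R ones J)\<bar>
          \<le> L * (\<Sum>l\<in>UNIV. \<bar>z $ l - x $ l\<bar>)"
        using eventually_shift_in_open_face[OF z(1) \<rho>] eventually_shift_in_open_face[OF x \<rho>]
          eventually_at_right_less[of 0]
      proof eventually_elim
        case (elim t)
        have "(z + t *\<^sub>R ones J) $ l \<le> c'" "(x + t *\<^sub>R ones J) $ l \<le> c'" for l
          using z(2)[of l] less_imp_le[OF c(2)[of l]] elim by auto
        from L[OF elim(2,3) this] show ?case
          by simp
      qed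
    qed simp
    have near: "\<forall>\<^sub>F z in at x within face \<rho> J. z \<in> face \<rho> J \<and> (\<forall>l\<in>UNIV. z $ l < c)"
    proof (intro eventually_conj eventually_ball_finite ballI)
      show "\<forall>\<^sub>F z in at x within face \<rho> J. z \<in> face \<rho> J"
        by (simp add: eventually_at_filter)
      show "\<forall>\<^sub>F z in at x within face \<rho> J. z $ l < c" for l
        by (rule order_tendstoD(2)[OF _ c(2)]) (auto intro!: tendsto_intros)
    qed simp
    have "((\<lambda>z. h z - h x) \<longlongrightarrow> 0) (at x within face \<rho> J)"
    proof (rule Lim_null_comparison)
      show "\<forall>\<^sub>F z in at x within face \<rho> J. norm (h z - h x) \<le> L * (\<Sum>l\<in>UNIV. \<bar>z $ l - x $ l\<bar>)"
        using near by eventually_elim (simp add: lip less_imp_le)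
      have "((\<lambda>z. L * (\<Sum>l\<in>UNIV. \<bar>z $ l - x $ l\<bar>)) \<longlongrightarrow> L * (\<Sum>l\<in>(UNIV :: 'm set). \<bar>x $ l - x $ l\<bar>)) (at x within face \<rho> J)"
        by (intro tendsto_intros)
      then show "((\<lambda>z. L * (\<Sum>l\<in>UNIV. \<bar>z $ l - x $ l\<bar>)) \<longlongrightarrow> 0) (at x within face \<rho> J)"
        by simp
    qed
    then show "(h \<longlongrightarrow> h x) (at x within face \<rho> J)"
      by (rule LIM_zero_cancel)
  qed
  have "nonneg_diffs J (open_face \<rho> J) h"
    unfolding nonneg_diffs_def
  proof (intro allI impI)
    fix ps x assume ps: "set ps \<subseteq> J \<times> {0..}" "x \<in> open_face \<rho> J" "x + reach ps \<in> open_face \<rho> J"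
    have "0 \<le> iter_diff ps g x"
      using nd ps unfolding nonneg_diffs_def by blast
    then show "0 \<le> iter_diff ps h x"
      using iter_diff_cong[OF order_convex_open_face h_eq ps] by simp
  qed
  moreover have "continuous_on (open_face \<rho> J) h"
    using continuous_on_subset[OF cont_h open_face_subset_face[OF \<rho>]] .
  ultimately have "absolutely_monotonic_on J (open_face \<rho> J) h"
    by (rule nonneg_diffs_imp_absolutely_monotonic[OF order_convex_open_face axis_open_open_face])
  then have "\<forall>x\<in>open_face \<rho> J. \<forall>ls\<in>lists J.
      (\<forall>l\<in>J. partially_differentiable l (mixed_partial ls h) x) \<and> 0 \<le> mixed_partial ls h x"
    unfolding absolutely_monotonic_on_def interior_of_openin[OF openin_open_face] by blast
  then have "absolutely_monotonic_on J (face \<rho> J) h"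
    unfolding absolutely_monotonic_on_def using cont_h interior_face_subset[of J \<rho>] by blast
  then show ?thesis
    using h_eq by blast
qed

lemma face_extension_props:
  fixes g :: "real ^ 'm \<Rightarrow> real"
  assumes \<rho>: "0 < \<rho>" and g: "absolutely_monotonic_on J (open_face \<rho> J) g"
  shows face_extension_eq: "x \<in> open_face \<rho> J \<Longrightarrow> face_extension \<rho> J g x = g x"
    and continuous_on_face_extension: "continuous_on (face \<rho> J) (face_extension \<rho> J g)"
    and face_extension_tendsto: "x \<in> face \<rho> J \<Longrightarrow>
      ((\<lambda>t. g (x + t *\<^sub>R ones J)) \<longlongrightarrow> face_extension \<rho> J g x) (at_right 0)"
    and nonneg_diffs_face_extension: "nonneg_diffs J (face \<rho> J) (face_extension \<rho> J g)"
proof -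
  define h where "h = face_extension \<rho> J g"
  have h: "absolutely_monotonic_on J (face \<rho> J) h" "\<And>x. x \<in> open_face \<rho> J \<Longrightarrow> h x = g x"
    using someI_ex[OF absolutely_monotonic_extension[OF assms]] unfolding h_def face_extension_def by blast+
  show "x \<in> open_face \<rho> J \<Longrightarrow> h x = g x" for x
    by (rule h(2))
  show cont: "continuous_on (face \<rho> J) h"
    using h(1) by (simp add: absolutely_monotonic_on_def)
  have lim: "((\<lambda>t. g (x + t *\<^sub>R ones J)) \<longlongrightarrow> h x) (at_right 0)" if x: "x \<in> face \<rho> J" for x
  proof -
    note ev = eventually_shift_in_open_face[OF x \<rho>]
    have "((\<lambda>t. x + t *\<^sub>R ones J) \<longlongrightarrow> x) (at_right 0)"
      by (auto intro!: tendsto_eq_intros)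
    then have "((\<lambda>t. h (x + t *\<^sub>R ones J)) \<longlongrightarrow> h x) (at_right 0)"
      using ev open_face_subset_face[OF \<rho>]
      by (intro continuous_on_tendsto_compose[OF cont _ x]) (auto elim!: eventually_mono)
    then show ?thesis
      by (rule Lim_transform_eventually) (use ev in eventually_elim, rule h(2))
  qed
  then show "x \<in> face \<rho> J \<Longrightarrow> ((\<lambda>t. g (x + t *\<^sub>R ones J)) \<longlongrightarrow> h x) (at_right 0)" for x .
  show "nonneg_diffs J (face \<rho> J) h"
  proof (rule nonneg_diffs_limit[OF order_convex_face])
    show "((\<lambda>t. g (z + t *\<^sub>R ones J)) \<longlongrightarrow> h z) (at_right 0)" if "z \<in> face \<rho> J" for z
      by (rule lim[OF that])
    fix ps x assume ps: "set ps \<subseteq> J \<times> {0..}" and x: "x \<in> face \<rho> J" "x + reach ps \<in> face \<rho> J"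
    have nd: "nonneg_diffs J (open_face \<rho> J) g"
      by (rule absolutely_monotonic_imp_nonneg_diffs[OF order_convex_open_face openin_open_face g])
    show "\<forall>\<^sub>F t in at_right 0. 0 \<le> iter_diff ps (\<lambda>z. g (z + t *\<^sub>R ones J)) x"
      using eventually_shift_in_open_face[OF x(1) \<rho>] eventually_shift_in_open_face[OF x(2) \<rho>]
    proof eventually_elim
      case (elim t)
      have "x + reach ps + t *\<^sub>R ones J = x + t *\<^sub>R ones J + reach ps"
        by simp
      then have "0 \<le> iter_diff ps g (x + t *\<^sub>R ones J)"
        using nd ps elim unfolding nonneg_diffs_def by metis
      then show ?case
        by (simp only: iter_diff_translate)
    qed
  qed (rule trivial_limit_at_right_real)
qed

lemma pos_poly_limit_face_extension:
  fixes g :: "real ^ 'm \<Rightarrow> real"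
  assumes \<rho>: "0 < \<rho>" and g: "absolutely_monotonic_on J (open_face \<rho> J) g"
    and c: "0 < c" "ereal c < \<rho>"
  shows "pos_poly_limit (corner_box c) (\<lambda>x. face_extension \<rho> J g (proj J x))"
proof (rule nonneg_diffs_imp_pos_poly_limit[OF c(1)])
  have face: "proj J x \<in> face \<rho> J" if "x \<in> corner_box c" for x
  proof -
    have "ereal (x $ l) < \<rho>" for l
      using le_less_trans[OF _ c(2), of "ereal (x $ l)"] that by simp
    then show ?thesis
      using that \<rho> by (auto simp: face_def coord_space_def zero_ereal_def)
  qed
  show "face_extension \<rho> J g (proj J x) = face_extension \<rho> J g (proj J (proj J x))" for x
    by (simp add: proj_idem)
  show "nonneg_diffs J (corner_box c) (\<lambda>x. face_extension \<rho> J g (proj J x))"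
    unfolding nonneg_diffs_def
  proof (intro allI impI)
    fix ps x assume ps: "set ps \<subseteq> J \<times> {0..}" and x: "x \<in> corner_box c" "x + reach ps \<in> corner_box c"
    have "proj J x + reach ps \<in> face \<rho> J"
      using face[OF x(2)] by (simp add: proj_add proj_reach[OF ps])
    then show "0 \<le> iter_diff ps (\<lambda>x. face_extension \<rho> J g (proj J x)) x"
      using nonneg_diffs_face_extension[OF \<rho> g] ps face[OF x(1)]
      unfolding iter_diff_proj[OF ps] nonneg_diffs_def by blast
  qed
  show "continuous_on (corner_box c) (\<lambda>x. face_extension \<rho> J g (proj J x))"
    by (rule continuous_on_compose2[OF continuous_on_face_extension[OF \<rho> g]])
      (use face in \<open>auto intro!: continuous_intros\<close>)
qed


section \<open>Moment sequences\<close>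

lemma moment_seqs_mono: "K \<subseteq> L \<Longrightarrow> moment_seqs K \<subseteq> moment_seqs L"
  unfolding moment_seqs_def by (auto elim!: eventually_mono)

lemma bounded_moment_seqs_mono: "K \<subseteq> L \<Longrightarrow> bounded_moment_seqs \<rho> K \<subseteq> bounded_moment_seqs \<rho> L"
  using moment_seqs_mono[of K L] by (auto simp: bounded_moment_seqs_def)

lemma two_atom_moments:
  fixes u v :: real
  assumes "0 \<le> p" "0 \<le> q"
  shows "(\<lambda>k. p * u ^ k + q * v ^ k) \<in> moment_seqs {u, v}"
proof -
  define w where "w b = (if b then p else q)" for b
  define \<mu> where "\<mu> = distr (point_measure UNIV w) borel (\<lambda>b. if b then u else v)"
  have meas: "f \<in> measurable (point_measure UNIV w) borel" for f :: "bool \<Rightarrow> real"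
    by (simp add: measurable_def space_point_measure sets_point_measure)
  have w: "0 \<le> w b" for b
    using assms by (simp add: w_def)
  have int: "(\<integral>x. x ^ k \<partial>\<mu>) = p * u ^ k + q * v ^ k" for k
  proof -
    have "(\<integral>x. x ^ k \<partial>\<mu>) = (\<integral>b. (if b then u else v) ^ k \<partial>point_measure UNIV w)"
      unfolding \<mu>_def by (rule integral_distr[OF meas]) simp
    also have "\<dots> = (\<Sum>b\<in>UNIV. w b * (if b then u else v) ^ k)"
      using w by (subst lebesgue_integral_point_measure_finite) auto
    finally show ?thesis
      by (simp add: UNIV_bool w_def)
  qed
  have "integrable \<mu> (\<lambda>x. x ^ k)" for k
    unfolding \<mu>_def by (subst integrable_distr_eq[OF meas])
      (auto intro: integrable_point_measure_finite)
  then have "admissible \<mu>"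
    by (simp add: admissible_def \<mu>_def)
  moreover have "AE x in \<mu>. x \<in> {u, v}"
    unfolding \<mu>_def by (subst AE_distr_iff[OF meas]) auto
  moreover have "moments \<mu> = (\<lambda>k. p * u ^ k + q * v ^ k)"
    by (simp add: fun_eq_iff moments_def int)
  ultimately show ?thesis
    unfolding moment_seqs_def by (auto intro!: exI[of _ \<mu>])
qed

text \<open>The sum is the integral of \<open>p\<^sup>2\<close>.\<close>

lemma moment_seq_square_nonneg:
  fixes p :: "real poly"
  assumes "t \<in> moment_seqs UNIV"
  shows "0 \<le> (\<Sum>k\<le>degree (p * p). coeff (p * p) k * t k)"
proof -
  obtain \<mu> where \<mu>: "t = moments \<mu>" "admissible \<mu>"
    using assms by (auto simp: moment_seqs_def)
  have "(\<Sum>k\<le>degree (p * p). coeff (p * p) k * t k) = (\<integral>x. poly (p * p) x \<partial>\<mu>)"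
    using \<mu>(2) by (simp add: \<mu>(1) moments_def admissible_def poly_altdef Bochner_Integration.integral_sum del: poly_mult)
  also have "0 \<le> \<dots>"
    by (rule Bochner_Integration.integral_nonneg) simp
  finally show ?thesis .
qed

lemma moment_seq_Cauchy_Schwarz:
  assumes "t \<in> moment_seqs UNIV"
  shows "(t 1)\<^sup>2 \<le> t 0 * t 2"
proof -
  have q: "0 \<le> a\<^sup>2 * t 0 + 2 * a * b * t 1 + b\<^sup>2 * t 2" for a b
  proof (cases "b = 0")
    case True
    then show ?thesis
      using moment_seq_square_nonneg[OF assms, of "[:a:]"] by (cases "a = 0") (simp_all add: power2_eq_square)
  next
    case False
    have "degree ([:a, b:] * [:a, b:]) = 2"
      using False by (subst degree_mult_eq) auto
    then show ?thesis
      using moment_seq_square_nonneg[OF assms, of "[:a, b:]"] False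
      by (simp add: numeral_2_eq_2 power2_eq_square algebra_simps)
  qed
  show ?thesis
  proof (cases "t 2 = 0")
    case True
    have "t 1 = 0"
    proof (rule ccontr)
      assume "t 1 \<noteq> 0"
      then show False
        using q[of 1 "- (t 0 + 1) / (2 * t 1)"] True by (simp add: field_simps)
    qed
    then show ?thesis
      using True by simp
  next
    case False
    then have "0 < t 2"
      using q[of 0 1] by simp
    moreover have "0 \<le> t 2 * (t 0 * t 2 - (t 1)\<^sup>2)"
      using q[of "t 2" "- t 1"] by (simp add: power2_eq_square algebra_simps)
    ultimately show ?thesis
      by (simp add: zero_le_mult_iff)
  qed
qed

text \<open>If one moment of positive order vanishes, then the measure is concentrated at the origin.\<close>

lemma moment_seq_zero_tail:
  assumes s: "s \<in> moment_seqs {0..1}" and "s k = 0" "0 < k" "0 < j"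
  shows "s j = 0"
proof -
  obtain \<mu> where \<mu>: "s = moments \<mu>" "admissible \<mu>" "AE x in \<mu>. x \<in> {0..1}"
    using s by (auto simp: moment_seqs_def)
  have "AE x in \<mu>. 0 \<le> x ^ k"
    using \<mu>(3) by eventually_elim simp
  then have "AE x in \<mu>. x ^ k = 0"
    using integral_nonneg_eq_0_iff_AE[of \<mu> "\<lambda>x. x ^ k"] assms(2) \<mu> by (simp add: moments_def admissible_def)
  then have "AE x in \<mu>. x ^ j = 0"
    by eventually_elim (use assms(3,4) in simp)
  then show ?thesis
    unfolding \<mu>(1) moments_def by (rule integral_eq_zero_AE)
qed

section \<open>Transforms of moment sequences are facewise absolutely monotonic\<close>

text \<open>These hypotheses are shared by the first two conditions of the theorem. In the second condition
the inequality between values at \<open>a\<close> and \<open>b\<close> is at first visible for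
\<open>b = r\<^sup>2 a\<close> only.\<close>

locale moment_transform =
  fixes F :: "real ^ 'm \<Rightarrow> real" and \<rho> :: ereal and y :: "real ^ 'm"
  assumes \<rho>: "0 < \<rho>" and y: "y \<in> multiplicatively_generic"
    and image_y: "\<And>s. (\<And>l. s l \<in> bounded_moment_seqs \<rho> {1, y $ l}) \<Longrightarrow> entrywise F s \<in> moment_seqs UNIV"
    and image_01: "\<And>s. (\<And>l. s l \<in> bounded_moment_seqs \<rho> {0, 1}) \<Longrightarrow> entrywise F s \<in> moment_seqs UNIV"
    and ray: "\<And>c r. c \<in> cube \<rho> \<Longrightarrow> 0 \<le> r \<Longrightarrow> r \<le> 1 \<Longrightarrow> (F (r *\<^sub>R c))\<^sup>2 \<le> F c * F (r\<^sup>2 *\<^sub>R c)"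
begin

lemma y_bounds: "0 < y $ l" "y $ l < 1"
  using y by (simp_all add: multiplicatively_generic_def)

lemma minus_\<rho>_less: "0 \<le> r \<Longrightarrow> - \<rho> < ereal r"
  using \<rho> by (cases \<rho>) auto

text \<open>The sequence with first term \<open>z\<close> and all others equal to \<open>x\<close> comes
from masses \<open>z - x\<close> at 0 and \<open>x\<close> at 1. If its image is a moment
sequence, then the integrals of the squares of \<open>t\<^sup>2 - 1\<close> and \<open>t\<close>
with respect to the variable \<open>t\<close> are \<open>F z - F x\<close> and \<open>F
x\<close>.\<close>

lemma mono_and_nonneg:
  assumes x: "x \<in> cube \<rho>" and z: "z \<in> cube \<rho>" and le: "x \<le> z"
  shows "F x \<le> F z" "0 \<le> F x"
proof -
  define s where "s l k = (z $ l - x $ l) * 0 ^ k + x $ l * 1 ^ k" for l and k :: nat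
  have le': "x $ l \<le> z $ l" "0 \<le> x $ l" "ereal (z $ l) < \<rho>" "ereal (x $ l) < \<rho>" for l
    using le x z by (auto simp: less_eq_vec_def face_def)
  have "s l \<in> bounded_moment_seqs \<rho> {0, 1}" for l
  proof -
    have "s l k = (if k = 0 then z $ l else x $ l)" for k
      by (simp add: s_def)
    moreover have "s l \<in> moment_seqs {0, 1}"
      unfolding s_def using le'[of l] by (intro two_atom_moments) auto
    ultimately show ?thesis
      using le'[of l] minus_\<rho>_less by (simp add: bounded_moment_seqs_def order_trans[OF le'(2) le'(1)])
  qed
  then have t: "entrywise F s \<in> moment_seqs UNIV"
    by (rule image_01)
  have t0: "entrywise F s 0 = F z" and tk: "0 < k \<Longrightarrow> entrywise F s k = F x" for k
    by (simp_all add: entrywise_def s_def vec_lambda_eta power_0_left)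
  let ?p = "[:- 1, 0, 1:] :: real poly"
  have p: "?p * ?p = [:1, 0, -2, 0, 1:]"
    by simp
  have "(\<Sum>k\<le>degree (?p * ?p). coeff (?p * ?p) k * entrywise F s k) = F z - F x"
    unfolding p using t0 tk[of 2] tk[of 4] by (simp add: eval_nat_numeral)
  then show "F x \<le> F z"
    using moment_seq_square_nonneg[OF t, of ?p] by linarith
  have "0 \<le> (\<Sum>k\<le>degree ([:0, 1:] * [:0, 1:] :: real poly). coeff ([:0, 1:] * [:0, 1:]) k * entrywise F s k)"
    by (rule moment_seq_square_nonneg[OF t])
  then show "0 \<le> F x"
    using tk[of 2] by (simp add: eval_nat_numeral)
qed

text \<open>On the ray through \<open>x\<close> the function is monotone and, in a logarithmic scale,
midpoint convex; this leaves no room for a jump at \<open>x\<close>. Points of the face near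
\<open>x\<close> lie between two multiples of \<open>x\<close> close to \<open>x\<close>, so
monotonicity reduces continuity to the ray.\<close>

lemma continuous_on_F: "continuous_on (open_face \<rho> J) F"
  unfolding continuous_on_def
proof
  fix x assume x: "x \<in> open_face \<rho> J"
  then have xf: "x \<in> cube \<rho>"
    using open_face_subset_cube[OF \<rho>, of J] by blast
  have x0: "0 \<le> x $ l" "ereal (x $ l) < \<rho>" for l
    using xf by (simp_all add: face_def)
  have pos: "0 < x $ l" if "l \<in> J" for l
    using x that by (simp add: open_face_def)
  obtain c where c: "0 < c" "\<And>l. x $ l < c" "ereal c < \<rho>"
    using bound_below_ereal[OF x0(2) \<rho>] by blast
  \<comment> \<open>The factor \<open>R\<close> keeps the ray through \<open>x\<close> below \<open>c\<close>; the constant 2 serves the empty face.\<close>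
  define R where "R = Min (insert 2 ((\<lambda>l. c / x $ l) ` J))"
  have R1: "1 < R"
    unfolding R_def using c(2) pos by (subst Min_gr_iff) auto
  have Rx: "R * x $ l \<le> c" for l
  proof (cases "l \<in> J")
    case True
    then have "R \<le> c / x $ l"
      unfolding R_def by (intro Min_le) auto
    then show ?thesis
      using pos[OF True] by (simp add: pos_le_divide_eq)
  next
    case False
    then show ?thesis
      using x c(1) by (simp add: open_face_def coord_space_def)
  qed
  have in_cube: "r *\<^sub>R x \<in> cube \<rho>" if "0 \<le> r" "r \<le> R" for r
  proof -
    have "r * x $ l \<le> c" for l
      using mult_right_mono[OF that(2) x0(1)[of l]] Rx[of l] by linarith
    then have "ereal (r * x $ l) < \<rho>" for l
      using le_less_trans[OF _ c(3), of "ereal (r * x $ l)"] by simp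
    then show ?thesis
      using that(1) x0(1) by (simp add: face_def coord_space_def)
  qed
  \<comment> \<open>Successive square roots, so that \<open>r n\<close> is the square of its successor and the inequality on rays relates consecutive terms.\<close>
  define r where "r n = R powr (1 / 2 ^ n)" for n :: nat
  have r1: "1 < r n" "r n \<le> R" for n
  proof -
    show "1 < r n"
      using R1 by (simp add: r_def)
    show "r n \<le> R"
      using R1 powr_mono[of "1 / 2 ^ n" 1 R] by (simp add: r_def)
  qed
  have r_inv: "0 \<le> 1 / r n" "1 / r n \<le> 1" "1 / r n \<le> R" for n
  proof -
    show "0 \<le> 1 / r n" and le1: "1 / r n \<le> 1"
      using r1(1)[of n] by simp_all
    show "1 / r n \<le> R"
      using le1 R1 by linarith
  qed
  have r2: "(r (Suc n))\<^sup>2 = r n" for n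
    using R1 by (simp add: r_def power2_eq_square flip: powr_add)
  have r_decr: "r (Suc n) \<le> r n" for n
    using r1[of "Suc n"] unfolding r2[of n, symmetric] by (simp add: power2_eq_square)
  define u where "u n = F (r n *\<^sub>R x)" for n
  define v where "v n = F ((1 / r n) *\<^sub>R x)" for n
  have scale_mono: "p *\<^sub>R x \<le> q *\<^sub>R x" if "p \<le> q" for p q :: real
    using that x0(1) by (simp add: less_eq_vec_def mult_right_mono)
  have F_mono: "F (p *\<^sub>R x) \<le> F (q *\<^sub>R x)" if "0 \<le> p" "p \<le> q" "q \<le> R" for p q
    using that by (intro mono_and_nonneg(1) in_cube scale_mono) auto
  have x_le_u: "F x \<le> u n" for n
    using F_mono[of 1 "r n"] r1[of n] by (simp add: u_def)
  have v_le_x: "v n \<le> F x" for n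
    using F_mono[OF r_inv(1,2)] R1 by (simp add: v_def)
  have Fx: "0 \<le> F x" "0 \<le> v n" for n
    unfolding v_def
    by (rule mono_and_nonneg(2)[OF xf xf order_refl],
        rule mono_and_nonneg(2)[OF in_cube[OF r_inv(1,3)] in_cube[OF r_inv(1,3)] order_refl])
  have u_step: "(u (Suc n))\<^sup>2 \<le> u n * F x" for n
  proof -
    have "(F ((1 / r (Suc n)) *\<^sub>R (r n *\<^sub>R x)))\<^sup>2
        \<le> F (r n *\<^sub>R x) * F ((1 / r (Suc n))\<^sup>2 *\<^sub>R (r n *\<^sub>R x))"
      using r1[of n] r_inv[of "Suc n"] by (intro ray in_cube) simp_all
    moreover have "1 / r (Suc n) * r n = r (Suc n)"
      using r1[of "Suc n"] unfolding r2[of n, symmetric] by (simp add: power2_eq_square)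
    moreover have "(1 / r (Suc n))\<^sup>2 * r n = 1"
      using r1[of "Suc n"] unfolding r2[of n, symmetric] by (simp add: power_divide)
    ultimately show ?thesis
      unfolding scaleR_scaleR by (simp only: u_def scaleR_one)
  qed
  have v_step: "(F x)\<^sup>2 \<le> u n * v n" for n
  proof -
    have "(F ((1 / r n) *\<^sub>R (r n *\<^sub>R x)))\<^sup>2 \<le> F (r n *\<^sub>R x) * F ((1 / r n)\<^sup>2 *\<^sub>R (r n *\<^sub>R x))"
      using r1[of n] r_inv[of n] by (intro ray in_cube) simp_all
    moreover have "1 / r n * r n = 1" "(1 / r n)\<^sup>2 * r n = 1 / r n"
      using r1[of n] by (simp_all add: power2_eq_square)
    ultimately show ?thesis
      unfolding scaleR_scaleR by (simp only: u_def v_def scaleR_one)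
  qed
  have "decseq u"
    unfolding decseq_Suc_iff u_def using r1 r_decr by (auto intro!: F_mono simp: less_imp_le order_trans[OF zero_le_one])
  then obtain P where P: "u \<longlonglongrightarrow> P" "\<And>n. P \<le> u n"
    using decseq_convergent[of u "F x"] x_le_u by blast
  have "F x \<le> P"
    using x_le_u by (intro LIMSEQ_le_const[OF P(1)]) auto
  have "(\<lambda>n. (u (Suc n))\<^sup>2) \<longlonglongrightarrow> P\<^sup>2" "(\<lambda>n. u n * F x) \<longlonglongrightarrow> P * F x"
    using LIMSEQ_Suc[OF P(1)] P(1) by (auto intro!: tendsto_intros)
  then have "P\<^sup>2 \<le> P * F x"
    using u_step by (intro LIMSEQ_le) auto
  then have "P = F x"
    using \<open>F x \<le> P\<close> Fx(1) by (cases "P = 0") (auto simp: power2_eq_square)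
  then have u_lim: "u \<longlonglongrightarrow> F x"
    using P(1) by simp
  have v_lim: "v \<longlonglongrightarrow> F x"
  proof (cases "F x = 0")
    case True
    then have "v = (\<lambda>_. F x)"
      using v_le_x Fx(2) by (intro ext antisym) simp_all
    then show ?thesis
      by simp
  next
    case False
    then have Fpos: "0 < F x"
      using Fx(1) by simp
    show ?thesis
    proof (rule tendsto_sandwich[of "\<lambda>n. (F x)\<^sup>2 / u n" _ _ "\<lambda>_. F x"])
      have "0 < u n" for n
        using Fpos x_le_u[of n] by linarith
      then show "\<forall>\<^sub>F n in sequentially. (F x)\<^sup>2 / u n \<le> v n"
        using v_step by (intro always_eventually allI) (simp add: pos_divide_le_eq mult.commute)
      have "(\<lambda>n. (F x)\<^sup>2 / u n) \<longlonglongrightarrow> (F x)\<^sup>2 / F x"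
        using False by (intro tendsto_intros u_lim) auto
      then show "(\<lambda>n. (F x)\<^sup>2 / u n) \<longlonglongrightarrow> F x"
        using False by (simp add: power2_eq_square)
    qed (use v_le_x in auto)
  qed
  show "(F \<longlongrightarrow> F x) (at x within open_face \<rho> J)"
  proof (rule tendstoI)
    fix e :: real assume "0 < e"
    then have "\<forall>\<^sub>F n in sequentially. dist (u n) (F x) < e \<and> dist (v n) (F x) < e"
      using tendstoD[OF u_lim] tendstoD[OF v_lim] by (intro eventually_conj) auto
    then obtain n where n: "dist (u n) (F x) < e" "dist (v n) (F x) < e"
      by (auto simp: eventually_sequentially)
    have "\<forall>\<^sub>F z in at x within open_face \<rho> J. z \<in> open_face \<rho> J \<and>
        (\<forall>l\<in>J. x $ l / r n < z $ l) \<and> (\<forall>l\<in>J. z $ l < r n * x $ l)"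
    proof (intro eventually_conj eventually_ball_finite ballI)
      show "\<forall>\<^sub>F z in at x within open_face \<rho> J. z \<in> open_face \<rho> J"
        by (simp add: eventually_at_filter)
      fix l assume l: "l \<in> J"
      have lim: "((\<lambda>z. z $ l) \<longlongrightarrow> x $ l) (at x within open_face \<rho> J)"
        by (intro tendsto_intros)
      have "x $ l / r n < x $ l" "x $ l < r n * x $ l"
        using pos[OF l] r1[of n] by (simp_all add: divide_less_eq)
      then show "\<forall>\<^sub>F z in at x within open_face \<rho> J. x $ l / r n < z $ l"
        "\<forall>\<^sub>F z in at x within open_face \<rho> J. z $ l < r n * x $ l"
        using order_tendstoD[OF lim] by auto
    qed simp_all
    then show "\<forall>\<^sub>F z in at x within open_face \<rho> J. dist (F z) (F x) < e"
    proof eventually_elim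
      case (elim z)
      have zero: "x $ l = 0" "z $ l = 0" if "l \<notin> J" for l
        using x elim that by (simp_all add: open_face_def coord_space_def)
      have "((1 / r n) *\<^sub>R x) $ l \<le> z $ l" "z $ l \<le> (r n *\<^sub>R x) $ l" for l
        using elim zero[of l] by (cases "l \<in> J"; simp add: less_imp_le)+
      then have le: "(1 / r n) *\<^sub>R x \<le> z" "z \<le> r n *\<^sub>R x"
        unfolding less_eq_vec_def by blast+
      have zc: "z \<in> cube \<rho>"
        using elim open_face_subset_cube[OF \<rho>, of J] by blast
      have "0 \<le> r n"
        using r1[of n] by simp
      then have "v n \<le> F z" "F z \<le> u n"
        unfolding u_def v_def using le zc r1(2)[of n] r_inv[of n] by (auto intro!: mono_and_nonneg(1) in_cube)
      then show ?case
        using n by (auto simp: dist_real_def)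
    qed
  qed
qed

lemma square_positive_F_proj:
  assumes c: "ereal c \<le> \<rho>"
  shows "square_positive y c (\<lambda>x. F (proj J x))"
  unfolding square_positive_def
proof (intro allI impI)
  fix p :: "real poly" and a :: "real ^ 'm" and \<epsilon> :: real
  assume a: "\<forall>l. 0 < a $ l \<and> a $ l + \<epsilon> < c" and \<epsilon>: "0 \<le> \<epsilon>"
  define s where "s l k = (if l \<in> J then a $ l else 0) * 1 ^ k + (if l \<in> J then \<epsilon> else 0) * (y $ l) ^ k" for l and k :: nat
  have "s l \<in> bounded_moment_seqs \<rho> {1, y $ l}" for l
  proof -
    have "s l \<in> moment_seqs {1, y $ l}"
      unfolding s_def using a \<epsilon> by (intro two_atom_moments) (auto simp: less_imp_le)
    moreover have "0 \<le> s l k \<and> ereal (s l k) < \<rho>" for k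
    proof -
      have y: "0 \<le> y $ l ^ k" "\<epsilon> * y $ l ^ k \<le> \<epsilon>"
        using y_bounds[of l] \<epsilon> by (simp_all add: power_le_one mult_left_le)
      have al: "0 < a $ l" "a $ l + \<epsilon> < c"
        using a by blast+
      show ?thesis
      proof (cases "l \<in> J")
        case True
        then have "s l k < c" "0 \<le> s l k"
          using y al \<epsilon> by (simp_all add: s_def)
        then show ?thesis
          using less_le_trans[OF _ c, of "ereal (s l k)"] by simp
      next
        case False
        then show ?thesis
          using \<rho> by (simp add: s_def zero_ereal_def)
      qed
    qed
    ultimately show ?thesis
      using minus_\<rho>_less by (simp add: bounded_moment_seqs_def)
  qed
  then have "0 \<le> (\<Sum>k\<le>degree (p * p). coeff (p * p) k * entrywise F s k)"
    by (intro moment_seq_square_nonneg image_y)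
  moreover have "entrywise F s k = F (proj J (a + \<epsilon> *\<^sub>R vec_power y k))" for k
    unfolding entrywise_def by (rule arg_cong[of _ _ F]) (simp add: vec_eq_iff s_def vec_power_def)
  ultimately show "0 \<le> (\<Sum>k\<le>degree (p * p). coeff (p * p) k * F (proj J (a + \<epsilon> *\<^sub>R vec_power y k)))"
    by simp
qed

lemma proj_open_box_in_open_face:
  assumes c: "ereal c \<le> \<rho>" and x: "x \<in> open_box c"
  shows "proj J x \<in> open_face \<rho> J"
proof -
  have "0 < x $ l" "x $ l < c" for l
    using x by simp_all
  moreover have "ereal (x $ l) < \<rho>" for l
    using less_le_trans[OF _ c, of "ereal (x $ l)"] x by simp
  ultimately show ?thesis
    by (simp add: open_face_def coord_space_def)
qed

text \<open>Composing \<open>F\<close> with the projection to a face yields a function on a full-dimensional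
box, so all faces are treated alike. Coordinates outside \<open>J\<close> may then have any
value inside the box, such as \<open>c / 2\<close>.\<close>

lemma nonneg_diffs_F: "nonneg_diffs J (open_face \<rho> J) F"
  unfolding nonneg_diffs_def
proof (intro allI impI)
  fix ps x assume ps: "set ps \<subseteq> J \<times> {0..}" and x: "x \<in> open_face \<rho> J" "x + reach ps \<in> open_face \<rho> J"
  have "ereal ((x + reach ps) $ l) < \<rho>" for l
    using subsetD[OF open_face_subset_face[OF \<rho>] x(2)] by (simp only: face_def mem_Collect_eq)
  then obtain c where c: "0 < c" "\<And>l. (x + reach ps) $ l < c" "ereal c < \<rho>"
    using bound_below_ereal[of "x + reach ps" \<rho>] \<rho> by blast
  have c_le: "ereal c \<le> \<rho>"
    using c(3) by simp
  define x' where "x' = (\<chi> l. if l \<in> J then x $ l else c / 2)"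
  have proj_x': "proj J x' = x"
    using x(1) by (auto simp: vec_eq_iff x'_def open_face_def coord_space_def)
  have reach0: "reach ps $ l = 0" if "l \<notin> J" for l
  proof -
    have "reach ps $ l = proj J (reach ps) $ l"
      by (simp only: proj_reach[OF ps])
    then show ?thesis
      using that by simp
  qed
  have x_pos: "0 < x $ l" "x $ l \<le> (x + reach ps) $ l" if "l \<in> J" for l
    using x(1) that reach_nonneg[OF ps] by (auto simp: open_face_def less_eq_vec_def)
  have x': "x' \<in> open_box c" "x' + reach ps \<in> open_box c"
  proof -
    have "0 < x' $ l \<and> x' $ l < c \<and> 0 < (x' + reach ps) $ l \<and> (x' + reach ps) $ l < c" for l
    proof (cases "l \<in> J")
      case True
      then show ?thesis
        using x_pos[OF True] c(2)[of l] by (simp add: x'_def)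
    next
      case False
      then show ?thesis
        using c(1) reach0[OF False] by (simp add: x'_def)
    qed
    then show "x' \<in> open_box c" "x' + reach ps \<in> open_box c"
      by blast+
  qed
  have "continuous_on (open_box c) (\<lambda>x. F (proj J x))"
    by (rule continuous_on_compose2[OF continuous_on_F[of J]])
      (use proj_open_box_in_open_face[OF c_le] in \<open>auto intro!: continuous_intros\<close>)
  then have "nonneg_diffs UNIV (open_box c) (\<lambda>x. F (proj J x))"
    by (rule square_positive_imp_nonneg_diffs[OF y _ square_positive_F_proj[OF c_le]])
  moreover have "set ps \<subseteq> UNIV \<times> {0..}"
    using ps by auto
  ultimately have "0 \<le> iter_diff ps (\<lambda>x. F (proj J x)) x'"
    using x' unfolding nonneg_diffs_def by blast
  then show "0 \<le> iter_diff ps F x"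
    by (simp only: iter_diff_proj[OF ps] proj_x')
qed

lemma absolutely_monotonic_F: "absolutely_monotonic_on J (open_face \<rho> J) F"
  by (rule nonneg_diffs_imp_absolutely_monotonic[OF order_convex_open_face axis_open_open_face
        nonneg_diffs_F continuous_on_F])

text \<open>The extension from a face is the limit of \<open>F\<close> in the direction of the interior of
this face, and for \<open>K \<subseteq> J\<close> the points that approach through
\<open>J\<close> dominate those that approach through \<open>K\<close>.\<close>

lemma facewise_condition:
  "facewise_absolutely_monotonic \<rho> F (\<lambda>_. F)"
  "x \<in> face \<rho> K \<Longrightarrow> 0 \<le> face_extension \<rho> K F x"
  "K \<subseteq> J \<Longrightarrow> x \<in> face \<rho> K \<Longrightarrow> face_extension \<rho> K F x \<le> face_extension \<rho> J F x"
proof -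
  show "facewise_absolutely_monotonic \<rho> F (\<lambda>_. F)"
    by (simp add: facewise_absolutely_monotonic_def absolutely_monotonic_F)
  show "0 \<le> face_extension \<rho> K F x" if "x \<in> face \<rho> K"
    by (rule nonneg_diffs_nonneg[OF nonneg_diffs_face_extension[OF \<rho> absolutely_monotonic_F] that])
  assume K: "K \<subseteq> J" and x: "x \<in> face \<rho> K"
  have xJ: "x \<in> face \<rho> J"
    using x K by (auto simp: face_def coord_space_def)
  show "face_extension \<rho> K F x \<le> face_extension \<rho> J F x"
  proof (rule tendsto_le[OF trivial_limit_at_right_real
        face_extension_tendsto[OF \<rho> absolutely_monotonic_F xJ]
        face_extension_tendsto[OF \<rho> absolutely_monotonic_F x]])
    show "\<forall>\<^sub>F t in at_right 0. F (x + t *\<^sub>R ones K) \<le> F (x + t *\<^sub>R ones J)"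
      using eventually_shift_in_open_face[OF x \<rho>] eventually_shift_in_open_face[OF xJ \<rho>]
        eventually_at_right_less[of 0]
    proof eventually_elim
      case (elim t)
      have "x + t *\<^sub>R ones K \<in> cube \<rho>" "x + t *\<^sub>R ones J \<in> cube \<rho>"
        using elim open_face_subset_cube[OF \<rho>] by blast+
      moreover have "x + t *\<^sub>R ones K \<le> x + t *\<^sub>R ones J"
        using K elim by (auto simp: less_eq_vec_def)
      ultimately show ?case
        by (rule mono_and_nonneg(1))
    qed
  qed
qed

end

section \<open>Facewise absolutely monotonic functions transform moment sequences\<close>

locale monotone_facewise =
  fixes F :: "real ^ 'm \<Rightarrow> real" and \<rho> :: ereal and g :: "'m set \<Rightarrow> real ^ 'm \<Rightarrow> real"
  assumes \<rho>: "0 < \<rho>" and F: "facewise_absolutely_monotonic \<rho> F g"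
    and ext_mono: "\<And>K J x. K \<subseteq> J \<Longrightarrow> x \<in> face \<rho> K \<Longrightarrow>
      face_extension \<rho> K (g K) x \<le> face_extension \<rho> J (g J) x"
begin

abbreviation "h J \<equiv> face_extension \<rho> J (g J)"

lemma g_am: "absolutely_monotonic_on J (open_face \<rho> J) (g J)"
  using F by (simp add: facewise_absolutely_monotonic_def)

definition support :: "real ^ 'm \<Rightarrow> 'm set" where
  "support x = {l. x $ l \<noteq> 0}"

lemma proj_support: "support x \<subseteq> J \<Longrightarrow> proj J x = x"
  by (auto simp: support_def vec_eq_iff)

lemma in_open_face_support: "x \<in> cube \<rho> \<Longrightarrow> x \<in> open_face \<rho> (support x)"
  by (auto simp: support_def open_face_def face_def coord_space_def less_le)

lemma F_eq_h: "x \<in> cube \<rho> \<Longrightarrow> F x = h (support x) x"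
  using F face_extension_eq[OF \<rho> g_am in_open_face_support] in_open_face_support
  by (simp add: facewise_absolutely_monotonic_def)

lemma cube_corner_box:
  assumes "x \<in> cube \<rho>"
  obtains c where "0 < c" "ereal c < \<rho>" "x \<in> corner_box c"
proof -
  obtain c where "0 < c" "\<And>l. x $ l < c" "ereal c < \<rho>"
    using bound_below_ereal[of x \<rho>] \<rho> assms by (auto simp: face_def)
  then show ?thesis
    using assms by (intro that[of c]) (auto simp: face_def less_imp_le)
qed

lemma proj_in_face: "x \<in> cube \<rho> \<Longrightarrow> proj J x \<in> face \<rho> J"
  using \<rho> by (auto simp: face_def coord_space_def zero_ereal_def)

text \<open>Decrease \<open>x\<close> to its projection inside the face spanned by its support, then pass to
the smaller face by the comparison of extensions.\<close>

lemma h_proj_le: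
  assumes x: "x \<in> cube \<rho>" and K: "K \<subseteq> support x"
  shows "h K (proj K x) \<le> F x" "0 \<le> h K (proj K x)"
proof -
  obtain c where c: "0 < c" "ereal c < \<rho>" "x \<in> corner_box c"
    using cube_corner_box[OF x] by blast
  have nonneg: "\<And>x. x \<in> corner_box c \<Longrightarrow> (0 :: real ^ 'm) \<le> x"
    by (simp add: less_eq_vec_def)
  have p: "proj K x \<in> corner_box c" "proj K x \<le> x"
    using c by (auto simp: less_eq_vec_def)
  have "h K (proj K x) \<le> h (support x) (proj K x)"
    by (rule ext_mono[OF K proj_in_face[OF x]])
  also have "\<dots> = h (support x) (proj (support x) (proj K x))"
    using K by (subst proj_support) (auto simp: support_def)
  also have "\<dots> \<le> h (support x) (proj (support x) x)"
    by (rule pos_poly_limit_mono[OF pos_poly_limit_face_extension[OF \<rho> g_am c(1,2)] nonneg p(1) c(3) p(2)])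
  also have "\<dots> = F x"
    using F_eq_h[OF x] by (simp add: proj_support)
  finally show "h K (proj K x) \<le> F x" .
  show "0 \<le> h K (proj K x)"
    by (rule pos_poly_limit_nonneg[OF pos_poly_limit_face_extension[OF \<rho> g_am c(1,2)] nonneg c(3)])
qed

text \<open>The geometric mean lies in the open face \<open>K\<close> of the common support. There the
inequality holds for the projections of \<open>a\<close> and \<open>b\<close>, whose values do
not exceed those of \<open>F\<close> at \<open>a\<close> and \<open>b\<close>.\<close>

lemma geometric_mean_inequality:
  assumes a: "a \<in> cube \<rho>" and b: "b \<in> cube \<rho>"
  shows "(F (\<chi> l. sqrt (a $ l * b $ l)))\<^sup>2 \<le> F a * F b"
proof -
  define m where "m = (\<chi> l. sqrt (a $ l * b $ l))"
  define K where "K = support m"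
  have K: "K \<subseteq> support a" "K \<subseteq> support b"
    by (auto simp: K_def support_def m_def)
  define w where "w = (\<chi> l. max (a $ l) (b $ l))"
  have w: "w \<in> cube \<rho>"
    using a b by (auto simp: w_def face_def coord_space_def max_def)
  obtain c where c: "0 < c" "ereal c < \<rho>" "w \<in> corner_box c"
    using cube_corner_box[OF w] by blast
  have ab0: "0 \<le> a $ l" "0 \<le> b $ l" for l
    using a b by (simp_all add: face_def)
  have m_le: "m $ l \<le> w $ l" for l
  proof -
    have "a $ l * b $ l \<le> w $ l * w $ l"
      using ab0 by (intro mult_mono) (simp_all add: w_def le_max_iff_disj)
    then have "m $ l \<le> sqrt (w $ l * w $ l)"
      unfolding m_def vec_lambda_beta by (rule real_sqrt_le_mono)
    also have "\<dots> = w $ l"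
      using ab0[of l] by (simp add: w_def le_max_iff_disj)
    finally show ?thesis .
  qed
  have w_c: "w $ l \<le> c" for l
    using c(3) by blast
  have "0 \<le> m $ l" "m $ l \<le> c" "a $ l \<le> c" "b $ l \<le> c" for l
  proof -
    show "0 \<le> m $ l"
      using ab0[of l] by (simp add: m_def)
    show "m $ l \<le> c"
      using m_le[of l] w_c[of l] by linarith
    show "a $ l \<le> c" "b $ l \<le> c"
      using w_c[of l] by (simp_all add: w_def)
  qed
  then have box: "a \<in> corner_box c" "b \<in> corner_box c" "m \<in> corner_box c"
    using ab0 by simp_all
  have mc: "m \<in> cube \<rho>"
    using order_convexD[OF order_convex_face _ w, of 0 m] m_le box(3) \<rho>
    by (simp add: less_eq_vec_def face_def coord_space_def zero_ereal_def)
  have nonneg: "\<And>x. x \<in> corner_box c \<Longrightarrow> (0 :: real ^ 'm) \<le> x"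
    by (simp add: less_eq_vec_def)
  have "(F m)\<^sup>2 = (h K (proj K m))\<^sup>2"
    using F_eq_h[OF mc] by (simp add: K_def proj_support)
  also have "\<dots> \<le> h K (proj K a) * h K (proj K b)"
    using pos_poly_limit_Cauchy_Schwarz[OF pos_poly_limit_face_extension[OF \<rho> g_am c(1,2)] nonneg box(1,2)]
      box(3) unfolding m_def by blast
  also have "\<dots> \<le> F a * F b"
    using h_proj_le[OF a K(1)] h_proj_le[OF b K(2)] by (intro mult_mono) auto
  finally show ?thesis
    by (simp add: m_def)
qed

text \<open>All moments of positive order have the same support \<open>K\<close>, so from order one on the
image agrees with that of the extension from \<open>K\<close>, which is completely monotone also
at order zero. The difference at order zero is a non-negative mass at the origin.\<close>

lemma preserves_moment_seqs:
  assumes s: "\<And>l. s l \<in> bounded_moment_seqs \<rho> {0..1}"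
  shows "entrywise F s \<in> moment_seqs {0..1}"
proof -
  define X where "X k = (\<chi> l. s l k)" for k
  have s_mom: "s l \<in> moment_seqs {0..1}" and s_less: "ereal (s l k) < \<rho>" for l k
    using s[of l] by (simp_all add: bounded_moment_seqs_def)
  have cm: "completely_monotone (s l)" for l
    by (rule completely_monotone_moments[OF s_mom])
  have s_nonneg: "0 \<le> s l k" and s_le: "s l k \<le> s l 0" for l k
    by (rule completely_monotone_nonneg[OF cm], rule completely_monotone_le_0[OF cm])
  have X: "X k \<in> cube \<rho>" for k
    using s_nonneg s_less by (simp add: X_def face_def coord_space_def)
  define K where "K = support (X 1)"
  have supp: "support (X k) = K" if "0 < k" for k
  proof -
    have "s l k = 0 \<longleftrightarrow> s l 1 = 0" for l
      using moment_seq_zero_tail[OF s_mom[of l]] that by (meson zero_less_one)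
    then show ?thesis
      by (simp add: K_def support_def X_def)
  qed
  have supp0: "K \<subseteq> support (X 0)"
  proof -
    have "s l 1 = 0" if "s l 0 = 0" for l
      using s_le[of l 1] s_nonneg[of l 1] that by simp
    then show ?thesis
      by (auto simp: K_def support_def X_def)
  qed
  obtain c where c: "0 < c" "ereal c < \<rho>" "X 0 \<in> corner_box c"
    using cube_corner_box[OF X[of 0]] by blast
  have box: "(\<chi> l. s l k) \<in> corner_box c" for k
  proof -
    have "s l k \<le> c" for l
      using c(3) s_le[of l k] by (auto simp: X_def dest: spec[of _ l])
    then show ?thesis
      using s_nonneg by simp
  qed
  define v where "v k = h K (proj K (X k))" for k
  have v: "completely_monotone v"
    unfolding v_def X_def
    by (rule pos_poly_limit_completely_monotone[OF pos_poly_limit_face_extension[OF \<rho> g_am c(1,2)] cm box])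
  define e where "e = F (X 0) - v 0"
  have "0 \<le> e"
    using h_proj_le(1)[OF X supp0] by (simp add: e_def v_def)
  have "entrywise F s k = v k + (if k = 0 then e else 0)" for k
  proof (cases "k = 0")
    case True
    then show ?thesis
      by (simp add: entrywise_def e_def X_def)
  next
    case False
    then have "F (X k) = v k"
      using F_eq_h[OF X[of k]] supp[of k] proj_support[of "X k" K] by (simp add: v_def)
    then show ?thesis
      using False by (simp add: entrywise_def X_def)
  qed
  then have "entrywise F s = (\<lambda>k. v k + (if k = 0 then e else 0))"
    by (simp add: fun_eq_iff)
  then have "completely_monotone (entrywise F s)"
    using completely_monotone_add[OF v completely_monotone_single[OF \<open>0 \<le> e\<close>]] by simp
  then show ?thesis
    by (rule Hausdorff_moment)
qed

end

section \<open>The equivalence\<close>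

theorem theorem9p5:
  fixes F :: "real ^ 'm \<Rightarrow> real" and \<rho> :: ereal and y :: "real ^ 'm"
  assumes "0 < \<rho>"
    and "y \<in> multiplicatively_generic"
  defines "cond1 \<equiv>
      entrywise F ` (Pi UNIV (\<lambda>l. bounded_moment_seqs \<rho> {1, y $ l})
                     \<union> Pi UNIV (\<lambda>_. bounded_moment_seqs \<rho> {0, 1}))
        \<subseteq> moment_seqs UNIV \<and>
      (\<forall>a \<in> cube \<rho>. \<forall>b \<in> cube \<rho>. F a * F b \<ge> (F (\<chi> l. sqrt (a $ l * b $ l)))\<^sup>2)"
    and "cond2 \<equiv>
      entrywise F ` Pi UNIV (\<lambda>_. bounded_moment_seqs \<rho> {0..1}) \<subseteq> moment_seqs {0..1}"
    and "cond3 \<equiv>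
      \<exists>g. facewise_absolutely_monotonic \<rho> F g \<and>
          (\<forall>K J. K \<subseteq> J \<longrightarrow> (\<forall>x \<in> face \<rho> K.
             0 \<le> face_extension \<rho> K (g K) x \<and>
             face_extension \<rho> K (g K) x \<le> face_extension \<rho> J (g J) x))"
  shows "(cond1 \<longleftrightarrow> cond2) \<and> (cond2 \<longleftrightarrow> cond3)"
proof -
  note \<rho> = assms(1)
  have y: "0 < y $ l" "y $ l < 1" for l
    using assms(2) by (simp_all add: multiplicatively_generic_def)
  have sub: "bounded_moment_seqs \<rho> {1, y $ l} \<subseteq> bounded_moment_seqs \<rho> {0..1}"
    "bounded_moment_seqs \<rho> {0, 1} \<subseteq> bounded_moment_seqs \<rho> {0..1}" for l
    using y[of l] by (auto intro!: bounded_moment_seqs_mono)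
  have UNIV: "moment_seqs {0..1} \<subseteq> moment_seqs UNIV"
    by (rule moment_seqs_mono) simp
  have transform_imp_3: "cond3" if "moment_transform F \<rho> y"
  proof -
    interpret moment_transform F \<rho> y by fact
    show ?thesis
      unfolding cond3_def using facewise_condition by (intro exI[of _ "\<lambda>_. F"]) blast
  qed
  have cube_scale: "r *\<^sub>R c \<in> cube \<rho>" if "c \<in> cube \<rho>" "0 \<le> r" "r \<le> 1" for r and c :: "real ^ 'm"
  proof -
    have c: "0 \<le> c $ l" "ereal (c $ l) < \<rho>" for l
      using that(1) by (simp_all add: face_def)
    have "r * c $ l \<le> c $ l" for l
      using c(1)[of l] that(3) by (simp add: mult_left_le_one_le that(2))
    then have "ereal (r * c $ l) < \<rho>" for l
      using le_less_trans[OF _ c(2)[of l], of "ereal (r * c $ l)"] by simp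
    then show ?thesis
      using c(1) that(2) by (simp add: face_def coord_space_def)
  qed
  have 13: "cond3" if "cond1"
  proof (rule transform_imp_3, unfold_locales)
    have img: "entrywise F s \<in> moment_seqs UNIV"
      if "s \<in> Pi UNIV (\<lambda>l. bounded_moment_seqs \<rho> {1, y $ l}) \<union> Pi UNIV (\<lambda>_. bounded_moment_seqs \<rho> {0, 1})" for s
      using \<open>cond1\<close> that unfolding cond1_def by blast
    show "entrywise F s \<in> moment_seqs UNIV" if "\<And>l. s l \<in> bounded_moment_seqs \<rho> {1, y $ l}" for s
      using that by (intro img) auto
    show "entrywise F s \<in> moment_seqs UNIV" if "\<And>l. s l \<in> bounded_moment_seqs \<rho> {0, 1}" for s
      using that by (intro img) auto
    show "(F (r *\<^sub>R c))\<^sup>2 \<le> F c * F (r\<^sup>2 *\<^sub>R c)" if c: "c \<in> cube \<rho>" and r: "0 \<le> r" "r \<le> 1" for c r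
    proof -
      have "r\<^sup>2 *\<^sub>R c \<in> cube \<rho>"
        using c r by (intro cube_scale) (auto simp: power_le_one)
      moreover have "(\<chi> l. sqrt (c $ l * (r\<^sup>2 *\<^sub>R c) $ l)) = r *\<^sub>R c"
      proof -
        have "c $ l * (r\<^sup>2 * c $ l) = (r * c $ l)\<^sup>2" for l
          by (simp add: power2_eq_square)
        then show ?thesis
          using c r(1) by (simp add: vec_eq_iff face_def)
      qed
      ultimately show ?thesis
        using \<open>cond1\<close> c unfolding cond1_def by metis
    qed
  qed (use assms(1,2) in auto)
  have 23: "cond3" if "cond2"
  proof (rule transform_imp_3, unfold_locales)
    have img: "entrywise F s \<in> moment_seqs UNIV" if "\<And>l. s l \<in> bounded_moment_seqs \<rho> {0..1}" for s
      using \<open>cond2\<close> that UNIV unfolding cond2_def by blast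
    show "entrywise F s \<in> moment_seqs UNIV" if "\<And>l. s l \<in> bounded_moment_seqs \<rho> {1, y $ l}" for s
      using that sub(1) by (intro img) blast
    show "entrywise F s \<in> moment_seqs UNIV" if "\<And>l. s l \<in> bounded_moment_seqs \<rho> {0, 1}" for s
      using that sub(2) by (intro img) blast
    show "(F (r *\<^sub>R c))\<^sup>2 \<le> F c * F (r\<^sup>2 *\<^sub>R c)" if c: "c \<in> cube \<rho>" and r: "0 \<le> r" "r \<le> 1" for c r
    proof -
      define s where "s l k = c $ l * r ^ k + 0 * 0 ^ k" for l and k :: nat
      have "s l \<in> bounded_moment_seqs \<rho> {0..1}" for l
      proof -
        have "s l \<in> moment_seqs {r, 0}"
          unfolding s_def using c by (intro two_atom_moments) (auto simp: face_def)
        then have "s l \<in> moment_seqs {0..1}"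
          using moment_seqs_mono[of "{r, 0}" "{0..1}"] r by auto
        moreover have "- \<rho> < ereal (s l k) \<and> ereal (s l k) < \<rho>" for k
        proof -
          have "r ^ k *\<^sub>R c \<in> cube \<rho>"
            using c r by (intro cube_scale) (auto simp: power_le_one)
          then have "0 \<le> s l k" "ereal (s l k) < \<rho>"
            by (simp_all add: s_def face_def mult.commute)
          moreover have "- \<rho> < 0"
            using \<rho> by (simp add: ereal_uminus_less_reorder)
          ultimately show ?thesis
            using less_le_trans[of "- \<rho>" 0 "ereal (s l k)"] by simp
        qed
        ultimately show ?thesis
          by (simp add: bounded_moment_seqs_def)
      qed
      then have "(entrywise F s 1)\<^sup>2 \<le> entrywise F s 0 * entrywise F s 2"
        by (intro moment_seq_Cauchy_Schwarz img)
      moreover have "entrywise F s k = F (r ^ k *\<^sub>R c)" for k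
        unfolding entrywise_def by (rule arg_cong[of _ _ F]) (simp add: vec_eq_iff s_def)
      ultimately show ?thesis
        by simp
    qed
  qed (use assms(1,2) in auto)
  have 3: "cond1 \<and> cond2" if "cond3"
  proof -
    obtain g where g: "facewise_absolutely_monotonic \<rho> F g"
      "\<And>K J x. K \<subseteq> J \<Longrightarrow> x \<in> face \<rho> K \<Longrightarrow> face_extension \<rho> K (g K) x \<le> face_extension \<rho> J (g J) x"
      using \<open>cond3\<close> unfolding cond3_def by blast
    interpret monotone_facewise F \<rho> g
      using \<rho> g by unfold_locales
    have "cond2"
      unfolding cond2_def using preserves_moment_seqs by blast
    moreover have "cond1"
      unfolding cond1_def
    proof (intro conjI ballI image_subsetI)
      fix s assume "s \<in> Pi UNIV (\<lambda>l. bounded_moment_seqs \<rho> {1, y $ l}) \<union> Pi UNIV (\<lambda>_. bounded_moment_seqs \<rho> {0, 1})"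
      then have "s l \<in> bounded_moment_seqs \<rho> {0..1}" for l
        using sub by (auto simp: Pi_iff)
      then show "entrywise F s \<in> moment_seqs UNIV"
        using preserves_moment_seqs UNIV by blast
    qed (use geometric_mean_inequality in blast)
    ultimately show ?thesis
      by blast
  qed
  show ?thesis
    using 13 23 3 by blast
qed

end
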